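(* For $0<t\leq1$, let $\mu_t=\lim_{n\to\infty}\mathrm{law}(u_{11}+\ldots+u_{[tn][tn]})$, where $u$ is the fundamental $n\times n$ corepresentation of $A_h(n)$. The even moments of $\mu_t$ are given, for $k\ge1$, by $$\int x^{2k}\,d\mu_t(x)=\sum_{b=1}^k\frac1b\binom{k-1}{b-1}\binom{2k}{b-1}t^b,$$ and the odd moments of $\mu_t$ are zero.
   Context: $A_h(n)$ is the universal $C^*$-algebra generated by the entries $u_{ij}$ of an $n\times n$ cubic unitary matrix $u$: the $u_{ij}$ are self-adjoint, $u$ is unitary, and $u_{ij}u_{ik}=u_{ji}u_{ki}=0$ for all $i$ and $j\neq k$. It is a Hopf algebra (compact quantum group algebra) with $\Delta(u_{ij})=\sum_ku_{ik}\otimes u_{kj}$, and $\int:A_h(n)\to\mathbb C$ is its Haar functional (the unique bi-invariant state). The law of a self-adjoint element $a$ is the real probability measure $\mu$ with $\int a^k=\int_{\mathbb R}x^k\,d\mu(x)$ for all $k$; limits of laws are taken in moments. $[tn]$ is the integer part of $tn$. *)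

theory Defs
  imports "HOL-Probability.Probability" "HOL-Algebra.Module"
begin

section \<open>Unital C*-algebras with explicit carriers\<close>

text \<open>Explicit carriers rather than type classes are used because the algebras depend on \<open>n\<close>.\<close>

definition complex_field :: "complex ring" where
  "complex_field = \<lparr>carrier = UNIV, mult = (*), one = 1, zero = 0, add = (+)\<rparr>"

record 'a cstar = "(complex, 'a) module" +
  adj :: "'a \<Rightarrow> 'a"
  nrm :: "'a \<Rightarrow> real"

text \<open>The case distinction is there because the locale \<open>Metric_space\<close> constrains the
  distance function outside the carrier as well.\<close>

definition cdist :: "('a, 'm) cstar_scheme \<Rightarrow> 'a \<Rightarrow> 'a \<Rightarrow> real" where
  "cdist A x y = (if x \<in> carrier A \<and> y \<in> carrier A then nrm A (x \<ominus>\<^bsub>A\<^esub> y) else 0)"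

locale cstar_algebra = Ring.ring A for A :: "('a, 'm) cstar_scheme" (structure) +
  assumes complex_module: "Module.module complex_field A"
    and smult_mult_left: "\<lbrakk>x \<in> carrier A; y \<in> carrier A\<rbrakk> \<Longrightarrow> (c \<odot> x) \<otimes> y = c \<odot> (x \<otimes> y)"
    and smult_mult_right: "\<lbrakk>x \<in> carrier A; y \<in> carrier A\<rbrakk> \<Longrightarrow> x \<otimes> (c \<odot> y) = c \<odot> (x \<otimes> y)"
    and adj_closed: "x \<in> carrier A \<Longrightarrow> adj A x \<in> carrier A"
    and adj_adj: "x \<in> carrier A \<Longrightarrow> adj A (adj A x) = x"
    and adj_add: "\<lbrakk>x \<in> carrier A; y \<in> carrier A\<rbrakk> \<Longrightarrow> adj A (x \<oplus> y) = adj A x \<oplus> adj A y"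
    and adj_smult: "x \<in> carrier A \<Longrightarrow> adj A (c \<odot> x) = cnj c \<odot> adj A x"
    and adj_mult: "\<lbrakk>x \<in> carrier A; y \<in> carrier A\<rbrakk> \<Longrightarrow> adj A (x \<otimes> y) = adj A y \<otimes> adj A x"
    and nrm_nonneg: "x \<in> carrier A \<Longrightarrow> 0 \<le> nrm A x"
    and nrm_eq_0: "x \<in> carrier A \<Longrightarrow> nrm A x = 0 \<longleftrightarrow> x = \<zero>"
    and nrm_triangle: "\<lbrakk>x \<in> carrier A; y \<in> carrier A\<rbrakk> \<Longrightarrow> nrm A (x \<oplus> y) \<le> nrm A x + nrm A y"
    and nrm_smult: "x \<in> carrier A \<Longrightarrow> nrm A (c \<odot> x) = cmod c * nrm A x"
    and nrm_mult: "\<lbrakk>x \<in> carrier A; y \<in> carrier A\<rbrakk> \<Longrightarrow> nrm A (x \<otimes> y) \<le> nrm A x * nrm A y"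
    and cstar_identity: "x \<in> carrier A \<Longrightarrow> nrm A (adj A x \<otimes> x) = (nrm A x)\<^sup>2"
    and complete: "Metric_space.mcomplete (carrier A) (cdist A)"

definition cstar_subalgebra :: "('a, 'm) cstar_scheme \<Rightarrow> 'a set \<Rightarrow> bool" where
  "cstar_subalgebra A S \<longleftrightarrow>
     S \<subseteq> carrier A \<and> \<one>\<^bsub>A\<^esub> \<in> S \<and>
     (\<forall>x\<in>S. \<forall>y\<in>S. x \<oplus>\<^bsub>A\<^esub> y \<in> S \<and> x \<otimes>\<^bsub>A\<^esub> y \<in> S) \<and>
     (\<forall>x\<in>S. adj A x \<in> S \<and> (\<forall>c. c \<odot>\<^bsub>A\<^esub> x \<in> S)) \<and>
     closedin (Metric_space.mtopology (carrier A) (cdist A)) S"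

definition cstar_generates :: "('a, 'm) cstar_scheme \<Rightarrow> 'a set \<Rightarrow> bool" where
  "cstar_generates A X \<longleftrightarrow>
     X \<subseteq> carrier A \<and> (\<forall>S. cstar_subalgebra A S \<and> X \<subseteq> S \<longrightarrow> S = carrier A)"

definition star_hom :: "('a, 'm) cstar_scheme \<Rightarrow> ('b, 'k) cstar_scheme \<Rightarrow> ('a \<Rightarrow> 'b) set" where
  "star_hom A B = {f \<in> ring_hom A B.
     (\<forall>x\<in>carrier A. f (adj A x) = adj B (f x) \<and> (\<forall>c. f (c \<odot>\<^bsub>A\<^esub> x) = c \<odot>\<^bsub>B\<^esub> f x))}"

definition bounded_linear_map ::
    "('a, 'm) cstar_scheme \<Rightarrow> ('b, 'k) cstar_scheme \<Rightarrow> ('a \<Rightarrow> 'b) \<Rightarrow> bool" where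
  "bounded_linear_map A B f \<longleftrightarrow>
     f \<in> carrier A \<rightarrow> carrier B \<and>
     (\<forall>x\<in>carrier A. \<forall>y\<in>carrier A. f (x \<oplus>\<^bsub>A\<^esub> y) = f x \<oplus>\<^bsub>B\<^esub> f y) \<and>
     (\<forall>x\<in>carrier A. \<forall>c. f (c \<odot>\<^bsub>A\<^esub> x) = c \<odot>\<^bsub>B\<^esub> f x) \<and>
     (\<exists>C. \<forall>x\<in>carrier A. nrm B (f x) \<le> C * nrm A x)"

definition state :: "('a, 'm) cstar_scheme \<Rightarrow> ('a \<Rightarrow> complex) \<Rightarrow> bool" where
  "state A h \<longleftrightarrow>
     (\<forall>x\<in>carrier A. \<forall>y\<in>carrier A. h (x \<oplus>\<^bsub>A\<^esub> y) = h x + h y) \<and>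
     (\<forall>x\<in>carrier A. \<forall>c. h (c \<odot>\<^bsub>A\<^esub> x) = c * h x) \<and>
     (\<forall>x\<in>carrier A. h (adj A x \<otimes>\<^bsub>A\<^esub> x) \<in> \<real>\<^sub>\<ge>\<^sub>0) \<and>
     h \<one>\<^bsub>A\<^esub> = 1"


section \<open>C*-tensor products\<close>

text \<open>\<open>T\<close> with \<open>\<tau> a b\<close> in the role of \<open>a \<otimes> b\<close> is a completion of the algebraic tensor product
  of \<open>A\<close> and \<open>B\<close> in some C*-norm; the last clause says that the algebraic tensor product embeds
  into \<open>T\<close>. No particular norm is singled out: slice maps by states are bounded for all of
  them, so that invariance of a state does not depend on the choice.\<close>

definition lin_indep :: "('a, 'm) cstar_scheme \<Rightarrow> nat \<Rightarrow> (nat \<Rightarrow> 'a) \<Rightarrow> bool" where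
  "lin_indep A m b \<longleftrightarrow>
     (\<forall>c. (\<Oplus>\<^bsub>A\<^esub>i\<in>{..<m}. c i \<odot>\<^bsub>A\<^esub> b i) = \<zero>\<^bsub>A\<^esub> \<longrightarrow> (\<forall>i<m. c i = 0))"

definition cstar_tensor_product ::
    "('a, 'm) cstar_scheme \<Rightarrow> ('b, 'k) cstar_scheme \<Rightarrow> ('c, 'l) cstar_scheme
      \<Rightarrow> ('a \<Rightarrow> 'b \<Rightarrow> 'c) \<Rightarrow> bool" where
  "cstar_tensor_product A B T \<tau> \<longleftrightarrow>
     cstar_algebra T \<and>
     (\<forall>a\<in>carrier A. \<forall>a'\<in>carrier A. \<forall>b\<in>carrier B. \<tau> (a \<oplus>\<^bsub>A\<^esub> a') b = \<tau> a b \<oplus>\<^bsub>T\<^esub> \<tau> a' b) \<and>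
     (\<forall>a\<in>carrier A. \<forall>b\<in>carrier B. \<forall>b'\<in>carrier B. \<tau> a (b \<oplus>\<^bsub>B\<^esub> b') = \<tau> a b \<oplus>\<^bsub>T\<^esub> \<tau> a b') \<and>
     (\<forall>a\<in>carrier A. \<forall>b\<in>carrier B. \<forall>c. \<tau> (c \<odot>\<^bsub>A\<^esub> a) b = c \<odot>\<^bsub>T\<^esub> \<tau> a b \<and>
                                       \<tau> a (c \<odot>\<^bsub>B\<^esub> b) = c \<odot>\<^bsub>T\<^esub> \<tau> a b) \<and>
     (\<forall>a\<in>carrier A. \<forall>a'\<in>carrier A. \<forall>b\<in>carrier B. \<forall>b'\<in>carrier B.
        \<tau> a b \<otimes>\<^bsub>T\<^esub> \<tau> a' b' = \<tau> (a \<otimes>\<^bsub>A\<^esub> a') (b \<otimes>\<^bsub>B\<^esub> b')) \<and>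
     (\<forall>a\<in>carrier A. \<forall>b\<in>carrier B. adj T (\<tau> a b) = \<tau> (adj A a) (adj B b)) \<and>
     \<tau> \<one>\<^bsub>A\<^esub> \<one>\<^bsub>B\<^esub> = \<one>\<^bsub>T\<^esub> \<and>
     cstar_generates T {\<tau> a b | a b. a \<in> carrier A \<and> b \<in> carrier B} \<and>
     (\<forall>m a b. a \<in> {..<m} \<rightarrow> carrier A \<and> b \<in> {..<m} \<rightarrow> carrier B \<and> lin_indep B m b \<and>
        (\<Oplus>\<^bsub>T\<^esub>i\<in>{..<m}. \<tau> (a i) (b i)) = \<zero>\<^bsub>T\<^esub> \<longrightarrow> (\<forall>i<m. a i = \<zero>\<^bsub>A\<^esub>))"


section \<open>The algebras \<open>A_h(n)\<close>\<close>

definition unitary_matrix :: "('a, 'm) cstar_scheme \<Rightarrow> nat \<Rightarrow> (nat \<Rightarrow> nat \<Rightarrow> 'a) \<Rightarrow> bool" where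
  "unitary_matrix A n u \<longleftrightarrow>
     (\<forall>i\<in>{1..n}. \<forall>j\<in>{1..n}. u i j \<in> carrier A) \<and>
     (\<forall>i\<in>{1..n}. \<forall>j\<in>{1..n}.
        (\<Oplus>\<^bsub>A\<^esub>k\<in>{1..n}. u i k \<otimes>\<^bsub>A\<^esub> adj A (u j k)) = (if i = j then \<one>\<^bsub>A\<^esub> else \<zero>\<^bsub>A\<^esub>) \<and>
        (\<Oplus>\<^bsub>A\<^esub>k\<in>{1..n}. adj A (u k i) \<otimes>\<^bsub>A\<^esub> u k j) = (if i = j then \<one>\<^bsub>A\<^esub> else \<zero>\<^bsub>A\<^esub>))"

definition cubic_unitary :: "('a, 'm) cstar_scheme \<Rightarrow> nat \<Rightarrow> (nat \<Rightarrow> nat \<Rightarrow> 'a) \<Rightarrow> bool" where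
  "cubic_unitary A n u \<longleftrightarrow>
     unitary_matrix A n u \<and>
     (\<forall>i\<in>{1..n}. \<forall>j\<in>{1..n}. adj A (u i j) = u i j) \<and>
     (\<forall>i\<in>{1..n}. \<forall>j\<in>{1..n}. \<forall>k\<in>{1..n}. j \<noteq> k \<longrightarrow>
        u i j \<otimes>\<^bsub>A\<^esub> u i k = \<zero>\<^bsub>A\<^esub> \<and> u j i \<otimes>\<^bsub>A\<^esub> u k i = \<zero>\<^bsub>A\<^esub>)"

text \<open>The universal property is tested on C*-algebras \<open>B\<close> carried by the same type as \<open>A\<close>, which
  is no restriction if \<open>A\<close> is nonzero: then the type has at least continuum many elements, while
  the C*-subalgebra of an arbitrary \<open>B\<close> generated by finitely many elements has at most
  continuum many, hence is isomorphic to one carried by this type. The homomorphism is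
  unique because the \<open>u i j\<close> generate.\<close>

definition is_A_h :: "nat \<Rightarrow> 'a cstar \<Rightarrow> (nat \<Rightarrow> nat \<Rightarrow> 'a) \<Rightarrow> bool" where
  "is_A_h n A u \<longleftrightarrow>
     cstar_algebra A \<and> cubic_unitary A n u \<and>
     cstar_generates A {u i j | i j. i \<in> {1..n} \<and> j \<in> {1..n}} \<and>
     (\<forall>(B :: 'a cstar) v. cstar_algebra B \<and> cubic_unitary B n v \<longrightarrow>
        (\<exists>f \<in> star_hom A B. \<forall>i\<in>{1..n}. \<forall>j\<in>{1..n}. f (u i j) = v i j))"

definition is_comult ::
    "nat \<Rightarrow> ('a, 'm) cstar_scheme \<Rightarrow> (nat \<Rightarrow> nat \<Rightarrow> 'a) \<Rightarrow> ('c, 'l) cstar_scheme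
      \<Rightarrow> ('a \<Rightarrow> 'a \<Rightarrow> 'c) \<Rightarrow> ('a \<Rightarrow> 'c) \<Rightarrow> bool" where
  "is_comult n A u T \<tau> \<Delta> \<longleftrightarrow>
     \<Delta> \<in> star_hom A T \<and>
     (\<forall>i\<in>{1..n}. \<forall>j\<in>{1..n}. \<Delta> (u i j) = (\<Oplus>\<^bsub>T\<^esub>k\<in>{1..n}. \<tau> (u i k) (u k j)))"

text \<open>\<open>L\<close> and \<open>R\<close> are the slice maps \<open>h \<otimes> id\<close> and \<open>id \<otimes> h\<close>.\<close>

definition is_haar ::
    "('a, 'm) cstar_scheme \<Rightarrow> ('c, 'l) cstar_scheme \<Rightarrow> ('a \<Rightarrow> 'a \<Rightarrow> 'c) \<Rightarrow> ('a \<Rightarrow> 'c)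
      \<Rightarrow> ('a \<Rightarrow> complex) \<Rightarrow> bool" where
  "is_haar A T \<tau> \<Delta> h \<longleftrightarrow>
     state A h \<and>
     (\<exists>L. bounded_linear_map T A L \<and>
          (\<forall>a\<in>carrier A. \<forall>b\<in>carrier A. L (\<tau> a b) = h a \<odot>\<^bsub>A\<^esub> b) \<and>
          (\<forall>a\<in>carrier A. L (\<Delta> a) = h a \<odot>\<^bsub>A\<^esub> \<one>\<^bsub>A\<^esub>)) \<and>
     (\<exists>R. bounded_linear_map T A R \<and>
          (\<forall>a\<in>carrier A. \<forall>b\<in>carrier A. R (\<tau> a b) = h b \<odot>\<^bsub>A\<^esub> a) \<and>
          (\<forall>a\<in>carrier A. R (\<Delta> a) = h a \<odot>\<^bsub>A\<^esub> \<one>\<^bsub>A\<^esub>))"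


section \<open>Laws and their limits\<close>

definition is_law ::
    "('a, 'm) cstar_scheme \<Rightarrow> ('a \<Rightarrow> complex) \<Rightarrow> 'a \<Rightarrow> real measure \<Rightarrow> bool" where
  "is_law A h a \<mu> \<longleftrightarrow>
     real_distribution \<mu> \<and>
     (\<forall>k::nat. integrable \<mu> (\<lambda>x. x ^ k) \<and>
        h (a [^]\<^bsub>A\<^esub> k) = complex_of_real (\<integral>x. x ^ k \<partial>\<mu>))"

definition law ::
    "('a, 'm) cstar_scheme \<Rightarrow> ('a \<Rightarrow> complex) \<Rightarrow> 'a \<Rightarrow> real measure" where
  "law A h a = (THE \<mu>. is_law A h a \<mu>)"

definition converges_in_moments :: "(nat \<Rightarrow> real measure) \<Rightarrow> real measure \<Rightarrow> bool" where
  "converges_in_moments \<nu> \<mu> \<longleftrightarrow>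
     real_distribution \<mu> \<and>
     (\<forall>k::nat. integrable \<mu> (\<lambda>x. x ^ k) \<and>
        (\<lambda>n. \<integral>x. x ^ k \<partial>\<nu> n) \<longlonglongrightarrow> (\<integral>x. x ^ k \<partial>\<mu>))"

definition partial_trace ::
    "('a, 'm) cstar_scheme \<Rightarrow> (nat \<Rightarrow> nat \<Rightarrow> 'a) \<Rightarrow> nat \<Rightarrow> 'a" where
  "partial_trace A u s = (\<Oplus>\<^bsub>A\<^esub>i\<in>{1..s}. u i i)"

end

theory Submission
  imports Defs "HOL-Library.FuncSet" "HOL-Computational_Algebra.Formal_Power_Series"
begin

text \<open>
  The Haar functional applied to words of length \<open>k\<close> in the generators gives the matrix of the
  orthogonal projection onto the vectors fixed by the \<open>k\<close>-th tensor power of \<open>u\<close>. For \<open>n \<ge> k + 2\<close>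
  these vectors are spanned by the indicators of the noncrossing partitions all of whose blocks are
  even: averaging over signed permutations leaves only even partitions, and a cubic unitary of
  2-by-2 matrices built from two noncommuting reflections excludes the crossing ones. Hence the
  \<open>k\<close>-th moment of the partial trace is a sum of entries of the inverse of the Gram matrix against
  numbers of words. The Gram matrix, normalised by \<open>n\<close> to the power of half the numbers of blocks,
  tends to the identity, so the limit of the moment is the sum of \<open>t\<close> to the number of blocks over
  these partitions. Cutting off the block of the first point gives an algebraic equation for their
  generating function, and Lagrange inversion gives the coefficients. The laws and their limit
  exist as solutions of moment problems of exponential growth.
\<close>

section \<open>The moment problem for sequences of exponential growth\<close>

text \<open>The fixed vectors of the tensor powers of \<open>u\<close> are not computed inside
  \<open>A\<close> but enclosed from two sides: the relations of a cubic unitary show that every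
  noncrossing even partition gives a fixed vector (\<open>even_code_fixed\<close>), and models by
  2-by-2 matrices show that nothing else is fixed (\<open>common_fixed_span\<close>). Invariance
  under the two slice maps then ties the Haar coefficients to this span. Small models are forced by
  the universal property, which only speaks of algebras on the type of \<open>A\<close>: a nonzero
  \<open>A\<close> contains a copy of the complex numbers, and that leaves room for 2-by-2 matrices.
  The condition \<open>k + 2 \<le> n\<close> comes from the crossing argument, which pairs the two
  crossing letters with two letters outside a word that has at most \<open>k\<close> letters. Since
  \<open>law\<close> is a definite description and the limit is claimed to be unique, moments must
  be shown to come from exactly one measure, for each \<open>n\<close> and in the limit; the
  necessary bounds come from positivity and the row relations.\<close>

locale positive_functional =
  fixes L :: "real poly \<Rightarrow> real"
  assumes add: "L (p + q) = L p + L q"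
    and smult: "L (Polynomial.smult c p) = c * L p"
    and square: "0 \<le> L (p * p)"
begin

lemma zero [simp]: "L 0 = 0"
  using smult[of 0 0] by simp

lemma diff: "L (p - q) = L p - L q"
  using add[of p "- q"] smult[of "-1" q] by simp

lemma sum: "L (\<Sum>i\<in>A. f i) = (\<Sum>i\<in>A. L (f i))"
  by (induction A rule: infinite_finite_induct) (auto simp: add)

lemma one_nonneg: "0 \<le> L 1"
  using square[of 1] by simp

lemma cauchy_schwarz: "(L p)\<^sup>2 \<le> L 1 * L (p * p)"
proof -
  have expand: "0 \<le> a\<^sup>2 * L (p * p) - 2 * a * b * L p + b\<^sup>2 * L 1" for a b
  proof -
    have "(Polynomial.smult a p - Polynomial.smult b 1) * (Polynomial.smult a p - Polynomial.smult b 1) =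
        Polynomial.smult (a\<^sup>2) (p * p) - Polynomial.smult (2 * a * b) p + Polynomial.smult (b\<^sup>2) 1"
      by (simp add: poly_eq_poly_eq_iff[symmetric] fun_eq_iff algebra_simps power2_eq_square)
    with square[of "Polynomial.smult a p - Polynomial.smult b 1"] show ?thesis
      by (simp only: add diff smult)
  qed
  show ?thesis
  proof (cases "L 1 = 0")
    case True
    have "L p = 0"
    proof (rule ccontr)
      assume "L p \<noteq> 0"
      \<comment> \<open>In the degenerate case this coefficient makes the quadratic expression equal
        to -1.\<close>
      moreover have "0 \<le> L (p * p) - 2 * ((L (p * p) + 1) / (2 * L p)) * L p"
        using expand[of 1 "(L (p * p) + 1) / (2 * L p)"] True by simp
      ultimately show False by (simp add: field_simps)
    qed
    with True show ?thesis by simp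
  next
    case False
    with one_nonneg have "0 < L 1" by simp
    have "0 \<le> L 1 * (L 1 * L (p * p) - (L p)\<^sup>2)"
      using expand[of "L 1" "L p"] by (simp add: algebra_simps power2_eq_square)
    with \<open>0 < L 1\<close> show ?thesis by (simp add: zero_le_mult_iff)
  qed
qed

text \<open>Cauchy-Schwarz along the exponents \<open>2 ^ j\<close> gives
  \<open>r ^ 2 ^ j * L 1 \<le> \<bar>L (y ^ 2 ^ j)\<bar>\<close> for
  \<open>r = \<bar>L y\<bar> / L 1\<close>, so that \<open>r > R\<close> would outgrow
  \<open>C * R ^ k\<close>. The constant is absorbed by the growth of the exponents; hence the lemma
  applies to functionals weighted by a square, whose constants vary with the square.\<close>

lemma growth_bound:
  assumes growth: "\<And>k. \<bar>L (y ^ k)\<bar> \<le> C * R ^ k" and "0 < R"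
  shows "\<bar>L y\<bar> \<le> R * L 1"
proof (cases "L 1 = 0")
  case True
  with cauchy_schwarz[of y] show ?thesis by simp
next
  case False
  with one_nonneg have pos: "0 < L 1" by simp
  define r where "r = \<bar>L y\<bar> / L 1"
  have pow: "r ^ 2 ^ j * L 1 \<le> \<bar>L (y ^ 2 ^ j)\<bar>" for j
  proof (induction j)
    case 0
    then show ?case using pos by (simp add: r_def)
  next
    case (Suc j)
    have "(r ^ 2 ^ j * L 1)\<^sup>2 \<le> \<bar>L (y ^ 2 ^ j)\<bar>\<^sup>2"
      using Suc pos by (intro power_mono) (auto simp: r_def)
    also have "\<dots> \<le> L 1 * L (y ^ 2 ^ j * y ^ 2 ^ j)"
      using cauchy_schwarz[of "y ^ 2 ^ j"] by simp
    also have "y ^ 2 ^ j * y ^ 2 ^ j = y ^ 2 ^ Suc j"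
      by (simp add: power_add[symmetric] mult_2)
    finally have "L 1 * (r ^ 2 ^ Suc j * L 1) \<le> L 1 * L (y ^ 2 ^ Suc j)"
      by (simp add: power2_eq_square power_add mult_2 algebra_simps)
    with pos show ?case by simp
  qed
  have "r \<le> R"
  proof (rule ccontr)
    assume "\<not> r \<le> R"
    define q where "q = r / R"
    have q: "1 < q" using \<open>\<not> r \<le> R\<close> \<open>0 < R\<close> by (simp add: q_def field_simps)
    have bound: "q ^ 2 ^ j \<le> C / L 1" for j
    proof -
      have "r ^ 2 ^ j * L 1 \<le> C * R ^ 2 ^ j"
        using pow[of j] growth[of "2 ^ j"] by linarith
      then show ?thesis using pos \<open>0 < R\<close> by (simp add: q_def power_divide field_simps)
    qed
    obtain N where N: "C / L 1 < q ^ N" using real_arch_pow[OF q] by blast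
    have "N \<le> 2 ^ N" by (rule less_imp_le[OF less_exp])
    then have "q ^ N \<le> q ^ 2 ^ N" using q by (intro power_increasing) auto
    with N bound[of N] show False by simp
  qed
  with pos show ?thesis by (simp add: r_def field_simps)
qed

end

section \<open>Bernstein polynomials and the Hausdorff moment problem on the unit interval\<close>

lemma bernstein_binomial_sum:
  fixes x :: "'a::comm_ring_1"
  assumes "k \<le> N"
  shows "(\<Sum>j\<le>N. of_nat (j choose k) * (of_nat (N choose j) * x ^ j * (1 - x) ^ (N - j))) =
    of_nat (N choose k) * x ^ k"
proof -
  have "(\<Sum>j\<le>N. of_nat (j choose k) * (of_nat (N choose j) * x ^ j * (1 - x) ^ (N - j))) =
      (\<Sum>j\<in>{k..N}. of_nat (j choose k) * (of_nat (N choose j) * x ^ j * (1 - x) ^ (N - j)))"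
    by (rule sum.mono_neutral_right) (auto simp: not_le binomial_eq_0)
  also have "\<dots> = (\<Sum>i\<in>{0..N - k}. of_nat ((i + k) choose k) *
      (of_nat (N choose (i + k)) * x ^ (i + k) * (1 - x) ^ (N - (i + k))))"
    using sum.shift_bounds_cl_nat_ivl[of _ 0 k "N - k"] assms by simp
  also have "\<dots> = (\<Sum>i\<in>{0..N - k}. of_nat (N choose k) * x ^ k *
      (of_nat ((N - k) choose i) * x ^ i * (1 - x) ^ (N - k - i)))"
  proof (rule sum.cong[OF refl])
    fix i assume "i \<in> {0..N - k}"
    then have "(N choose (i + k)) * ((i + k) choose k) = (N choose k) * ((N - k) choose i)"
      using choose_mult[of k "i + k" N] assms by simp
    then have "of_nat ((i + k) choose k) * of_nat (N choose (i + k)) =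
        (of_nat (N choose k) * of_nat ((N - k) choose i) :: 'a)"
      by (metis of_nat_mult mult.commute)
    then show "of_nat ((i + k) choose k) *
        (of_nat (N choose (i + k)) * x ^ (i + k) * (1 - x) ^ (N - (i + k))) =
        of_nat (N choose k) * x ^ k * (of_nat ((N - k) choose i) * x ^ i * (1 - x) ^ (N - k - i))"
      by (simp add: power_add algebra_simps) (metis mult.assoc mult.left_commute)
  qed
  also have "\<dots> = of_nat (N choose k) * x ^ k * (x + (1 - x)) ^ (N - k)"
    by (simp only: sum_distrib_left[symmetric] binomial_ring atMost_atLeast0)
  finally show ?thesis by simp
qed

text \<open>Both terms are products of \<open>k\<close> factors, \<open>j / N\<close> and
  \<open>(j - i) / (N - i)\<close>, and are compared factor by factor. The condition
  \<open>2 * k < N\<close> keeps every factor at most 1 in absolute value, also those with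
  \<open>j < i\<close>.\<close>

lemma binomial_ratio_approx:
  assumes "2 * k < N" and "j \<le> N"
  shows "\<bar>(real j / real N) ^ k - real (j choose k) / real (N choose k)\<bar> \<le> real k * (real k / real (N - k))"
proof -
  have "real (j choose k) / real (N choose k) = (\<Prod>i\<in>{0..<k}. (real j - real i) / (real N - real i))"
    by (simp add: binomial_gbinomial gbinomial_altdef_of_nat prod_dividef[symmetric])
  moreover have "(real j / real N) ^ k = (\<Prod>i\<in>{0..<k}. real j / real N)"
    by simp
  moreover have "norm ((\<Prod>i\<in>{0..<k}. real j / real N) - (\<Prod>i\<in>{0..<k}. (real j - real i) / (real N - real i)))
      \<le> (\<Sum>i\<in>{0..<k}. norm (real j / real N - (real j - real i) / (real N - real i)))"
    using assms by (intro norm_prod_diff) (auto simp: field_simps abs_le_iff)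
  moreover have "\<dots> \<le> (\<Sum>i\<in>{0..<k}. real k / real (N - k))"
  proof (rule sum_mono)
    fix i assume i: "i \<in> {0..<k}"
    have "real j / real N - (real j - real i) / (real N - real i) =
        real i / (real N - real i) * ((real N - real j) / real N)"
      using assms i by (simp add: field_simps)
    moreover have "\<bar>(real N - real j) / real N\<bar> \<le> 1"
      using assms by (simp add: field_simps)
    moreover have "\<bar>real i / (real N - real i)\<bar> \<le> real k / real (N - k)"
    proof -
      have "\<bar>real i / (real N - real i)\<bar> = real i / (real N - real i)"
        using assms i by simp
      also have "\<dots> \<le> real k / real (N - k)"
        using assms i by (intro frac_le) (auto simp: of_nat_diff)
      finally show ?thesis .
    qed
    ultimately show "norm (real j / real N - (real j - real i) / (real N - real i)) \<le> real k / real (N - k)"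
      using mult_mono[of "\<bar>real i / (real N - real i)\<bar>" "real k / real (N - k)"
          "\<bar>(real N - real j) / real N\<bar>" 1]
      by (simp only: real_norm_def abs_mult mult_1_right) simp
  qed
  ultimately show ?thesis by simp
qed

text \<open>Weak convergence tests bounded continuous functions, so powers are replaced by powers of
  the retraction \<open>clip\<close> onto the interval. The function \<open>f\<close> is the
  distance to the interval, truncated at 1; its integral vanishes along the sequence, hence in the
  limit.\<close>

lemma weak_limit_concentrated_unit_interval:
  assumes dist: "\<And>n. real_distribution (\<mu> n)" "real_distribution M"
    and weak: "weak_conv_m \<mu> M"
    and supp: "\<And>n. AE x in \<mu> n. x \<in> {0..1}"
  shows "AE x in M. x \<in> {0..1}"
    and "(\<lambda>n. \<integral>x. x ^ k \<partial>\<mu> n) \<longlonglongrightarrow> (\<integral>x. x ^ k \<partial>M)"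
proof -
  interpret M: real_distribution M by (rule dist)
  define clip :: "real \<Rightarrow> real" where "clip x = max 0 (min 1 x)" for x
  have cont: "isCont clip x" for x
    unfolding clip_def by (intro continuous_intros)
  have meas [measurable]: "clip \<in> borel_measurable borel"
    using cont by (intro borel_measurable_continuous_onI) (simp add: continuous_at_imp_continuous_on)
  have clip_id: "clip x = x" if "x \<in> {0..1}" for x
    using that by (auto simp: clip_def)
  have clip_bounds: "0 \<le> clip x" "clip x \<le> 1" for x
    by (auto simp: clip_def)
  define f where "f x = min 1 \<bar>x - clip x\<bar>" for x
  have [measurable]: "f \<in> borel_measurable borel"
    unfolding f_def by measurable
  have "(\<lambda>n. \<integral>x. f x \<partial>\<mu> n) \<longlonglongrightarrow> (\<integral>x. f x \<partial>M)"
    by (rule weak_conv_imp_integral_bdd_continuous_conv[OF dist weak, where B = 1])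
      (auto simp: f_def intro!: continuous_intros cont)
  moreover have "(\<integral>x. f x \<partial>\<mu> n) = 0" for n
    by (rule integral_eq_zero_AE) (use supp[of n] in eventually_elim, simp add: f_def clip_id)
  ultimately have "(\<integral>x. f x \<partial>M) = 0"
    by (simp add: LIMSEQ_const_iff)
  moreover have "integrable M f"
    by (rule M.integrable_const_bound[where B = 1]) (auto simp: f_def)
  ultimately have "AE x in M. f x = 0"
    by (subst (asm) integral_nonneg_eq_0_iff_AE) (auto simp: f_def)
  then show supp_M: "AE x in M. x \<in> {0..1}"
  proof eventually_elim
    case (elim x)
    then have "clip x = x"
      by (simp add: f_def min_def split: if_splits)
    then show ?case
      using clip_bounds[of x] by (metis atLeastAtMost_iff)
  qed
  have "(\<lambda>n. \<integral>x. clip x ^ k \<partial>\<mu> n) \<longlonglongrightarrow> (\<integral>x. clip x ^ k \<partial>M)"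
  proof (rule weak_conv_imp_integral_bdd_continuous_conv[OF dist weak, where B = 1])
    show "isCont (\<lambda>x. clip x ^ k) x" for x
      by (intro isCont_power cont)
    show "norm (clip x ^ k) \<le> 1" for x
      using power_le_one[OF clip_bounds] clip_bounds(1)[of x] by simp
  qed
  moreover have "(\<integral>x. clip x ^ k \<partial>\<mu> n) = (\<integral>x. x ^ k \<partial>\<mu> n)" for n
  proof -
    interpret real_distribution "\<mu> n" by (rule dist)
    have "AE x in \<mu> n. clip x ^ k = x ^ k"
      using supp[of n] by eventually_elim (simp add: clip_id)
    then show ?thesis
      by (intro integral_cong_AE) simp_all
  qed
  moreover have "(\<integral>x. clip x ^ k \<partial>M) = (\<integral>x. x ^ k \<partial>M)"
  proof -
    have "AE x in M. clip x ^ k = x ^ k"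
      using supp_M by eventually_elim (simp add: clip_id)
    then show ?thesis
      by (intro integral_cong_AE) simp_all
  qed
  ultimately show "(\<lambda>n. \<integral>x. x ^ k \<partial>\<mu> n) \<longlonglongrightarrow> (\<integral>x. x ^ k \<partial>M)"
    by simp
qed

lemma integrable_power_unit_interval:
  assumes "real_distribution M" and "AE x in M. x \<in> {0..1::real}"
  shows "integrable M (\<lambda>x. x ^ k)"
proof -
  interpret real_distribution M by fact
  have "AE x in M. norm (x ^ k) \<le> 1"
    using assms(2) by eventually_elim (simp add: power_le_one)
  then show ?thesis
    by (rule integrable_const_bound) simp
qed

text \<open>The measures charging \<open>j / N\<close> with the mass that the functional gives to the
  \<open>j\<close>-th Bernstein polynomial of degree \<open>N\<close> are tight, and any weak limit has the right moments.\<close>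

theorem (in positive_functional) hausdorff_moment:
  assumes one: "L 1 = 1"
    and bernstein: "\<And>N j. j \<le> N \<Longrightarrow> 0 \<le> L ([:0, 1:] ^ j * (1 - [:0, 1:]) ^ (N - j))"
  shows "\<exists>M. real_distribution M \<and> (AE x in M. x \<in> {0..1}) \<and>
    (\<forall>k. (\<integral>x. x ^ k \<partial>M) = L ([:0, 1:] ^ k))"
proof -
  let ?X = "[:0, 1:] :: real poly"
  define w where "w N j = (if j \<le> N then real (N choose j) * L (?X ^ j * (1 - ?X) ^ (N - j)) else 0)"
    for N j
  have w_nonneg: "0 \<le> w N j" for N j
    using bernstein by (simp add: w_def)
  have w_eq: "w N j = L (of_nat (N choose j) * ?X ^ j * (1 - ?X) ^ (N - j))" if "j \<le> N" for N j
    using that by (simp add: w_def of_nat_poly mult.assoc smult)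
  \<comment> \<open>Factorial moments of the binomial law, read in the ring of polynomials with the
    variable as success probability. They are exact for every \<open>N\<close>, whereas ordinary
    moments are only reached in the limit.\<close>
  have w_binomial: "(\<Sum>j\<le>N. real (j choose k) * w N j) = real (N choose k) * L (?X ^ k)"
    if "k \<le> N" for N k
  proof -
    have "(\<Sum>j\<le>N. real (j choose k) * w N j) =
        L (\<Sum>j\<le>N. of_nat (j choose k) * (of_nat (N choose j) * ?X ^ j * (1 - ?X) ^ (N - j)))"
      by (simp add: sum w_eq of_nat_poly smult mult_ac)
    also have "\<dots> = real (N choose k) * L (?X ^ k)"
      by (subst bernstein_binomial_sum[OF that]) (simp add: of_nat_poly smult)
    finally show ?thesis .
  qed
  have w_sum: "(\<Sum>j\<le>N. w N j) = 1" for N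
    using w_binomial[of 0 N] one by (simp add: one_pCons)
  define P where "P N = embed_pmf (w N)" for N
  have pmf_P: "pmf (P N) j = w N j" for N j
    unfolding P_def
  proof (rule pmf_embed_pmf)
    have "(\<integral>\<^sup>+x. ennreal (w N x) \<partial>count_space UNIV) = (\<Sum>j\<le>N. ennreal (w N j))"
      by (rule nn_integral_count_space'[where A = "{..N}"]) (auto simp: w_def w_nonneg split: if_splits)
    then show "(\<integral>\<^sup>+x. ennreal (w N x) \<partial>count_space UNIV) = 1"
      by (simp add: sum_ennreal w_nonneg w_sum)
  qed (rule w_nonneg)
  have set_P: "set_pmf (P N) \<subseteq> {..N}" for N
    by (auto simp: set_pmf_iff pmf_P w_def split: if_splits)
  define \<mu> where "\<mu> N = distr (measure_pmf (P N)) borel (\<lambda>j. real j / real N)" for N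
  have dist: "real_distribution (\<mu> N)" for N
    unfolding \<mu>_def by (rule prob_space.real_distribution_distr) (auto intro: measure_pmf.prob_space_axioms)
  have supp: "AE x in \<mu> N. x \<in> {0..1}" for N
    unfolding \<mu>_def
    by (subst AE_distr_iff, simp, simp)
      (auto simp: AE_measure_pmf_iff divide_le_eq dest: subsetD[OF set_P])
  have moment: "(\<integral>x. x ^ k \<partial>\<mu> N) = (\<Sum>j\<le>N. (real j / real N) ^ k * w N j)" for k N
    unfolding \<mu>_def
    by (subst integral_distr, simp, simp)
      (subst integral_measure_pmf_real[where A = "{..N}"], use set_P in \<open>auto simp: pmf_P\<close>)
  have moment_lim: "(\<lambda>N. \<integral>x. x ^ k \<partial>\<mu> N) \<longlonglongrightarrow> L (?X ^ k)" for k
  proof (rule LIM_zero_cancel, rule Lim_null_comparison)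
    show "(\<lambda>N. real k * (real k / real (N - k))) \<longlonglongrightarrow> 0"
    proof (rule LIMSEQ_offset[where k = k])
      show "(\<lambda>N. real k * (real k / real (N + k - k))) \<longlonglongrightarrow> 0"
        using tendsto_mult[OF tendsto_const lim_const_over_n[of "real k"], of "real k"] by simp
    qed
    show "\<forall>\<^sub>F N in sequentially. norm ((\<integral>x. x ^ k \<partial>\<mu> N) - L (?X ^ k)) \<le> real k * (real k / real (N - k))"
      using eventually_gt_at_top[of "2 * k"]
    proof eventually_elim
      case (elim N)
      \<comment> \<open>The target is an average against the same masses, so the error is bounded by
        the uniform distance of the two integrands.\<close>
      have "L (?X ^ k) = (\<Sum>j\<le>N. real (j choose k) / real (N choose k) * w N j)"
        using w_binomial[of k N] elim
        by (simp add: sum_divide_distrib[symmetric] field_simps)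
      then have "(\<integral>x. x ^ k \<partial>\<mu> N) - L (?X ^ k) =
          (\<Sum>j\<le>N. ((real j / real N) ^ k - real (j choose k) / real (N choose k)) * w N j)"
        by (simp add: moment sum_subtractf[symmetric] left_diff_distrib)
      also have "norm \<dots> \<le> (\<Sum>j\<le>N. real k * (real k / real (N - k)) * w N j)"
      proof (rule sum_norm_le)
        fix j assume "j \<in> {..N}"
        then show "norm (((real j / real N) ^ k - real (j choose k) / real (N choose k)) * w N j)
            \<le> real k * (real k / real (N - k)) * w N j"
          using mult_right_mono[OF binomial_ratio_approx[OF elim, of j] w_nonneg[of N j]]
          by (simp only: real_norm_def abs_mult abs_of_nonneg[OF w_nonneg] atMost_iff)
      qed
      also have "\<dots> = real k * (real k / real (N - k))"
        by (simp only: sum_distrib_left[symmetric] w_sum mult_1_right)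
      finally show ?case .
    qed
  qed
  have tight: "tight \<mu>"
    unfolding tight_def
  proof (intro conjI allI impI)
    fix \<epsilon> :: real assume "0 < \<epsilon>"
    have "measure (\<mu> n) {-1<..2} = 1" for n
    proof -
      interpret real_distribution "\<mu> n" by (rule dist)
      have "AE x in \<mu> n. x \<in> {-1<..2}"
        using supp[of n] by eventually_elim simp
      then show ?thesis
        by (subst prob_eq_1) simp_all
    qed
    then show "\<exists>a b. a < b \<and> (\<forall>n. 1 - \<epsilon> < measure (\<mu> n) {a<..b})"
      using \<open>0 < \<epsilon>\<close> by (intro exI[of _ "-1"] exI[of _ 2]) simp
  qed (rule dist)
  obtain r M where r: "strict_mono (r :: nat \<Rightarrow> nat)" and M: "real_distribution M"
    and weak: "weak_conv_m (\<lambda>n. \<mu> (r n)) M"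
    using tight_imp_convergent_subsubsequence[OF tight strict_mono_id] by (auto simp: comp_def)
  note limit = weak_limit_concentrated_unit_interval[where \<mu> = "\<lambda>n. \<mu> (r n)", OF dist M weak supp]
  have "(\<integral>x. x ^ k \<partial>M) = L (?X ^ k)" for k
  proof (rule LIMSEQ_unique[OF limit(2)])
    show "(\<lambda>n. \<integral>x. x ^ k \<partial>\<mu> (r n)) \<longlonglongrightarrow> L (?X ^ k)"
      using LIMSEQ_subseq_LIMSEQ[OF moment_lim r] by (simp add: comp_def)
  qed
  with M limit(1) show ?thesis by blast
qed

text \<open>Growth confines the functional to \<open>[-R', R']\<close>: functionals weighted by
  squares are positive with growth of the same base, so \<open>growth_bound\<close> compares
  \<open>X\<close> and \<open>X ^ 2\<close> with \<open>R'\<close> and \<open>R' ^ 2\<close>. After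
  an affine change of variable this is the positivity on Bernstein polynomials that the Hausdorff
  problem requires.\<close>

lemma moment_sequence_measure:
  fixes m :: "nat \<Rightarrow> real"
  assumes m0: "m 0 = 1"
    and hankel: "\<And>N c. 0 \<le> (\<Sum>i\<le>N. \<Sum>j\<le>N. c i * c j * m (i + j))"
    and growth: "\<And>k. \<bar>m k\<bar> \<le> C * R ^ k"
  shows "\<exists>M. real_distribution M \<and> (\<forall>k. integrable M (\<lambda>x. x ^ k) \<and> (\<integral>x. x ^ k \<partial>M) = m k)"
proof -
  \<comment> \<open>\<open>R\<close> may be zero or negative, whereas \<open>R'\<close> serves as a
    divisor and as half the length of an interval.\<close>
  define R' where "R' = max 1 \<bar>R\<bar>"
  have R': "1 \<le> R'" by (simp add: R'_def)
  have C: "0 \<le> C" using growth[of 0] m0 by simp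
  have growth': "\<bar>m k\<bar> \<le> C * R' ^ k" for k
  proof -
    have "R ^ k \<le> \<bar>R\<bar> ^ k" by (metis abs_ge_self power_abs)
    also have "\<dots> \<le> R' ^ k" by (intro power_mono) (auto simp: R'_def)
    finally show ?thesis using growth[of k] C by (meson mult_left_mono order_trans)
  qed
  define L where "L p = (\<Sum>i\<le>degree p. coeff p i * m i)" for p :: "real poly"
  have L_upto: "L p = (\<Sum>i\<le>N. coeff p i * m i)" if "degree p \<le> N" for p N
    unfolding L_def using that by (intro sum.mono_neutral_left) (auto simp: coeff_eq_0 not_le)
  have L_square: "L (p * p) = (\<Sum>i\<le>degree p. \<Sum>j\<le>degree p. coeff p i * coeff p j * m (i + j))" for p
  proof -
    let ?d = "degree p"
    have "L (p * p) = (\<Sum>k\<le>?d + ?d. (\<Sum>i\<le>k. coeff p i * coeff p (k - i)) * m k)"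
      by (subst L_upto[of _ "?d + ?d"]) (auto simp: degree_mult_le coeff_mult)
    also have "\<dots> = (\<Sum>k\<le>?d + ?d. \<Sum>i\<le>k. coeff p i * coeff p (k - i) * m (i + (k - i)))"
      by (simp add: sum_distrib_right)
    also have "\<dots> = (\<Sum>(i, j)\<in>{(i, j). i + j \<le> ?d + ?d}. coeff p i * coeff p j * m (i + j))"
      by (subst sum.triangle_reindex_eq[symmetric]) simp
    also have "\<dots> = (\<Sum>(i, j)\<in>{..?d} \<times> {..?d}. coeff p i * coeff p j * m (i + j))"
    proof (rule sum.mono_neutral_right)
      show "finite {(i, j). i + j \<le> ?d + ?d}"
        by (rule finite_subset[of _ "{..?d + ?d} \<times> {..?d + ?d}"]) auto
    qed (auto intro: le_degree)
    finally show ?thesis by (simp add: sum.cartesian_product)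
  qed
  interpret L: positive_functional L
  proof
    fix p q :: "real poly" and c
    let ?N = "max (degree p) (degree q)"
    show "L (p + q) = L p + L q"
      using L_upto[of "p + q" ?N] L_upto[of p ?N] L_upto[of q ?N]
      by (simp add: degree_add_le_max sum.distrib distrib_right)
    show "L (Polynomial.smult c p) = c * L p"
      using L_upto[of "Polynomial.smult c p" "degree p"]
      by (simp add: L_def degree_smult_le sum_distrib_left mult.assoc)
    show "0 \<le> L (p * p)"
      using hankel unfolding L_square .
  qed
  let ?X = "[:0, 1:] :: real poly"
  have X_pow: "?X ^ k = monom 1 k" for k
    by (simp add: monom_altdef)
  have L_X: "L (?X ^ k) = m k" for k
    by (simp add: X_pow L_def degree_monom_eq) (simp add: coeff_monom if_distrib[of "\<lambda>x. x * _"] sum.delta cong: if_cong)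
  have L_1: "L 1 = 1" using L_X[of 0] m0 by simp
  have shift_growth: "\<exists>C'. \<forall>k. \<bar>L (?X ^ k * q)\<bar> \<le> C' * R' ^ k" for q
  proof (intro exI allI)
    fix k
    have "?X ^ k * q = (\<Sum>i\<le>degree q. Polynomial.smult (coeff q i) (?X ^ (k + i)))"
      by (subst poly_as_sum_of_monoms[symmetric])
        (simp add: X_pow sum_distrib_left mult_monom Polynomial.smult_monom)
    then have "\<bar>L (?X ^ k * q)\<bar> \<le> (\<Sum>i\<le>degree q. \<bar>coeff q i\<bar> * \<bar>m (k + i)\<bar>)"
      by (simp add: L.sum L.smult L_X abs_mult[symmetric] sum_abs)
    also have "\<dots> \<le> (\<Sum>i\<le>degree q. \<bar>coeff q i\<bar> * (C * R' ^ (k + i)))"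
      by (intro sum_mono mult_left_mono growth') simp
    finally show "\<bar>L (?X ^ k * q)\<bar> \<le> (\<Sum>i\<le>degree q. \<bar>coeff q i\<bar> * (C * R' ^ i)) * R' ^ k"
      by (simp add: sum_distrib_left sum_distrib_right power_add mult_ac)
  qed
  have weighted: "\<bar>L (?X ^ e * (p * p))\<bar> \<le> R' ^ e * L (p * p)" for e p
  proof -
    interpret W: positive_functional "\<lambda>q. L (q * (p * p))"
    proof
      fix q r :: "real poly" and c
      show "L ((q + r) * (p * p)) = L (q * (p * p)) + L (r * (p * p))"
        by (simp add: distrib_right L.add)
      show "L (Polynomial.smult c q * (p * p)) = c * L (q * (p * p))"
        by (simp add: L.smult)
      have "q * q * (p * p) = (q * p) * (q * p)" by (simp add: mult_ac)
      then show "0 \<le> L (q * q * (p * p))" by (simp only: L.square)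
    qed
    obtain C' where "\<And>k. \<bar>L (?X ^ k * (p * p))\<bar> \<le> C' * R' ^ k"
      using shift_growth[of "p * p"] by blast
    then have "\<bar>L ((?X ^ e) ^ k * (p * p))\<bar> \<le> C' * (R' ^ e) ^ k" for k
      by (simp add: power_mult[symmetric])
    then show ?thesis
      using W.growth_bound[of "?X ^ e" C' "R' ^ e"] R' by simp
  qed
  \<comment> \<open>The affine change of variables \<open>Y\<close> maps \<open>[-R', R']\<close> onto \<open>[0, 1]\<close>.\<close>
  define Y where "Y = [:1/2, 1 / (2 * R'):]"
  have Y_eq: "Y = Polynomial.smult (1 / (2 * R')) ([:R':] + ?X)"
    and Y'_eq: "1 - Y = Polynomial.smult (1 / (2 * R')) ([:R':] - ?X)"
    using R' by (auto simp: Y_def one_pCons)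
  have const: "[:a:] * q = Polynomial.smult a q" for a :: real and q
    by simp
  have Y_weight: "0 \<le> L (Y * (p * p))" "0 \<le> L ((1 - Y) * (p * p))" for p
  proof -
    have "\<bar>L (?X * (p * p))\<bar> \<le> R' * L (p * p)"
      using weighted[of 1 p] by simp
    then have "0 \<le> R' * L (p * p) + L (?X * (p * p))" "0 \<le> R' * L (p * p) - L (?X * (p * p))"
      by linarith+
    moreover have "L (Y * (p * p)) = 1 / (2 * R') * (R' * L (p * p) + L (?X * (p * p)))"
      unfolding Y_eq mult_smult_left distrib_right const L.add L.smult ..
    moreover have "L ((1 - Y) * (p * p)) = 1 / (2 * R') * (R' * L (p * p) - L (?X * (p * p)))"
      unfolding Y'_eq mult_smult_left left_diff_distrib const L.diff L.smult ..
    ultimately show "0 \<le> L (Y * (p * p))" "0 \<le> L ((1 - Y) * (p * p))"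
      using R' by simp_all
  qed
  have YY_weight: "0 \<le> L (Y * (1 - Y) * (p * p))" for p
  proof -
    have "Y * (1 - Y) = Polynomial.smult ((1 / (2 * R'))\<^sup>2) ([:R'\<^sup>2:] - ?X ^ 2)"
      using R' by (simp add: Y_def one_pCons power2_eq_square field_simps)
    then show ?thesis
      using weighted[of 2 p]
      by (simp only: mult_smult_left left_diff_distrib const L.diff L.smult) simp
  qed
  have pcompose_pow: "pcompose (p ^ k) Y = pcompose p Y ^ k" for p k
    by (induction k) (simp_all add: pcompose_mult pcompose_1)
  interpret LY: positive_functional "\<lambda>q. L (pcompose q Y)"
    by standard (simp_all add: pcompose_add pcompose_smult pcompose_mult L.add L.smult L.square)
  have "\<exists>M. real_distribution M \<and> (AE x in M. x \<in> {0..1}) \<and>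
      (\<forall>k. (\<integral>x. x ^ k \<partial>M) = L (pcompose (?X ^ k) Y))"
  proof (rule LY.hausdorff_moment)
    show "L (pcompose 1 Y) = 1" by (simp add: L_1 pcompose_1)
  next
    fix N j :: nat assume "j \<le> N"
    define i where "i = N - j"
    \<comment> \<open>By the parities of the exponents, a product of powers of \<open>Y\<close> and
      \<open>1 - Y\<close> is a square times one of \<open>1\<close>, \<open>Y\<close>,
      \<open>1 - Y\<close> and \<open>Y * (1 - Y)\<close>, and each of these weights has been
      treated.\<close>
    have split: "\<exists>p. y ^ a = (if even a then p * p else y * (p * p))" for y :: "real poly" and a :: nat
      by (rule exI[of _ "y ^ (a div 2)"])
        (auto simp: power_add[symmetric] mult_2[symmetric] power_Suc[symmetric] elim!: evenE oddE)
    obtain p where p: "Y ^ j = (if even j then p * p else Y * (p * p))" using split by blast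
    obtain q where q: "(1 - Y) ^ i = (if even i then q * q else (1 - Y) * (q * q))" using split by blast
    have "0 \<le> L (Y ^ j * (1 - Y) ^ i)"
      using L.square[of "p * q"] Y_weight[of "p * q"] YY_weight[of "p * q"]
      unfolding p q by (cases "even j"; cases "even i") (simp_all add: mult_ac)
    then show "0 \<le> L (pcompose (?X ^ j * (1 - ?X) ^ (N - j)) Y)"
      by (simp add: pcompose_mult pcompose_pow pcompose_diff pcompose_1 pcompose_pCons i_def)
  qed
  then obtain M where M: "real_distribution M" "AE x in M. x \<in> {0..1}"
    and M_mom: "\<And>k. (\<integral>x. x ^ k \<partial>M) = L (pcompose (?X ^ k) Y)"
    by blast
  interpret M: real_distribution M by fact
  note int = integrable_power_unit_interval[OF M]
  have int_poly: "integrable M (poly q)" for q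
    unfolding poly_altdef by (intro Bochner_Integration.integrable_sum Bochner_Integration.integrable_mult_right int)
  have M_poly: "(\<integral>x. poly q x \<partial>M) = L (pcompose q Y)" for q
  proof -
    have "(\<integral>x. poly q x \<partial>M) = (\<Sum>i\<le>degree q. coeff q i * L (pcompose (?X ^ i) Y))"
      unfolding poly_altdef by (subst Bochner_Integration.integral_sum) (auto simp: int M_mom)
    also have "\<dots> = L (pcompose (\<Sum>i\<le>degree q. Polynomial.smult (coeff q i) (?X ^ i)) Y)"
      by (simp add: LY.sum LY.smult)
    also have "(\<Sum>i\<le>degree q. Polynomial.smult (coeff q i) (?X ^ i)) = q"
      by (simp add: X_pow Polynomial.smult_monom poly_as_sum_of_monoms)
    finally show ?thesis .
  qed
  \<comment> \<open>\<open>Z\<close> inverts the change of variable \<open>Y\<close>; the required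
    measure is the image under it.\<close>
  define Z where "Z = [:- R', 2 * R':]"
  have ZY: "pcompose Z Y = ?X"
    using R' by (simp add: Z_def Y_def pcompose_pCons)
  have [measurable]: "poly Z \<in> borel_measurable borel"
    by (intro borel_measurable_continuous_onI) (auto intro: continuous_intros)
  have mom: "(\<lambda>x. poly Z x ^ k) = poly (Z ^ k)" "pcompose (Z ^ k) Y = ?X ^ k" for k
    by (auto simp: pcompose_pow ZY)
  show ?thesis
  proof (intro exI conjI allI)
    show "real_distribution (distr M borel (poly Z))"
      by (rule M.real_distribution_distr) simp
    show "integrable (distr M borel (poly Z)) (\<lambda>x. x ^ k)" for k
      by (subst integrable_distr_eq) (simp_all add: mom int_poly)
    show "(\<integral>x. x ^ k \<partial>distr M borel (poly Z)) = m k" for k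
      by (subst integral_distr) (simp_all add: mom M_poly L_X)
  qed
qed

text \<open>Both characteristic functions are the limit of the same Taylor sums. Sums of even order
  are taken because the remainder contains an absolute moment, which in even order is an ordinary
  moment.\<close>

lemma moments_determine_measure:
  assumes dist: "real_distribution M" "real_distribution N"
    and int: "\<And>k. integrable M (\<lambda>x. x ^ k)" "\<And>k. integrable N (\<lambda>x. x ^ k)"
    and eq: "\<And>k. (\<integral>x. x ^ k \<partial>M) = (\<integral>x. x ^ k \<partial>N)"
    and growth: "\<And>k. \<bar>\<integral>x. x ^ k \<partial>M\<bar> \<le> C * R ^ k"
  shows "M = N"
proof (rule Levy_uniqueness[OF dist], rule ext)
  fix s :: real
  define S where "S n = (\<Sum>k\<le>n. (\<i> * s) ^ k / fact k * (\<integral>x. x ^ k \<partial>M))" for n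
  define b where "b n = 2 * C * ((\<bar>s\<bar> * \<bar>R\<bar>) ^ (2 * n) / fact (2 * n))" for n
  have "(\<lambda>n. (\<bar>s\<bar> * \<bar>R\<bar>) ^ n / fact n) \<longlonglongrightarrow> 0"
    using summable_LIMSEQ_zero[OF summable_exp[of "\<bar>s\<bar> * \<bar>R\<bar>"]] by (simp add: divide_inverse mult.commute)
  then have "(\<lambda>n. (\<bar>s\<bar> * \<bar>R\<bar>) ^ (2 * n) / fact (2 * n)) \<longlonglongrightarrow> 0"
    using LIMSEQ_subseq_LIMSEQ[of _ _ "\<lambda>n. 2 * n"] by (fastforce simp: comp_def strict_mono_def)
  from tendsto_mult_right_zero[OF this] have b_lim: "b \<longlonglongrightarrow> 0"
    unfolding b_def .
  have approx: "cmod (char Q s - S (2 * n)) \<le> b n"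
    if Q: "real_distribution Q" "\<And>k. integrable Q (\<lambda>x. x ^ k)"
      "\<And>k. (\<integral>x. x ^ k \<partial>Q) = (\<integral>x. x ^ k \<partial>M)" for Q n
  proof -
    interpret Q: real_distribution Q by fact
    have "cmod (char Q s - S (2 * n)) \<le> 2 * \<bar>s\<bar> ^ (2 * n) / fact (2 * n) * (\<integral>x. \<bar>x\<bar> ^ (2 * n) \<partial>Q)"
      using Q.char_approx1[of "2 * n" s] Q(2,3) by (simp add: S_def)
    also have "(\<integral>x. \<bar>x\<bar> ^ (2 * n) \<partial>Q) = (\<integral>x. x ^ (2 * n) \<partial>M)"
      by (simp add: Q(3)[symmetric] power_even_abs)
    also have "2 * \<bar>s\<bar> ^ (2 * n) / fact (2 * n) * \<dots> \<le> 2 * \<bar>s\<bar> ^ (2 * n) / fact (2 * n) * (C * \<bar>R\<bar> ^ (2 * n))"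
      using growth[of "2 * n"] by (intro mult_left_mono) (auto simp: power_even_abs)
    also have "2 * \<bar>s\<bar> ^ (2 * n) / fact (2 * n) * (C * \<bar>R\<bar> ^ (2 * n)) = b n"
      by (simp add: b_def power_mult_distrib)
    finally show ?thesis .
  qed
  have lim: "(\<lambda>n. S (2 * n)) \<longlonglongrightarrow> char Q s"
    if "real_distribution Q" "\<And>k. integrable Q (\<lambda>x. x ^ k)"
      "\<And>k. (\<integral>x. x ^ k \<partial>Q) = (\<integral>x. x ^ k \<partial>M)" for Q
  proof (rule LIM_zero_cancel, rule Lim_null_comparison[OF _ b_lim])
    show "\<forall>\<^sub>F n in sequentially. norm (S (2 * n) - char Q s) \<le> b n"
      using approx[OF that] by (simp add: norm_minus_commute)
  qed
  show "char M s = char N s"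
    by (rule LIMSEQ_unique[OF lim lim]) (use dist int eq in auto)
qed

section \<open>Kernels of words\<close>

text \<open>A partition of \<open>{0..<k}\<close> is encoded by the list of length \<open>k\<close> whose \<open>i\<close>-th entry is the
  distance from \<open>i\<close> to the next element of its block, or \<open>0\<close> if \<open>i\<close> is the last element of its block.
  With this encoding, substituting noncrossing partitions into each other is concatenation of lists.
  The function \<open>kernel\<close> computes the code of the partition into sets of equal letters.\<close>

fun kernel :: "'a list \<Rightarrow> nat list" where
  "kernel [] = []"
| "kernel (x # w) = (if x \<in> set w then Suc (length (takeWhile (\<lambda>y. y \<noteq> x) w)) else 0) # kernel w"

text \<open>\<open>compat c w\<close>: letters of \<open>w\<close> in the same block of \<open>c\<close> are equal.\<close>

fun compat :: "nat list \<Rightarrow> 'a list \<Rightarrow> bool" where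
  "compat [] [] = True"
| "compat (d # c) (x # w) = ((d = 0 \<or> d \<le> length w \<and> w ! (d - 1) = x) \<and> compat c w)"
| "compat _ _ = False"

text \<open>No link leads beyond the end of the list, so that a code placed in front of another one
  does not reach into it (\<open>compat_append\<close>).\<close>

fun self_contained :: "nat list \<Rightarrow> bool" where
  "self_contained [] = True"
| "self_contained (d # c) = (d \<le> length c \<and> self_contained c)"

text \<open>A rank for partitions that drops strictly when blocks are merged: the end of a block
  counts \<open>K\<close>, which is taken to be at least the length of the word and hence exceeds
  every distance. It orders the partitions for the inductions below.\<close>

definition weight :: "nat \<Rightarrow> nat list \<Rightarrow> nat" where
  "weight K c = sum_list (map (\<lambda>d. if d = 0 then K else d) c)"

lemma weight_simps [simp]:
  "weight K [] = 0" "weight K (d # c) = (if d = 0 then K else d) + weight K c"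
  by (simp_all add: weight_def)

lemma length_kernel [simp]: "length (kernel w) = length w"
  by (induction w) auto

lemma first_occurrence:
  assumes "x \<in> set w"
  shows "length (takeWhile (\<lambda>y. y \<noteq> x) w) < length w"
    and "w ! length (takeWhile (\<lambda>y. y \<noteq> x) w) = x"
proof -
  show less: "length (takeWhile (\<lambda>y. y \<noteq> x) w) < length w"
    using assms by (induction w) auto
  show "w ! length (takeWhile (\<lambda>y. y \<noteq> x) w) = x"
    using nth_length_takeWhile[OF less] by simp
qed

lemma first_occurrence_le:
  assumes "i < length w" and "w ! i = x"
  shows "length (takeWhile (\<lambda>y. y \<noteq> x) w) \<le> i"
  using assms by (induction w arbitrary: i) (auto simp: nth_Cons split: nat.splits)

lemma compat_length: "compat c w \<Longrightarrow> length w = length c"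
  by (induction c w rule: compat.induct) auto

lemma compat_kernel: "compat (kernel w) w"
  by (induction w) (auto simp: first_occurrence Suc_le_eq)

lemma compat_map: "compat c w \<Longrightarrow> compat c (map f w)"
  by (induction c w rule: compat.induct) (auto simp: nth_map)

lemma self_contained_kernel: "self_contained (kernel w)"
  by (induction w) (auto simp: first_occurrence Suc_le_eq)

lemma compat_append:
  assumes "self_contained e" and "length v = length e"
  shows "compat (e @ c) (v @ w) \<longleftrightarrow> compat e v \<and> compat c w"
  using assms(2,1) by (induction v e rule: list_induct2) (auto simp: nth_append)

text \<open>Compared entry by entry: the kernel links a letter to its very next occurrence, while
  \<open>c\<close> can only link it to some later occurrence or end the block at the price
  \<open>K\<close>.\<close>

lemma weight_kernel:
  assumes "compat c w" and "length w \<le> K"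
  shows "weight K (kernel w) \<le> weight K c \<and> (weight K (kernel w) = weight K c \<longrightarrow> kernel w = c)"
  using assms
proof (induction c w rule: compat.induct)
  case (2 d c x w)
  let ?i = "length (takeWhile (\<lambda>y. y \<noteq> x) w)"
  have IH: "weight K (kernel w) \<le> weight K c" "weight K (kernel w) = weight K c \<longrightarrow> kernel w = c"
    using 2 by auto
  show ?case
  proof (cases "d = 0")
    case True
    have "x \<in> set w \<Longrightarrow> Suc ?i < K"
      using first_occurrence(1)[of x w] 2(3) by simp
    with True IH show ?thesis by auto
  next
    case False
    then have d: "d \<le> length w" "w ! (d - 1) = x"
      using 2(2) by auto
    then have "x \<in> set w" and "?i \<le> d - 1"
      using False first_occurrence_le[of "d - 1" w x] by (auto simp: set_conv_nth intro!: exI[of _ "d - 1"])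
    with False IH show ?thesis by auto
  qed
qed auto

text \<open>The code only records nearest equal letters; the head of a word is compared with a far
  position through its first later occurrence.\<close>

lemma kernel_eq_nth:
  assumes "kernel w = kernel w'" and "i < length w" and "j < length w"
  shows "w ! i = w ! j \<longleftrightarrow> w' ! i = w' ! j"
proof -
  have *: "w ! i = w ! j \<longleftrightarrow> w' ! i = w' ! j" if "kernel w = kernel w'" "i < j" "j < length w" for i j w w'
    using that
  proof (induction w arbitrary: w' i j)
    case (Cons x w)
    from Cons.prems(1) obtain y v where w': "w' = y # v" by (cases w') auto
    with Cons.prems have k: "kernel w = kernel v" "length v = length w"
      and xy: "x \<in> set w \<longleftrightarrow> y \<in> set v"
      and first: "x \<in> set w \<Longrightarrow> length (takeWhile (\<lambda>z. z \<noteq> x) w) = length (takeWhile (\<lambda>z. z \<noteq> y) v)"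
      by (auto split: if_splits dest: arg_cong[of _ _ length])
    have IH: "w ! i = w ! j \<longleftrightarrow> v ! i = v ! j" if "i < length w" "j < length w" for i j
      using Cons.IH[OF k(1), of i j] Cons.IH[OF k(1), of j i] that by (cases i j rule: linorder_cases) auto
    obtain j' where j': "j = Suc j'" using Cons.prems(2) by (cases j) auto
    have "j' < length w" using j' Cons.prems by simp
    show ?case
    proof (cases i)
      case 0
      show ?thesis
      proof (cases "x \<in> set w")
        case True
        let ?p = "length (takeWhile (\<lambda>z. z \<noteq> x) w)"
        have "w ! ?p = x" "v ! ?p = y" "?p < length w"
          using first_occurrence[OF True] first_occurrence[of y v] xy True first by auto
        with IH[of ?p j'] \<open>j' < length w\<close> show ?thesis
          by (auto simp: 0 j' w')
      next
        case False
        with xy \<open>j' < length w\<close> k show ?thesis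
          by (auto simp: 0 j' w' in_set_conv_nth)
      qed
    next
      case (Suc i')
      with IH[of i' j'] Cons.prems show ?thesis by (simp add: j' w')
    qed
  qed auto
  show ?thesis
    using *[OF assms(1), of i j] *[OF assms(1), of j i] assms by (cases i j rule: linorder_cases) auto
qed

lemma kernel_map_inj: "inj_on f (set w) \<Longrightarrow> kernel (map f w) = kernel w"
proof (induction w)
  case (Cons x w)
  then have "f x \<in> f ` set w \<longleftrightarrow> x \<in> set w"
    by (auto simp: inj_on_def)
  moreover have "length (takeWhile (\<lambda>y. y \<noteq> f x) (map f w)) = length (takeWhile (\<lambda>y. y \<noteq> x) w)"
  proof -
    have "takeWhile (\<lambda>y. y \<noteq> f x) (map f w) = map f (takeWhile (\<lambda>y. y \<noteq> x) w)"
      using Cons.prems by (induction w) (auto simp: inj_on_def)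
    then show ?thesis by simp
  qed
  ultimately show ?case using Cons by auto
qed simp

lemma kernel_append:
  assumes "set v \<inter> set w = {}"
  shows "kernel (v @ w) = kernel v @ kernel w"
  using assms
proof (induction v)
  case (Cons x v)
  show ?case
  proof (cases "x \<in> set v")
    case True
    then have "takeWhile (\<lambda>y. y \<noteq> x) (v @ w) = takeWhile (\<lambda>y. y \<noteq> x) v"
      by (rule takeWhile_append1) simp
    with True Cons show ?thesis by simp
  next
    case False
    with Cons show ?thesis by simp
  qed
qed simp

text \<open>A cut at the first return of the head; on codes this is the shape produced by
  \<open>Cons\<close> and \<open>Next\<close> below.\<close>

lemma kernel_split:
  assumes "x \<notin> set v" and "set v \<inter> set r = {}"
  shows "kernel (x # v @ x # r) = Suc (length v) # kernel v @ kernel (x # r)"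
proof -
  have "takeWhile (\<lambda>y. y \<noteq> x) (v @ x # r) = v"
    using assms(1) by (induction v) auto
  moreover have "kernel (v @ x # r) = kernel v @ kernel (x # r)"
    using assms by (intro kernel_append) auto
  ultimately show ?thesis by simp
qed

text \<open>A letter contributes a zero exactly at its last occurrence.\<close>

lemma zeros_kernel: "count_list (kernel w) 0 = card (set w)"
  by (induction w) (auto simp: card_insert_if)

lemma compat_kernel_imp_map:
  assumes "compat (kernel v) w"
  shows "\<exists>g. w = map g v"
  using assms
proof (induction v arbitrary: w)
  case (Cons x v)
  from Cons.prems obtain y u where w: "w = y # u" by (cases w) auto
  with Cons.prems have "compat (kernel v) u" by simp
  with Cons.IH obtain g where g: "u = map g v" by blast
  show ?case
  proof (cases "x \<in> set v")
    case True
    with Cons.prems w have "u ! length (takeWhile (\<lambda>y. y \<noteq> x) v) = y" by simp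
    with first_occurrence[OF True] g have "g x = y" by simp
    with g w show ?thesis by auto
  next
    case False
    with g w have "w = map (g(x := y)) (x # v)" by simp
    then show ?thesis by blast
  qed
qed (auto dest: compat_length)

text \<open>A broken link of \<open>c\<close> names two positions that \<open>c\<close> forces to
  agree. In the count of joint words this costs a factor \<open>n\<close>.\<close>

lemma compat_fails:
  assumes "length w = length c" and "self_contained c" and "\<not> compat c w"
  shows "\<exists>i j. i < j \<and> j < length w \<and> w ! i \<noteq> w ! j \<and> (\<forall>u::'b list. compat c u \<longrightarrow> u ! i = u ! j)"
  using assms
proof (induction w c rule: list_induct2)
  case (Cons x w d c)
  show ?case
  proof (cases "compat c w")
    case True
    with Cons have d: "d \<noteq> 0" "w ! (d - 1) \<noteq> x" "d \<le> length w" by auto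
    have "u ! 0 = u ! d" if "compat (d # c) u" for u :: "'b list"
      using that d by (cases u) (auto simp: nth_Cons')
    with d show ?thesis
      by (intro exI[of _ 0] exI[of _ d]) (auto simp: nth_Cons')
  next
    case False
    with Cons obtain i j where ij: "i < j" "j < length w" "w ! i \<noteq> w ! j"
      and forced: "\<And>u::'b list. compat c u \<Longrightarrow> u ! i = u ! j" by auto
    have "u ! Suc i = u ! Suc j" if "compat (d # c) u" for u :: "'b list"
      using that forced by (cases u) auto
    with ij show ?thesis
      by (intro exI[of _ "Suc i"] exI[of _ "Suc j"]) auto
  qed
qed auto


section \<open>Noncrossing partitions with blocks of even size\<close>

text \<open>In a code satisfying \<open>odd_code\<close> the block of the first point is of odd size and all other
  blocks are of even size.\<close>

inductive even_code :: "nat list \<Rightarrow> bool" and odd_code :: "nat list \<Rightarrow> bool" where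
  Nil: "even_code []"
| Cons: "even_code e \<Longrightarrow> odd_code d \<Longrightarrow> even_code (Suc (length e) # e @ d)"
| Last: "even_code e \<Longrightarrow> odd_code (0 # e)"
| Next: "even_code e \<Longrightarrow> even_code f \<Longrightarrow> f \<noteq> [] \<Longrightarrow> odd_code (Suc (length e) # e @ f)"

lemma not_odd_code_Nil: "\<not> odd_code []"
  by (auto elim: odd_code.cases)

lemma code_length:
  "even_code c \<Longrightarrow> even (length c)"
  "odd_code c \<Longrightarrow> odd (length c)"
  by (induction rule: even_code_odd_code.inducts) auto

text \<open>The letters of \<open>v\<close> are shifted past those of \<open>w\<close> to make them
  disjoint, and the head of \<open>w\<close> is repeated in front, which links the new first point
  to the first point of \<open>w\<close>. Bounding letters by the length keeps the word within
  \<open>n\<close> letters as soon as \<open>n\<close> is at least its length.\<close>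

lemma kernel_join:
  assumes "kernel v = e" "set v \<subseteq> {1..length e}" and "kernel w = d" "set w \<subseteq> {1..length d}" "d \<noteq> []"
  shows "\<exists>w. kernel w = Suc (length e) # e @ d \<and> set w \<subseteq> {1..length (Suc (length e) # e @ d)}"
proof -
  obtain x r where r: "w = x # r" using assms by (cases w) auto
  let ?v = "map (\<lambda>y. y + length d) v"
  have set_v: "set ?v \<subseteq> {Suc (length d)..length e + length d}"
    using assms(2) by (auto dest!: subsetD)
  then have "x \<notin> set ?v" "set ?v \<inter> set r = {}"
    using assms(4) by (fastforce simp: r)+
  then have "kernel (x # ?v @ x # r) = Suc (length ?v) # kernel ?v @ kernel (x # r)"
    by (rule kernel_split)
  moreover have "kernel ?v = e"
    using assms(1) kernel_map_inj[of "\<lambda>y. y + length d" v] by simp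
  moreover have "length ?v = length e"
    using assms(1) by auto
  ultimately have "kernel (x # ?v @ x # r) = Suc (length e) # e @ d"
    using assms(3) by (simp only: r)
  moreover have "set (x # ?v @ x # r) \<subseteq> {1..length (Suc (length e) # e @ d)}"
  proof -
    have "set (x # ?v @ x # r) = set ?v \<union> set w" by (auto simp: r)
    also have "\<dots> \<subseteq> {Suc (length d)..length e + length d} \<union> {1..length d}"
      using set_v assms(4) by blast
    also have "\<dots> \<subseteq> {1..length (Suc (length e) # e @ d)}" by auto
    finally show ?thesis .
  qed
  ultimately show ?thesis by blast
qed

lemma code_realisation:
  "even_code c \<Longrightarrow> \<exists>w. kernel w = c \<and> set w \<subseteq> {1..length c}"
  "odd_code c \<Longrightarrow> \<exists>w. kernel w = c \<and> set w \<subseteq> {1..length c}"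
proof (induction rule: even_code_odd_code.inducts)
  case Nil
  then show ?case by simp
next
  case (Cons e d)
  then have "d \<noteq> []" using not_odd_code_Nil by blast
  with Cons show ?case by (elim exE conjE) (rule kernel_join)
next
  case (Last e)
  then obtain w where w: "kernel w = e" "set w \<subseteq> {1..length e}" by blast
  then have "Suc (length e) \<notin> set w" by auto
  with w have "kernel (Suc (length e) # w) = 0 # e \<and> set (Suc (length e) # w) \<subseteq> {1..length (0 # e)}"
    by auto
  then show ?case by blast
next
  case (Next e f)
  then show ?case by (elim exE conjE) (rule kernel_join)
qed

lemma self_contained_code: "even_code c \<Longrightarrow> self_contained c"
  using code_realisation self_contained_kernel by blast

definition noncrossing :: "'a list \<Rightarrow> bool" where
  "noncrossing w \<longleftrightarrow> (\<forall>p x q y r s t. w = p @ x # q @ y # r @ x # s @ y # t \<longrightarrow> x = y)"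

lemma noncrossingD: "noncrossing (p @ x # q @ y # r @ x # s @ y # t) \<Longrightarrow> x = y"
  unfolding noncrossing_def by blast

lemma noncrossing_infix:
  assumes "noncrossing (u @ v @ w)"
  shows "noncrossing v"
  unfolding noncrossing_def
proof (intro allI impI)
  fix p x q y r s t
  assume "v = p @ x # q @ y # r @ x # s @ y # t"
  then have "u @ v @ w = (u @ p) @ x # q @ y # r @ x # s @ y # (t @ w)" by simp
  with assms show "x = y" using noncrossingD by metis
qed

lemma noncrossing_disjoint:
  assumes "noncrossing (x # v @ x # r)" and "x \<notin> set v"
  shows "set v \<inter> set r = {}"
proof (rule ccontr)
  assume "set v \<inter> set r \<noteq> {}"
  then obtain y where "y \<in> set v" "y \<in> set r" by blast
  then obtain q r1 s t where "v = q @ y # r1" "r = s @ y # t" by (metis split_list)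
  then have "x # v @ x # r = [] @ x # q @ y # r1 @ x # s @ y # t" by simp
  with assms(1) have "x = y" using noncrossingD by metis
  with assms(2) \<open>y \<in> set v\<close> show False by simp
qed

text \<open>The two parity statements need each other. A word is cut at the first return of its head
  \<open>x\<close>: by noncrossing, the inner part shares no letter with the rest and is therefore
  even by itself, and dropping the first \<open>x\<close> switches the parity of its block.\<close>

lemma noncrossing_kernel_code:
  assumes "noncrossing w"
  shows "((\<forall>x. even (count_list w x)) \<longrightarrow> even_code (kernel w)) \<and>
    (w \<noteq> [] \<and> odd (count_list w (hd w)) \<and> (\<forall>x. x \<noteq> hd w \<longrightarrow> even (count_list w x)) \<longrightarrow>
      odd_code (kernel w))"
  using assms
proof (induction "length w" arbitrary: w rule: less_induct)
  case (less w)
  have IH_even: "even_code (kernel v)"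
    if "length v < length w" "noncrossing v" "\<forall>x. even (count_list v x)" for v :: "'a list"
    using less.hyps[of v] that by simp
  have IH_odd: "odd_code (kernel v)"
    if "length v < length w" "noncrossing v" "v \<noteq> []" "odd (count_list v (hd v))"
      "\<forall>x. x \<noteq> hd v \<longrightarrow> even (count_list v x)" for v :: "'a list"
    using less.hyps[of v] that by simp
  show ?case
  proof (cases w)
    case Nil
    then show ?thesis by (auto intro: even_code_odd_code.intros)
  next
    case (Cons x w')
    have repeated: "\<exists>v r. w' = v @ x # r \<and> x \<notin> set v \<and> set v \<inter> set r = {} \<and>
        even_code (kernel v) \<and> noncrossing (x # r) \<and>
        (\<forall>y. y \<noteq> x \<longrightarrow> even (count_list r y)) \<and> kernel w = Suc (length (kernel v)) # kernel v @ kernel (x # r)"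
      if nc: "noncrossing w" and ev: "\<forall>y. y \<noteq> x \<longrightarrow> even (count_list w y)" and "x \<in> set w'"
    proof -
      obtain v r where w': "w' = v @ x # r" "x \<notin> set v"
        using split_list_first[OF \<open>x \<in> set w'\<close>] by blast
      have disj: "set v \<inter> set r = {}"
        using nc w' by (intro noncrossing_disjoint[of x]) (simp_all add: Cons)
      have ev_vr: "even (count_list v y)" "y \<noteq> x \<Longrightarrow> even (count_list r y)" for y
        using ev[rule_format, of y] disj w'
        by (cases "y \<in> set v"; cases "y \<in> set r"; cases "y = x"; auto simp: Cons w' count_list_0_iff)+
      have "noncrossing v" "noncrossing (x # r)"
        using nc noncrossing_infix[of "[x]" v "x # r"] noncrossing_infix[of "x # v" "x # r" "[]"]
        by (simp_all add: Cons w')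
      moreover have "even_code (kernel v)"
        using ev_vr \<open>noncrossing v\<close> by (intro IH_even) (auto simp: Cons w')
      moreover have "kernel w = Suc (length (kernel v)) # kernel v @ kernel (x # r)"
        using kernel_split[OF w'(2) disj] by (simp add: Cons w' del: kernel.simps)
      ultimately show ?thesis using w' disj ev_vr by blast
    qed
    have "even_code (kernel w)" if nc: "noncrossing w" and ev: "\<forall>x. even (count_list w x)"
    proof -
      have "x \<in> set w'"
        using ev[rule_format, of x] by (auto simp: Cons intro: ccontr simp: count_list_0_iff)
      with repeated[OF nc] ev obtain v r where vr: "w' = v @ x # r" "x \<notin> set v" "even_code (kernel v)"
        "noncrossing (x # r)" "\<forall>y. y \<noteq> x \<longrightarrow> even (count_list r y)"
        "kernel w = Suc (length (kernel v)) # kernel v @ kernel (x # r)"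
        by blast
      have "odd_code (kernel (x # r))"
        using vr ev[rule_format, of x] by (intro IH_odd) (auto simp: Cons count_list_0_iff)
      with vr show ?thesis by (simp only: even_code_odd_code.Cons)
    qed
    moreover have "odd_code (kernel w)"
      if nc: "noncrossing w" and od: "odd (count_list w x)" and ev: "\<forall>y. y \<noteq> x \<longrightarrow> even (count_list w y)"
    proof (cases "x \<in> set w'")
      case True
      with repeated[OF nc ev] obtain v r where vr: "w' = v @ x # r" "x \<notin> set v" "even_code (kernel v)"
        "noncrossing (x # r)" "\<forall>y. y \<noteq> x \<longrightarrow> even (count_list r y)"
        "kernel w = Suc (length (kernel v)) # kernel v @ kernel (x # r)"
        by blast
      have "even_code (kernel (x # r))"
        using vr od by (intro IH_even) (auto simp: Cons count_list_0_iff)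
      then have "odd_code (Suc (length (kernel v)) # kernel v @ kernel (x # r))"
        by (rule even_code_odd_code.Next[OF vr(3)]) simp
      then show ?thesis by (simp only: vr(6))
    next
      case False
      have "even (count_list w' y)" for y
        using ev[rule_format, of y] False by (cases "y = x") (auto simp: Cons count_list_0_iff)
      then have "even_code (kernel w')"
        using noncrossing_infix[of "[x]" w' "[]"] nc by (intro IH_even) (auto simp: Cons)
      with False show ?thesis by (simp add: Cons even_code_odd_code.Last)
    qed
    ultimately show ?thesis using less.prems Cons by auto
  qed
qed

section \<open>Counting even noncrossing partitions\<close>

text \<open>Induction over \<open>n\<close> for all \<open>m\<close> at once: writing one factor of
  \<open>W ^ m\<close> as \<open>fps_X ^ q * (\<phi> oo W)\<close> expresses its coefficient through
  lower coefficients of all powers of \<open>W\<close>. In the application \<open>q\<close> is 2,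
  since only even lengths carry even codes.\<close>

lemma lagrange_inversion_power:
  fixes W \<phi> :: "'a::field_char_0 fps"
  assumes W: "W = fps_X ^ q * (\<phi> oo W)" and q: "0 < q" and n: "0 < n"
  shows "fps_nth (W ^ m) (q * n) =
    (if m \<le> n then of_nat m / of_nat n * fps_nth (\<phi> ^ n) (n - m) else 0)"
  using n
proof (induction n arbitrary: m)
  case 0
  then show ?case by simp
next
  case (Suc n)
  have W0: "fps_nth W 0 = 0"
    using arg_cong[OF W, of "\<lambda>F. fps_nth F 0"] q by simp
  show ?case
  proof (cases m)
    case 0
    then show ?thesis using q by simp
  next
    case (Suc p)
    have "W ^ m = fps_X ^ q * ((\<phi> * fps_X ^ p) oo W)"
    proof -
      have "W ^ m = W * W ^ p" by (simp add: Suc)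
      also have "\<dots> = fps_X ^ q * (\<phi> oo W) * W ^ p" by (subst (1) W) (rule refl)
      also have "\<dots> = fps_X ^ q * ((\<phi> * fps_X ^ p) oo W)"
        using W0 by (simp add: fps_compose_mult_distrib fps_compose_power[symmetric] fps_X_fps_compose_startby0 mult.assoc)
      finally show ?thesis .
    qed
    then have step: "fps_nth (W ^ m) (q * Suc n) =
        (\<Sum>i = 0..q * n. fps_nth (\<phi> * fps_X ^ p) i * fps_nth (W ^ i) (q * n))"
      by (simp add: fps_X_power_mult_nth fps_compose_nth)
    show ?thesis
    proof (cases "n = 0")
      case True
      then show ?thesis
        unfolding step by (auto simp: Suc fps_X_power_mult_right_nth)
    next
      case False
      define c where "c i = of_nat i / of_nat n * (if i \<le> n then fps_nth (\<phi> ^ n) (n - i) else 0)" for i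
      have "fps_nth (W ^ m) (q * Suc n) = (\<Sum>i = 0..q * n. fps_nth (\<phi> * fps_X ^ p) i * c i)"
        unfolding step using Suc.IH False by (intro sum.cong) (auto simp: c_def)
      \<comment> \<open>Terms below \<open>p\<close> vanish by the factor \<open>fps_X ^ p\<close>,
        terms above \<open>n\<close> by the case distinction in \<open>c\<close>.\<close>
      also have "\<dots> = (\<Sum>i\<in>{p..n}. fps_nth \<phi> (i - p) * c i)"
        using q by (intro sum.mono_neutral_cong_right)
          (auto simp: fps_X_power_mult_right_nth c_def intro: order_trans[of _ n])
      also have "\<dots> = (if m \<le> Suc n then of_nat m / of_nat (Suc n) * fps_nth (\<phi> ^ Suc n) (Suc n - m) else 0)"
      proof (cases "p \<le> n")
        case True
        define r where "r = n - p"
        have "(\<Sum>i\<in>{p..n}. fps_nth \<phi> (i - p) * c i) = (\<Sum>j\<in>{0..r}. fps_nth \<phi> j * c (j + p))"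
          using sum.shift_bounds_cl_nat_ivl[of "\<lambda>i. fps_nth \<phi> (i - p) * c i" 0 p r] True by (simp add: r_def)
        also have "\<dots> = (\<Sum>j\<in>{0..r}. (of_nat j * fps_nth \<phi> j * fps_nth (\<phi> ^ n) (r - j) +
            of_nat p * (fps_nth \<phi> j * fps_nth (\<phi> ^ n) (r - j))) / of_nat n)"
        proof (rule sum.cong[OF refl])
          fix j assume "j \<in> {0..r}"
          then have "j + p \<le> n" "n - (j + p) = r - j" using True by (auto simp: r_def)
          then show "fps_nth \<phi> j * c (j + p) = (of_nat j * fps_nth \<phi> j * fps_nth (\<phi> ^ n) (r - j) +
              of_nat p * (fps_nth \<phi> j * fps_nth (\<phi> ^ n) (r - j))) / of_nat n"
            by (simp add: c_def field_simps)
        qed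
        \<comment> \<open>The factor \<open>j\<close> turns the convolution into a coefficient of
          \<open>fps_X * fps_deriv \<phi> * \<phi> ^ n\<close>. This is a multiple of
          \<open>fps_X\<close> times the derivative of \<open>\<phi> ^ Suc n\<close>, so both
          summands become multiples of the same coefficient.\<close>
        also have "\<dots> = (fps_nth (fps_X * fps_deriv \<phi> * \<phi> ^ n) r + of_nat p * fps_nth (\<phi> * \<phi> ^ n) r) / of_nat n"
        proof -
          have "fps_nth (fps_X * fps_deriv \<phi>) j = of_nat j * fps_nth \<phi> j" for j
            by (cases j) simp_all
          then show ?thesis
            by (simp add: fps_mult_nth[of "fps_X * fps_deriv \<phi>"] fps_mult_nth[of \<phi>]
                sum.distrib sum_divide_distrib[symmetric] sum_distrib_left)
        qed
        also have "fps_X * fps_deriv \<phi> * \<phi> ^ n = fps_const (1 / of_nat (Suc n)) * (fps_X * fps_deriv (\<phi> ^ Suc n))"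
        proof -
          have "fps_deriv (\<phi> ^ Suc n) = fps_const (of_nat (Suc n)) * (fps_deriv \<phi> * \<phi> ^ n)"
            using fps_deriv_power[of \<phi> "Suc n"] by (simp add: mult.assoc)
          then have "fps_const (1 / of_nat (Suc n)) * (fps_X * fps_deriv (\<phi> ^ Suc n)) =
              (fps_const (1 / of_nat (Suc n)) * fps_const (of_nat (Suc n))) * (fps_X * fps_deriv \<phi> * \<phi> ^ n)"
            by (simp only: mult_ac)
          also have "fps_const (1 / of_nat (Suc n)) * fps_const (of_nat (Suc n)) = (1 :: 'a fps)"
            by (simp only: fps_const_mult) (simp del: of_nat_Suc)
          finally show ?thesis by simp
        qed
        also have "fps_nth (fps_const (1 / of_nat (Suc n)) * (fps_X * fps_deriv (\<phi> ^ Suc n))) r =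
            of_nat r / of_nat (Suc n) * fps_nth (\<phi> ^ Suc n) r"
          by (cases r) (simp_all del: power_Suc of_nat_Suc)
        also have "(of_nat r / of_nat (Suc n) * fps_nth (\<phi> ^ Suc n) r + of_nat p * fps_nth (\<phi> * \<phi> ^ n) r) / of_nat n =
            of_nat m / of_nat (Suc n) * fps_nth (\<phi> ^ Suc n) (Suc n - m)"
        proof -
          have "r + p * Suc n = n * m" using True by (simp add: r_def Suc algebra_simps)
          then have num: "of_nat r + of_nat p * of_nat (Suc n) = (of_nat n * of_nat m :: 'a)"
            by (metis of_nat_add of_nat_mult)
          have "(of_nat r / of_nat (Suc n) + of_nat p) / of_nat n =
              (of_nat r + of_nat p * of_nat (Suc n)) / (of_nat (Suc n) * of_nat n :: 'a)"
            by (simp add: add_divide_distrib del: of_nat_Suc)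
          then have "(of_nat r / of_nat (Suc n) + of_nat p) / of_nat n = (of_nat m / of_nat (Suc n) :: 'a)"
            unfolding num using False by (simp del: of_nat_Suc)
          moreover have "Suc n - m = r" by (simp add: Suc r_def)
          ultimately show ?thesis
            by (metis (no_types, lifting) distrib_right times_divide_eq_left power_Suc)
        qed
        finally show ?thesis using True by (simp add: Suc)
      qed (simp add: Suc)
      finally show ?thesis .
    qed
  qed
qed

section \<open>Enumeration of codes by length and their generating functions\<close>

definition even_codes :: "nat \<Rightarrow> nat list set" where
  "even_codes k = {c. even_code c \<and> length c = k}"

definition odd_codes :: "nat \<Rightarrow> nat list set" where
  "odd_codes k = {c. odd_code c \<and> length c = k}"

text \<open>Every block has exactly one last point, and exactly the last points are coded by
  0.\<close>

definition blocks :: "nat list \<Rightarrow> nat" where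
  "blocks c = count_list c 0"

lemma blocks_simps [simp]:
  "blocks [] = 0" "blocks (0 # c) = Suc (blocks c)" "blocks (Suc a # c) = blocks c"
  "blocks (c @ d) = blocks c + blocks d"
  by (simp_all add: blocks_def)

lemma finite_codes: "finite (even_codes k)" "finite (odd_codes k)"
proof -
  have "even_code c \<Longrightarrow> set c \<subseteq> {..length c}" "odd_code c \<Longrightarrow> set c \<subseteq> {..length c}" for c
    by (induction rule: even_code_odd_code.inducts) force+
  then have "even_codes k \<subseteq> {c. set c \<subseteq> {..k} \<and> length c = k}" "odd_codes k \<subseteq> {c. set c \<subseteq> {..k} \<and> length c = k}"
    unfolding even_codes_def odd_codes_def by blast+
  then show "finite (even_codes k)" "finite (odd_codes k)"
    using finite_lists_length_eq[of "{..k}" k] finite_subset by blast+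
qed

lemma even_codes_0: "even_codes 0 = {[]}"
  by (auto simp: even_codes_def intro: even_code_odd_code.intros)

lemma odd_codes_0: "odd_codes 0 = {}"
  using not_odd_code_Nil by (auto simp: odd_codes_def)

lemma even_codes_odd_empty: "odd k \<Longrightarrow> even_codes k = {}"
  using code_length(1) by (auto simp: even_codes_def)

lemma even_codes_Suc:
  "even_codes (Suc k) = (\<lambda>(a, e, d). Suc a # e @ d) ` (SIGMA a:{..k}. even_codes a \<times> odd_codes (k - a))"
proof (intro equalityI subsetI)
  fix c assume "c \<in> even_codes (Suc k)"
  then have "even_code c" "length c = Suc k" by (auto simp: even_codes_def)
  then obtain e d where "c = Suc (length e) # e @ d" "even_code e" "odd_code d"
    by (cases rule: even_code.cases) auto
  with \<open>length c = Suc k\<close> show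
    "c \<in> (\<lambda>(a, e, d). Suc a # e @ d) ` (SIGMA a:{..k}. even_codes a \<times> odd_codes (k - a))"
    by (intro image_eqI[of _ _ "(length e, e, d)"]) (auto simp: even_codes_def odd_codes_def)
qed (auto simp: even_codes_def odd_codes_def intro!: even_code_odd_code.Cons)

lemma odd_codes_Suc:
  "odd_codes (Suc k) = (Cons 0) ` even_codes k \<union>
    (\<lambda>(a, e, f). Suc a # e @ f) ` (SIGMA a:{..<k}. even_codes a \<times> even_codes (k - a))"
proof (intro equalityI subsetI)
  fix c assume "c \<in> odd_codes (Suc k)"
  then have c: "odd_code c" "length c = Suc k" by (auto simp: odd_codes_def)
  from c(1) show "c \<in> (Cons 0) ` even_codes k \<union>
      (\<lambda>(a, e, f). Suc a # e @ f) ` (SIGMA a:{..<k}. even_codes a \<times> even_codes (k - a))"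
  proof (cases rule: odd_code.cases)
    case (Last e)
    with c show ?thesis by (auto simp: even_codes_def)
  next
    case (Next e f)
    with c have "c = (\<lambda>(a, e, f). Suc a # e @ f) (length e, e, f)" "length e < k" "length f = k - length e"
      by auto
    with Next show ?thesis by (intro UnI2 image_eqI[of _ _ "(length e, e, f)"]) (auto simp: even_codes_def)
  qed
qed (auto simp: even_codes_def odd_codes_def intro!: even_code_odd_code.Last even_code_odd_code.Next)

text \<open>The leading entry determines the length of the first piece, so the decomposition of a
  code is unique.\<close>

lemma inj_on_code_join:
  "inj_on (\<lambda>(a, e, d). Suc a # e @ d) (SIGMA a:I. {e. length e = a} \<times> D a)"
  by (auto simp: inj_on_def)

text \<open>Removing the first point changes the parity of its block: \<open>E = 1 + X E D\<close>
  and \<open>D = X E (t + E - 1)\<close>, where \<open>t\<close> records a block that ends. After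
  elimination of \<open>D\<close>, the series \<open>W = E - 1\<close> solves
  \<open>W = X^2 (1 + W)^2 (t + W)\<close>, and Lagrange inversion applies with
  \<open>\<phi> = (1 + X)^2 (t + X)\<close>.\<close>

theorem sum_even_codes:
  fixes t :: real
  assumes "1 \<le> k"
  shows "(\<Sum>c\<in>even_codes (2 * k). t ^ blocks c) =
    (\<Sum>b = 1..k. 1 / real b * real ((k - 1) choose (b - 1)) * real ((2 * k) choose (b - 1)) * t ^ b)"
proof -
  define E where "E = Abs_fps (\<lambda>k. \<Sum>c\<in>even_codes k. t ^ blocks c)"
  define D where "D = Abs_fps (\<lambda>k. \<Sum>c\<in>odd_codes k. t ^ blocks c)"
  have join: "(\<Sum>c\<in>(\<lambda>(a, e, d). Suc a # e @ d) ` (SIGMA a:I. even_codes a \<times> S a). t ^ blocks c) =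
      (\<Sum>a\<in>I. (\<Sum>c\<in>even_codes a. t ^ blocks c) * (\<Sum>c\<in>S a. t ^ blocks c))"
    if "finite I" "\<And>a. finite (S a)" for I and S :: "nat \<Rightarrow> nat list set"
  proof -
    have "inj_on (\<lambda>(a, e, d). Suc a # e @ d) (SIGMA a:I. even_codes a \<times> S a)"
      by (rule inj_on_subset[OF inj_on_code_join[of I S]]) (auto simp: even_codes_def)
    then have "(\<Sum>c\<in>(\<lambda>(a, e, d). Suc a # e @ d) ` (SIGMA a:I. even_codes a \<times> S a). t ^ blocks c) =
        (\<Sum>(a, e, d)\<in>(SIGMA a:I. even_codes a \<times> S a). t ^ blocks e * t ^ blocks d)"
      by (subst sum.reindex) (auto simp: power_add intro!: sum.cong)
    also have "\<dots> = (\<Sum>a\<in>I. \<Sum>(e, d)\<in>even_codes a \<times> S a. t ^ blocks e * t ^ blocks d)"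
      using that by (subst sum.Sigma) (auto simp: finite_codes split_def)
    finally show ?thesis
      by (simp add: sum_product sum.cartesian_product)
  qed
  have E_eq: "E = 1 + fps_X * (E * D)"
  proof (rule fps_ext)
    fix k
    show "fps_nth E k = fps_nth (1 + fps_X * (E * D)) k"
      by (cases k)
        (simp_all add: E_def even_codes_0 even_codes_Suc join finite_codes atMost_atLeast0 fps_mult_nth[of "Abs_fps _" D],
          simp add: D_def)
  qed
  have D_eq: "D = fps_X * (E * (fps_const t + E - 1))"
  proof (rule fps_ext)
    fix k
    show "fps_nth D k = fps_nth (fps_X * (E * (fps_const t + E - 1))) k"
    proof (cases k)
      case (Suc j)
      let ?S = "(\<lambda>(a, e, f). Suc a # e @ f) ` (SIGMA a:{..<j}. even_codes a \<times> even_codes (j - a))"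
      have "fps_nth D k = (\<Sum>c\<in>Cons 0 ` even_codes j. t ^ blocks c) + (\<Sum>c\<in>?S. t ^ blocks c)"
        unfolding D_def Suc odd_codes_Suc fps_nth_Abs_fps
        by (rule sum.union_disjoint) (auto simp: finite_codes)
      also have "(\<Sum>c\<in>Cons 0 ` even_codes j. t ^ blocks c) = t * fps_nth E j"
        by (subst sum.reindex) (simp_all add: E_def sum_distrib_left)
      also have "(\<Sum>c\<in>?S. t ^ blocks c) = (\<Sum>a<j. fps_nth E a * fps_nth E (j - a))"
        by (subst join) (simp_all add: finite_codes E_def)
      \<comment> \<open>The missing summand \<open>a = j\<close> pairs with the empty code, which
        \<open>Next\<close> excludes.\<close>
      also have "\<dots> = fps_nth (E * E) j - fps_nth E j"
        by (simp add: fps_mult_nth atLeast0AtMost lessThan_Suc_atMost[symmetric]) (simp add: E_def even_codes_0)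
      also have "t * fps_nth E j + (fps_nth (E * E) j - fps_nth E j) =
          fps_nth (fps_X * (E * (fps_const t + E - 1))) k"
      proof -
        have "E * (fps_const t + E - 1) = fps_const t * E + E * E - E"
          by (simp add: algebra_simps)
        then show ?thesis by (simp add: Suc)
      qed
      finally show ?thesis .
    qed (simp add: D_def odd_codes_0)
  qed
  define W where "W = E - 1"
  define \<phi> where "\<phi> = (1 + fps_X) ^ 2 * (fps_const t + fps_X)"
  have W0: "fps_nth W 0 = 0"
    by (simp add: W_def E_def even_codes_0)
  have "\<phi> oo W = (1 + W) ^ 2 * (fps_const t + W)"
    unfolding \<phi>_def using W0
    by (simp add: fps_compose_mult_distrib fps_compose_add_distrib fps_compose_power[symmetric]
        fps_X_fps_compose_startby0)
  moreover have "W = fps_X ^ 2 * ((1 + W) ^ 2 * (fps_const t + W))"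
  proof -
    have "W = fps_X * (E * D)" unfolding W_def by (subst (1) E_eq) simp
    also have "\<dots> = fps_X ^ 2 * (E ^ 2 * (fps_const t + E - 1))"
      by (subst D_eq) (simp add: power2_eq_square mult_ac)
    finally show ?thesis by (simp add: W_def algebra_simps)
  qed
  ultimately have "W = fps_X ^ 2 * (\<phi> oo W)" by simp
  from lagrange_inversion_power[OF this, of k 1] assms
  have "(\<Sum>c\<in>even_codes (2 * k). t ^ blocks c) = 1 / real k * fps_nth (\<phi> ^ k) (k - 1)"
    by (simp add: W_def E_def)
  also have "fps_nth (\<phi> ^ k) (k - 1) =
      (\<Sum>b\<le>k. real (k choose b) * t ^ b * fps_nth (fps_X ^ (k - b) * (1 + fps_X) ^ (2 * k)) (k - 1))"
  proof -
    have "\<phi> ^ k = (\<Sum>b\<le>k. of_nat (k choose b) * fps_const t ^ b * fps_X ^ (k - b)) * (1 + fps_X) ^ (2 * k)"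
      unfolding binomial_ring[of "fps_const t" fps_X k, symmetric]
      by (simp only: \<phi>_def power_mult_distrib power_mult[symmetric] mult.commute)
    also have "\<dots> = (\<Sum>b\<le>k. fps_const (real (k choose b) * t ^ b) * (fps_X ^ (k - b) * (1 + fps_X) ^ (2 * k)))"
      by (simp add: sum_distrib_right fps_of_nat[symmetric] fps_const_power fps_const_mult mult.assoc)
    finally show ?thesis by (simp add: fps_sum_nth)
  qed
  \<comment> \<open>The term \<open>b = 0\<close> vanishes because \<open>fps_X ^ k\<close> starts
    above degree \<open>k - 1\<close>.\<close>
  also have "\<dots> = (\<Sum>b = 1..k. real (k choose b) * t ^ b * real ((2 * k) choose (b - 1)))"
  proof (rule sum.mono_neutral_cong_right)
    have nth: "fps_nth ((1 + fps_X) ^ n) i = real (n choose i)" for n i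
    proof -
      have "(1 + fps_X :: real fps) ^ n = (\<Sum>j\<le>n. fps_const (real (n choose j)) * fps_X ^ j)"
        using binomial_ring[of "fps_X :: real fps" 1 n] by (simp add: add.commute fps_of_nat)
      then show ?thesis
        by (simp add: fps_sum_nth if_distrib[of "\<lambda>x. _ * x"] sum.delta' not_le binomial_eq_0 cong: if_cong)
    qed
    fix b assume "b \<in> {1..k}"
    then show "real (k choose b) * t ^ b * fps_nth (fps_X ^ (k - b) * (1 + fps_X) ^ (2 * k)) (k - 1) =
        real (k choose b) * t ^ b * real ((2 * k) choose (b - 1))"
      by (auto simp: fps_X_power_mult_nth nth)
  qed (use assms in \<open>auto simp: fps_X_power_mult_nth\<close>)
  also have "1 / real k * \<dots> =
    (\<Sum>b = 1..k. 1 / real b * real ((k - 1) choose (b - 1)) * real ((2 * k) choose (b - 1)) * t ^ b)"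
    unfolding sum_distrib_left
  proof (rule sum.cong[OF refl])
    fix b assume b: "b \<in> {1..k}"
    then have "b * (k choose b) = k * ((k - 1) choose (b - 1))"
      using binomial_absorption[of "b - 1" k] by simp
    then have "real b * real (k choose b) = real k * real ((k - 1) choose (b - 1))"
      by (metis of_nat_mult)
    then have "real (k choose b) / real k = real ((k - 1) choose (b - 1)) / real b"
      using b assms by (simp add: field_simps)
    moreover have "1 / real k * (real (k choose b) * t ^ b * real ((2 * k) choose (b - 1))) =
        real (k choose b) / real k * (t ^ b * real ((2 * k) choose (b - 1)))"
      by simp
    ultimately show "1 / real k * (real (k choose b) * t ^ b * real ((2 * k) choose (b - 1))) =
        1 / real b * real ((k - 1) choose (b - 1)) * real ((2 * k) choose (b - 1)) * t ^ b"
      by simp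
  qed
  finally show ?thesis .
qed

section \<open>Representations by two-by-two matrices\<close>

definition cscale :: "complex \<Rightarrow> complex^'n^'m \<Rightarrow> complex^'n^'m" where
  "cscale c M = (\<chi> i j. c * M $ i $ j)"

definition hadj :: "complex^'n^'m \<Rightarrow> complex^'m^'n" where
  "hadj M = (\<chi> i j. cnj (M $ j $ i))"

definition opnorm :: "complex^'n^'m \<Rightarrow> real" where
  "opnorm M = onorm ((*v) M)"

lemma cscale_simps:
  "cscale c (M + N) = cscale c M + cscale c N"
  "cscale (c + d) M = cscale c M + cscale d M"
  "cscale (c * d) M = cscale c (cscale d M)"
  "cscale 1 M = M"
  "cscale 0 M = 0"
  by (simp_all add: cscale_def vec_eq_iff algebra_simps)

lemma cscale_mult:
  "cscale c M ** N = cscale c (M ** N)"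
  "M ** cscale c N = cscale c (M ** N)"
  by (simp_all add: cscale_def matrix_matrix_mult_def vec_eq_iff sum_distrib_left mult_ac)

lemma matrix_mult_add_left:
  fixes A B :: "'a::semiring_1^'n^'m"
  shows "(A + B) ** C = A ** C + B ** C"
  by (simp add: matrix_matrix_mult_def vec_eq_iff distrib_right sum.distrib)

lemma hadj_simps:
  "hadj (hadj M) = M"
  "hadj (M + N) = hadj M + hadj N"
  "hadj (cscale c M) = cscale (cnj c) (hadj M)"
  by (simp_all add: hadj_def cscale_def vec_eq_iff)

lemma hadj_mult: "hadj (M ** N) = hadj N ** hadj M"
  by (simp add: hadj_def matrix_matrix_mult_def vec_eq_iff mult.commute)

text \<open>The real inner product is the real part of the Hermitian one, which is enough to handle
  norms.\<close>

lemma inner_hadj: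
  fixes M :: "complex^'n^'m"
  shows "(M *v x) \<bullet> y = x \<bullet> (hadj M *v y)"
proof -
  have inner_Re: "a \<bullet> b = Re (a * cnj b)" for a b :: complex
    by (simp add: inner_complex_def)
  have "(M *v x) \<bullet> y = (\<Sum>i\<in>UNIV. \<Sum>j\<in>UNIV. Re (M $ i $ j * x $ j * cnj (y $ i)))"
    by (simp add: inner_vec_def inner_Re matrix_vector_mult_def sum_distrib_right del: times_complex.sel)
  also have "\<dots> = (\<Sum>j\<in>UNIV. \<Sum>i\<in>UNIV. Re (x $ j * cnj (cnj (M $ i $ j) * y $ i)))"
    by (subst sum.swap) (simp add: mult_ac del: times_complex.sel)
  also have "\<dots> = x \<bullet> (hadj M *v y)"
    by (simp add: inner_vec_def inner_Re matrix_vector_mult_def hadj_def sum_distrib_left del: times_complex.sel)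
  finally show ?thesis .
qed

section \<open>The operator norm of complex matrices\<close>

lemma opnorm_mult_vec: "norm (M *v x) \<le> opnorm M * norm x"
  unfolding opnorm_def by (rule onorm) simp

lemma opnorm_nonneg: "0 \<le> opnorm M"
  unfolding opnorm_def by (rule onorm_pos_le) simp

lemma opnorm_bound: "0 \<le> b \<Longrightarrow> (\<And>x. norm (M *v x) \<le> b * norm x) \<Longrightarrow> opnorm M \<le> b"
  unfolding opnorm_def by (rule onorm_bound)

lemma opnorm_triangle: "opnorm (M + N) \<le> opnorm M + opnorm N"
proof (rule opnorm_bound)
  fix x
  have "norm ((M + N) *v x) \<le> norm (M *v x) + norm (N *v x)"
    by (simp add: matrix_vector_mult_add_rdistrib norm_triangle_ineq)
  then show "norm ((M + N) *v x) \<le> (opnorm M + opnorm N) * norm x"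
    using opnorm_mult_vec[of M x] opnorm_mult_vec[of N x] by (simp add: distrib_right)
qed (simp add: opnorm_nonneg)

lemma opnorm_mult: "opnorm (M ** N) \<le> opnorm M * opnorm N"
proof (rule opnorm_bound)
  fix x
  have "norm (M *v (N *v x)) \<le> opnorm M * norm (N *v x)"
    by (rule opnorm_mult_vec)
  also have "\<dots> \<le> opnorm M * (opnorm N * norm x)"
    by (intro mult_left_mono opnorm_mult_vec opnorm_nonneg)
  finally show "norm ((M ** N) *v x) \<le> opnorm M * opnorm N * norm x"
    by (simp add: matrix_vector_mul_assoc mult.assoc)
qed (simp add: opnorm_nonneg)

lemma opnorm_cscale: "opnorm (cscale c M) = cmod c * opnorm M"
proof -
  have vec: "cscale c M *v x = c *s (M *v x)" for c and M :: "complex^'n^'m" and x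
    by (simp add: cscale_def matrix_vector_mult_def vec_eq_iff sum_distrib_left mult.assoc)
  have norm_vec: "norm (c *s x) = cmod c * norm x" for c and x :: "complex^'m"
    by (simp add: norm_vec_def norm_mult L2_set_right_distrib)
  have le: "opnorm (cscale c M) \<le> cmod c * opnorm M" for c and M :: "complex^'n^'m"
    using opnorm_mult_vec[of M]
    by (intro opnorm_bound) (auto simp: vec norm_vec opnorm_nonneg mult.assoc intro!: mult_left_mono)
  show ?thesis
  proof (cases "c = 0")
    case True
    with le[of c M] opnorm_nonneg[of "cscale c M"] show ?thesis by simp
  next
    case False
    have "opnorm M = opnorm (cscale (1 / c) (cscale c M))"
      using False by (simp flip: cscale_simps(3) add: cscale_simps)
    also have "\<dots> \<le> cmod (1 / c) * opnorm (cscale c M)"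
      by (rule le)
    finally have "cmod c * opnorm M \<le> opnorm (cscale c M)"
      using False by (simp add: norm_divide field_simps)
    with le[of c M] show ?thesis by simp
  qed
qed

lemma opnorm_component: "cmod (M $ i $ j) \<le> opnorm M"
proof -
  have "cmod (M $ i $ j) = cmod ((M *v axis j 1) $ i)"
    by (simp add: matrix_vector_mult_def axis_def if_distrib[of "\<lambda>x. _ * x"] cong: if_cong)
  also have "\<dots> \<le> norm (M *v axis j 1)"
    by (rule Finite_Cartesian_Product.norm_nth_le)
  also have "\<dots> \<le> opnorm M"
    using opnorm_mult_vec[of M "axis j 1"] by simp
  finally show ?thesis .
qed

text \<open>Together with \<open>opnorm_component\<close> this makes convergence in operator norm
  entrywise, which is how completeness is obtained.\<close>

lemma opnorm_le_sum: "opnorm M \<le> (\<Sum>i\<in>UNIV. \<Sum>j\<in>UNIV. cmod (M $ i $ j))"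
proof (rule opnorm_bound)
  fix x
  have "norm (M *v x) \<le> (\<Sum>i\<in>UNIV. cmod ((M *v x) $ i))"
    unfolding norm_vec_def by (rule L2_set_le_sum) simp
  also have "\<dots> \<le> (\<Sum>i\<in>UNIV. \<Sum>j\<in>UNIV. cmod (M $ i $ j) * norm x)"
    unfolding matrix_vector_mult_def
    by (auto intro!: sum_mono sum_norm_le mult_left_mono simp: norm_mult Finite_Cartesian_Product.norm_nth_le)
  finally show "norm (M *v x) \<le> (\<Sum>i\<in>UNIV. \<Sum>j\<in>UNIV. cmod (M $ i $ j)) * norm x"
    by (simp add: sum_distrib_right)
qed (simp add: sum_nonneg)

lemma opnorm_eq_0: "opnorm M = 0 \<longleftrightarrow> M = 0"
proof
  assume "opnorm M = 0"
  then show "M = 0"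
    using opnorm_component[of M] by (simp add: vec_eq_iff)
next
  assume "M = 0"
  then show "opnorm M = 0"
    using opnorm_le_sum[of M] opnorm_nonneg[of M] by simp
qed

text \<open>One inequality is Cauchy-Schwarz for the square of the norm of \<open>M *v x\<close>.
  Combined with submultiplicativity it shows that the adjoint is isometric, and this gives the other
  one.\<close>

lemma opnorm_hadj_mult: "opnorm (hadj M ** M) = (opnorm M)\<^sup>2"
proof -
  have sq_le: "(opnorm M)\<^sup>2 \<le> opnorm (hadj M ** M)" for M :: "complex^'k^'l"
  proof -
    have "opnorm M \<le> sqrt (opnorm (hadj M ** M))"
    proof (rule opnorm_bound)
      fix x
      have "(norm (M *v x))\<^sup>2 = x \<bullet> (hadj M ** M *v x)"
        by (simp add: power2_norm_eq_inner inner_hadj matrix_vector_mul_assoc)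
      also have "\<dots> \<le> norm x * norm (hadj M ** M *v x)"
        by (rule norm_cauchy_schwarz)
      also have "\<dots> \<le> norm x * (opnorm (hadj M ** M) * norm x)"
        by (intro mult_left_mono opnorm_mult_vec) simp
      also have "\<dots> = (sqrt (opnorm (hadj M ** M)) * norm x)\<^sup>2"
        by (simp add: power_mult_distrib opnorm_nonneg power2_eq_square)
      finally show "norm (M *v x) \<le> sqrt (opnorm (hadj M ** M)) * norm x"
        by (rule power2_le_imp_le) (simp add: opnorm_nonneg)
    qed (simp add: opnorm_nonneg)
    then have "(opnorm M)\<^sup>2 \<le> (sqrt (opnorm (hadj M ** M)))\<^sup>2"
      by (intro power_mono opnorm_nonneg)
    then show ?thesis by (simp add: opnorm_nonneg)
  qed
  have le: "opnorm M \<le> opnorm (hadj M)" for M :: "complex^'k^'l"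
  proof (cases "opnorm M = 0")
    case False
    with opnorm_nonneg[of M] have "0 < opnorm M" by simp
    moreover have "opnorm M * opnorm M \<le> opnorm (hadj M) * opnorm M"
      using sq_le[of M] opnorm_mult[of "hadj M" M] by (simp add: power2_eq_square)
    ultimately show ?thesis by simp
  qed (simp add: opnorm_nonneg)
  have "opnorm (hadj M) = opnorm M"
    using le[of M] le[of "hadj M"] by (simp add: hadj_simps)
  with sq_le[of M] opnorm_mult[of "hadj M" M] show ?thesis
    by (simp add: power2_eq_square)
qed

text \<open>The universal property of \<open>is_A_h\<close> only speaks about algebras with elements of the type of the
  generators, so the matrices are transported into that type by an injection \<open>\<phi>\<close>.\<close>

definition matrix_cstar :: "(complex^'n^'n \<Rightarrow> 'a) \<Rightarrow> 'a cstar" where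
  "matrix_cstar \<phi> =
    \<lparr>carrier = range \<phi>,
     mult = \<lambda>x y. \<phi> (inv_into UNIV \<phi> x ** inv_into UNIV \<phi> y),
     one = \<phi> (mat 1),
     zero = \<phi> 0,
     add = \<lambda>x y. \<phi> (inv_into UNIV \<phi> x + inv_into UNIV \<phi> y),
     smult = \<lambda>c x. \<phi> (cscale c (inv_into UNIV \<phi> x)),
     adj = \<lambda>x. \<phi> (hadj (inv_into UNIV \<phi> x)),
     nrm = \<lambda>x. opnorm (inv_into UNIV \<phi> x)\<rparr>"

section \<open>Matrices as a C*-algebra on a given type\<close>

lemma complex_field_cring: "cring complex_field"
proof (rule cringI)
  show "abelian_group complex_field"
  proof (rule abelian_groupI)
    fix x assume "x \<in> carrier complex_field"
    show "\<exists>y\<in>carrier complex_field. y \<oplus>\<^bsub>complex_field\<^esub> x = \<zero>\<^bsub>complex_field\<^esub>"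
      by (rule bexI[of _ "- x"]) (simp_all add: complex_field_def)
  qed (simp_all add: complex_field_def add_ac)
  show "comm_monoid complex_field"
    by (rule comm_monoidI) (simp_all add: complex_field_def mult_ac)
qed (simp_all add: complex_field_def distrib_right)

context
  fixes \<phi> :: "complex^'n^'n \<Rightarrow> 'a"
  assumes inj: "inj \<phi>"
begin

private abbreviation "B \<equiv> matrix_cstar \<phi>"

lemma matrix_cstar_simps:
  "carrier B = range \<phi>"
  "\<phi> M \<otimes>\<^bsub>B\<^esub> \<phi> N = \<phi> (M ** N)"
  "\<one>\<^bsub>B\<^esub> = \<phi> (mat 1)"
  "\<zero>\<^bsub>B\<^esub> = \<phi> 0"
  "\<phi> M \<oplus>\<^bsub>B\<^esub> \<phi> N = \<phi> (M + N)"
  "c \<odot>\<^bsub>B\<^esub> \<phi> M = \<phi> (cscale c M)"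
  "adj B (\<phi> M) = \<phi> (hadj M)"
  "nrm B (\<phi> M) = opnorm M"
  using inj by (simp_all add: matrix_cstar_def)

lemma carrier_cases:
  assumes "x \<in> carrier B" obtains M where "x = \<phi> M"
  using assms by (auto simp: matrix_cstar_simps(1))

lemma matrix_cstar_abelian_group: "abelian_group B"
proof (rule abelian_groupI)
  fix x assume "x \<in> carrier B"
  then obtain M where "x = \<phi> M" by (auto simp: matrix_cstar_simps)
  then show "\<exists>y\<in>carrier B. y \<oplus>\<^bsub>B\<^esub> x = \<zero>\<^bsub>B\<^esub>"
    by (intro bexI[of _ "\<phi> (- M)"]) (simp_all add: matrix_cstar_simps)
qed (auto simp: matrix_cstar_simps algebra_simps)

lemma matrix_cstar_ring: "ring B"
proof (rule ringI)
  show "monoid B"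
    by (rule monoidI) (auto simp: matrix_cstar_simps matrix_mul_assoc)
qed (auto simp: matrix_cstar_simps matrix_add_ldistrib matrix_mult_add_left
    intro: matrix_cstar_abelian_group)

lemma matrix_cstar_minus: "\<phi> M \<ominus>\<^bsub>B\<^esub> \<phi> N = \<phi> (M - N)"
proof -
  interpret ring B by (rule matrix_cstar_ring)
  have "\<ominus>\<^bsub>B\<^esub> \<phi> N = \<phi> (- N)"
    by (rule minus_equality) (simp_all add: matrix_cstar_simps)
  then show ?thesis by (simp add: a_minus_def matrix_cstar_simps)
qed

lemma matrix_cstar_finsum: "(\<Oplus>\<^bsub>B\<^esub>i\<in>S. \<phi> (f i)) = \<phi> (sum f S)"
proof (cases "finite S")
  case True
  interpret ring B by (rule matrix_cstar_ring)
  from True show ?thesis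
    by (induction S) (simp_all add: matrix_cstar_simps finsum_insert Pi_def)
next
  case False
  interpret ring B by (rule matrix_cstar_ring)
  from False show ?thesis by (simp add: finsum_infinite matrix_cstar_simps)
qed

lemma matrix_cstar_complete: "Metric_space.mcomplete (carrier B) (cdist B)"
proof -
  have cdist: "cdist B (\<phi> M) (\<phi> N) = opnorm (M - N)" for M N
    by (simp add: cdist_def matrix_cstar_simps(1,8) matrix_cstar_minus)
  have outside: "cdist B x y = 0" if "\<not> (x \<in> carrier B \<and> y \<in> carrier B)" for x y
    using that by (auto simp: cdist_def)
  have opnorm_minus: "opnorm (M - N) = opnorm (N - M)" for M N :: "complex^'n^'n"
  proof -
    have "cscale (- 1) (M - N) = N - M"
      by (simp add: cscale_def vec_eq_iff)
    then show ?thesis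
      using opnorm_cscale[of "- 1" "M - N"] by simp
  qed
  have cdist_nonneg: "0 \<le> cdist B x y" and cdist_commute: "cdist B x y = cdist B y x" for x y
  proof -
    have "0 \<le> cdist B x y \<and> cdist B x y = cdist B y x"
    proof (cases "x \<in> carrier B \<and> y \<in> carrier B")
      case True
      then obtain M N where "x = \<phi> M" "y = \<phi> N"
        by (meson carrier_cases)
      then show ?thesis
        by (simp only: cdist opnorm_nonneg opnorm_minus[of M N])
    next
      case False
      then have False': "\<not> (y \<in> carrier B \<and> x \<in> carrier B)" by blast
      show ?thesis
        by (simp only: outside[OF False] outside[OF False'] order_refl simp_thms)
    qed
    then show "0 \<le> cdist B x y" "cdist B x y = cdist B y x" by auto
  qed
  interpret Metric_space "carrier B" "cdist B"
  proof
    show "0 \<le> cdist B x y" "cdist B x y = cdist B y x" for x y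
      by (rule cdist_nonneg cdist_commute)+
    fix x y z
    assume x: "x \<in> carrier B" and y: "y \<in> carrier B"
    then obtain M N where M: "x = \<phi> M" "y = \<phi> N" by (auto simp: matrix_cstar_simps)
    show "cdist B x y = 0 \<longleftrightarrow> x = y"
      using inj by (simp add: M cdist opnorm_eq_0 inj_eq)
    assume "z \<in> carrier B"
    then obtain K where K: "z = \<phi> K" by (auto simp: matrix_cstar_simps)
    show "cdist B x z \<le> cdist B x y + cdist B y z"
      using opnorm_triangle[of "M - N" "N - K"] by (simp add: M K cdist)
  qed
  show ?thesis
    unfolding mcomplete_def
  proof (intro allI impI)
    fix \<sigma> assume \<sigma>: "MCauchy \<sigma>"
    define s where "s n = inv_into UNIV \<phi> (\<sigma> n)" for n
    have s: "\<sigma> n = \<phi> (s n)" for n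
    proof -
      have "range \<sigma> \<subseteq> carrier B"
        using \<sigma> unfolding MCauchy_def by (rule conjunct1)
      then have "\<sigma> n \<in> range \<phi>"
        unfolding matrix_cstar_simps(1) by blast
      then show ?thesis by (simp only: s_def f_inv_into_f)
    qed
    have cauchy: "\<exists>N. \<forall>m\<ge>N. \<forall>n\<ge>N. opnorm (s m - s n) < e" if "0 < e" for e
    proof -
      have "\<forall>\<epsilon>>0. \<exists>N. \<forall>m n. N \<le> m \<longrightarrow> N \<le> n \<longrightarrow> opnorm (s m - s n) < \<epsilon>"
        using \<sigma> unfolding MCauchy_def s cdist by (rule conjunct2)
      with that show ?thesis by meson
    qed
    have l: "(\<lambda>n. s n $ i $ j) \<longlonglongrightarrow> Topological_Spaces.lim (\<lambda>n. s n $ i $ j)" for i j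
    proof -
      have "Cauchy (\<lambda>n. s n $ i $ j)"
      proof (rule metric_CauchyI)
        fix e :: real assume "0 < e"
        then obtain N where N: "\<forall>m\<ge>N. \<forall>n\<ge>N. opnorm (s m - s n) < e"
          using cauchy by blast
        show "\<exists>M. \<forall>m\<ge>M. \<forall>n\<ge>M. dist (s m $ i $ j) (s n $ i $ j) < e"
        proof (intro exI allI impI)
          fix m n assume "N \<le> m" "N \<le> n"
          then show "dist (s m $ i $ j) (s n $ i $ j) < e"
            using N opnorm_component[of "s m - s n" i j] by (fastforce simp: dist_norm)
        qed
      qed
      then show ?thesis
        by (simp add: Cauchy_convergent_iff convergent_LIMSEQ_iff)
    qed
    define lim where "lim = (\<chi> i j. Topological_Spaces.lim (\<lambda>n. s n $ i $ j))"
    have "(\<lambda>n. \<Sum>i\<in>UNIV. \<Sum>j\<in>UNIV. cmod ((s n - lim) $ i $ j)) \<longlonglongrightarrow> (\<Sum>i\<in>(UNIV::'n set). \<Sum>j\<in>(UNIV::'n set). 0)"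
      by (intro tendsto_sum tendsto_norm_zero) (simp add: lim_def LIM_zero_iff l)
    then have bound_lim: "(\<lambda>n. \<Sum>i\<in>UNIV. \<Sum>j\<in>UNIV. cmod ((s n - lim) $ i $ j)) \<longlonglongrightarrow> 0"
      by simp
    have "(\<lambda>n. opnorm (s n - lim)) \<longlonglongrightarrow> 0"
    proof (rule tendsto_sandwich[OF _ _ tendsto_const bound_lim])
      show "\<forall>\<^sub>F n in sequentially. 0 \<le> opnorm (s n - lim)"
        by (simp add: opnorm_nonneg)
      show "\<forall>\<^sub>F n in sequentially. opnorm (s n - lim) \<le> (\<Sum>i\<in>UNIV. \<Sum>j\<in>UNIV. cmod ((s n - lim) $ i $ j))"
        by (intro always_eventually allI opnorm_le_sum)
    qed
    then have "\<forall>e>0. \<exists>N. \<forall>n\<ge>N. opnorm (s n - lim) < e"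
      by (simp add: LIMSEQ_iff opnorm_nonneg)
    then have "limitin mtopology \<sigma> (\<phi> lim) sequentially"
      by (simp add: limit_metric_sequentially s cdist) (simp add: matrix_cstar_simps(1))
    then show "\<exists>x. limitin mtopology \<sigma> x sequentially" ..
  qed
qed

lemma matrix_cstar_algebra: "cstar_algebra B"
proof (intro cstar_algebra.intro cstar_algebra_axioms.intro matrix_cstar_ring matrix_cstar_complete)
  show "Module.module complex_field B"
  proof (rule moduleI[OF complex_field_cring matrix_cstar_abelian_group])
    show "(c \<oplus>\<^bsub>complex_field\<^esub> d) \<odot>\<^bsub>B\<^esub> x = c \<odot>\<^bsub>B\<^esub> x \<oplus>\<^bsub>B\<^esub> d \<odot>\<^bsub>B\<^esub> x" if "x \<in> carrier B" for c d x
      using that by (elim carrier_cases) (simp add: complex_field_def matrix_cstar_simps cscale_simps(2))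
    show "(c \<otimes>\<^bsub>complex_field\<^esub> d) \<odot>\<^bsub>B\<^esub> x = c \<odot>\<^bsub>B\<^esub> (d \<odot>\<^bsub>B\<^esub> x)" if "x \<in> carrier B" for c d x
      using that by (elim carrier_cases) (simp add: complex_field_def matrix_cstar_simps cscale_simps(3))
    show "\<one>\<^bsub>complex_field\<^esub> \<odot>\<^bsub>B\<^esub> x = x" if "x \<in> carrier B" for x
      using that by (elim carrier_cases) (simp add: complex_field_def matrix_cstar_simps cscale_simps(4))
  qed (elim carrier_cases; simp add: matrix_cstar_simps cscale_simps(1))+
qed (elim carrier_cases; simp add: matrix_cstar_simps cscale_mult hadj_simps hadj_mult opnorm_nonneg
    opnorm_eq_0 opnorm_triangle opnorm_cscale opnorm_mult opnorm_hadj_mult inj_eq[OF inj])+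

end

text \<open>Since the unit is not zero, its scalar multiples embed the complex numbers. An infinite
  set has the cardinality of its square, and using this at two levels encodes four matrix entries in
  one complex number.\<close>

lemma matrix_injection:
  fixes A :: "('a, 'm) cstar_scheme"
  assumes A: "cstar_algebra A" and nonzero: "\<one>\<^bsub>A\<^esub> \<noteq> \<zero>\<^bsub>A\<^esub>"
  shows "\<exists>\<phi> :: complex^2^2 \<Rightarrow> 'a. inj \<phi>"
proof -
  interpret cstar_algebra A by (rule A)
  interpret M: Module.module complex_field A by (rule complex_module)
  have cfield: "carrier complex_field = UNIV" "add complex_field = (+)"
    by (simp_all add: complex_field_def)
  have inj: "inj (\<lambda>c. c \<odot>\<^bsub>A\<^esub> \<one>\<^bsub>A\<^esub>)"
  proof (rule injI)
    fix c d :: complex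
    assume eq: "c \<odot>\<^bsub>A\<^esub> \<one>\<^bsub>A\<^esub> = d \<odot>\<^bsub>A\<^esub> \<one>\<^bsub>A\<^esub>"
    have closed: "c \<odot>\<^bsub>A\<^esub> \<one>\<^bsub>A\<^esub> \<in> carrier A" for c
      using M.smult_closed[of c "\<one>\<^bsub>A\<^esub>"] by (simp add: cfield)
    have "d \<odot>\<^bsub>A\<^esub> \<one>\<^bsub>A\<^esub> \<oplus>\<^bsub>A\<^esub> (c - d) \<odot>\<^bsub>A\<^esub> \<one>\<^bsub>A\<^esub> = d \<odot>\<^bsub>A\<^esub> \<one>\<^bsub>A\<^esub>"
      using M.smult_l_distr[of d "c - d" "\<one>\<^bsub>A\<^esub>"] eq by (simp add: cfield)
    then have "(c - d) \<odot>\<^bsub>A\<^esub> \<one>\<^bsub>A\<^esub> = \<zero>\<^bsub>A\<^esub>"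
      using closed by (metis add.l_cancel_one)
    then have "cmod (c - d) * nrm A \<one>\<^bsub>A\<^esub> = 0"
      using nrm_smult[of "\<one>\<^bsub>A\<^esub>" "c - d"] nrm_eq_0[of "\<zero>\<^bsub>A\<^esub>"] by simp
    then show "c = d" using nrm_eq_0[of "\<one>\<^bsub>A\<^esub>"] nonzero by simp
  qed
  have "infinite (UNIV :: complex set)"
    by (rule infinite_UNIV_char_0)
  then obtain f :: "complex \<times> complex \<Rightarrow> complex" where f: "inj f"
    using card_of_Times_same_infinite[of "UNIV :: complex set"]
    unfolding ordIso_iff_ordLeq card_of_ordLeq[symmetric] by auto
  have pair: "inj (\<lambda>v :: 'x^2. (v $ 1, v $ 2))"
    by (rule injI) (simp add: vec_eq_iff forall_2)
  have "inj (\<lambda>v :: complex^2. f (v $ 1, v $ 2))"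
    using inj_compose[OF f pair] by (simp add: comp_def)
  then obtain g :: "complex^2 \<Rightarrow> complex" where g: "inj g" by blast
  have "inj (\<lambda>M :: complex^2^2. f (g (M $ 1), g (M $ 2)))"
    using f g by (intro injI) (simp add: inj_eq vec_eq_iff forall_2)
  from inj_compose[OF inj this] show ?thesis by blast
qed

text \<open>Unitarity is reduced to sums of squares: the entries are self-adjoint, and the sums for
  two different rows or columns vanish term by term by the orthogonality relations.\<close>

definition cubic_matrix :: "nat \<Rightarrow> (nat \<Rightarrow> nat \<Rightarrow> complex^2^2) \<Rightarrow> bool" where
  "cubic_matrix n v \<longleftrightarrow>
    (\<forall>i\<in>{1..n}. \<forall>j\<in>{1..n}. hadj (v i j) = v i j) \<and>
    (\<forall>i\<in>{1..n}. (\<Sum>k\<in>{1..n}. v i k ** v i k) = mat 1 \<and> (\<Sum>k\<in>{1..n}. v k i ** v k i) = mat 1) \<and>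
    (\<forall>i\<in>{1..n}. \<forall>j\<in>{1..n}. \<forall>k\<in>{1..n}. j \<noteq> k \<longrightarrow> v i j ** v i k = 0 \<and> v j i ** v k i = 0)"

lemma cubic_unitary_matrix_cstar:
  assumes inj: "inj \<phi>" and v: "cubic_matrix n v"
  shows "cubic_unitary (matrix_cstar \<phi>) n (\<lambda>i j. \<phi> (v i j))"
proof -
  let ?B = "matrix_cstar \<phi>"
  note simps = matrix_cstar_simps[OF inj]
  have adj_v: "hadj (v i j) = v i j" if "i \<in> {1..n}" "j \<in> {1..n}" for i j
    using v that unfolding cubic_matrix_def by blast
  have squares: "(\<Sum>k\<in>{1..n}. v i k ** v i k) = mat 1" "(\<Sum>k\<in>{1..n}. v k i ** v k i) = mat 1"
    if "i \<in> {1..n}" for i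
    using v that unfolding cubic_matrix_def by blast+
  have orth: "v i j ** v i k = 0" "v j i ** v k i = 0"
    if "i \<in> {1..n}" "j \<in> {1..n}" "k \<in> {1..n}" "j \<noteq> k" for i j k
    using v that unfolding cubic_matrix_def by blast+
  have rows: "(\<Oplus>\<^bsub>?B\<^esub>k\<in>{1..n}. \<phi> (v i k) \<otimes>\<^bsub>?B\<^esub> adj ?B (\<phi> (v j k))) = (if i = j then \<one>\<^bsub>?B\<^esub> else \<zero>\<^bsub>?B\<^esub>)"
    if "i \<in> {1..n}" "j \<in> {1..n}" for i j
  proof -
    have rows: "(\<Oplus>\<^bsub>?B\<^esub>k\<in>{1..n}. \<phi> (v i k) \<otimes>\<^bsub>?B\<^esub> adj ?B (\<phi> (v j k))) = \<phi> (\<Sum>k\<in>{1..n}. v i k ** hadj (v j k))"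
      by (simp only: simps matrix_cstar_finsum[OF inj])
    also have "(\<Sum>k\<in>{1..n}. v i k ** hadj (v j k)) = (\<Sum>k\<in>{1..n}. if i = j then v i k ** v i k else 0)"
      using that by (intro sum.cong) (auto simp: adj_v intro: orth simp del: One_nat_def)
    finally show ?thesis
      using that by (cases "i = j") (simp_all add: simps squares del: One_nat_def)
  qed
  have columns: "(\<Oplus>\<^bsub>?B\<^esub>k\<in>{1..n}. adj ?B (\<phi> (v k i)) \<otimes>\<^bsub>?B\<^esub> \<phi> (v k j)) = (if i = j then \<one>\<^bsub>?B\<^esub> else \<zero>\<^bsub>?B\<^esub>)"
    if "i \<in> {1..n}" "j \<in> {1..n}" for i j
  proof -
    have "(\<Oplus>\<^bsub>?B\<^esub>k\<in>{1..n}. adj ?B (\<phi> (v k i)) \<otimes>\<^bsub>?B\<^esub> \<phi> (v k j)) = \<phi> (\<Sum>k\<in>{1..n}. hadj (v k i) ** v k j)"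
      by (simp only: simps matrix_cstar_finsum[OF inj])
    also have "(\<Sum>k\<in>{1..n}. hadj (v k i) ** v k j) = (\<Sum>k\<in>{1..n}. if i = j then v k i ** v k i else 0)"
      using that by (intro sum.cong) (auto simp: adj_v intro: orth simp del: One_nat_def)
    finally show ?thesis
      using that by (cases "i = j") (simp_all add: simps squares del: One_nat_def)
  qed
  have unitary: "unitary_matrix ?B n (\<lambda>i j. \<phi> (v i j))"
    unfolding unitary_matrix_def by (intro conjI ballI rows columns) (simp_all only: simps rangeI)
  show ?thesis
    unfolding cubic_unitary_def
  proof (intro conjI ballI impI)
    fix i j assume i: "i \<in> {1..n}" and j: "j \<in> {1..n}"
    show "adj ?B (\<phi> (v i j)) = \<phi> (v i j)" by (simp only: simps adj_v[OF i j])
    fix k assume k: "k \<in> {1..n}" "j \<noteq> k"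
    show "\<phi> (v i j) \<otimes>\<^bsub>?B\<^esub> \<phi> (v i k) = \<zero>\<^bsub>?B\<^esub>" "\<phi> (v j i) \<otimes>\<^bsub>?B\<^esub> \<phi> (v k i) = \<zero>\<^bsub>?B\<^esub>"
      by (simp_all only: simps orth[OF i j k])
  qed (rule unitary)
qed

text \<open>The homomorphism of the universal property is followed by the inverse of the injection,
  so that everything afterwards happens among actual matrices. A nonzero unit is what makes the type
  large enough.\<close>

lemma matrix_representation:
  fixes A :: "'a cstar"
  assumes A: "is_A_h n A u" and nonzero: "\<one>\<^bsub>A\<^esub> \<noteq> \<zero>\<^bsub>A\<^esub>"
    and v: "cubic_matrix n v"
  shows "\<exists>g. (\<forall>x\<in>carrier A. \<forall>y\<in>carrier A. g (x \<oplus>\<^bsub>A\<^esub> y) = g x + g y \<and> g (x \<otimes>\<^bsub>A\<^esub> y) = g x ** g y) \<and>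
      g \<one>\<^bsub>A\<^esub> = mat 1 \<and> (\<forall>x\<in>carrier A. \<forall>c. g (c \<odot>\<^bsub>A\<^esub> x) = cscale c (g x)) \<and>
      (\<forall>i\<in>{1..n}. \<forall>j\<in>{1..n}. g (u i j) = v i j)"
proof -
  have "cstar_algebra A" using A by (simp add: is_A_h_def)
  from matrix_injection[OF this nonzero] obtain \<phi> :: "complex^2^2 \<Rightarrow> 'a" where inj: "inj \<phi>" by blast
  let ?B = "matrix_cstar \<phi>"
  note simps = matrix_cstar_simps[OF inj]
  have cubic: "cubic_unitary ?B n (\<lambda>i j. \<phi> (v i j))"
    by (rule cubic_unitary_matrix_cstar[OF inj v])
  have "\<exists>f\<in>star_hom A ?B. \<forall>i\<in>{1..n}. \<forall>j\<in>{1..n}. f (u i j) = \<phi> (v i j)"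
    by (rule A[unfolded is_A_h_def, THEN conjunct2, THEN conjunct2, THEN conjunct2, THEN spec, THEN spec,
          THEN mp, OF conjI, OF matrix_cstar_algebra[OF inj] cubic])
  then obtain f where f: "f \<in> star_hom A ?B"
    and fu: "\<forall>i\<in>{1..n}. \<forall>j\<in>{1..n}. f (u i j) = \<phi> (v i j)"
    by (rule bexE)
  from f have ring_hom: "f \<in> ring_hom A ?B"
    and scale: "\<And>x c. x \<in> carrier A \<Longrightarrow> f (c \<odot>\<^bsub>A\<^esub> x) = c \<odot>\<^bsub>?B\<^esub> f x"
    unfolding star_hom_def by blast+
  define g where "g x = inv_into UNIV \<phi> (f x)" for x
  have f_eq: "f x = \<phi> (g x)" if "x \<in> carrier A" for x
    using ring_hom_closed[OF ring_hom that] by (simp only: g_def simps(1) f_inv_into_f)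
  have inv: "inv_into UNIV \<phi> (\<phi> M) = M" for M using inj by simp
  show ?thesis
  proof (intro exI conjI ballI allI)
    fix x y assume x: "x \<in> carrier A" and y: "y \<in> carrier A"
    show "g (x \<oplus>\<^bsub>A\<^esub> y) = g x + g y"
      unfolding g_def[of "x \<oplus>\<^bsub>A\<^esub> y"]
      by (simp only: ring_hom_add[OF ring_hom x y] f_eq[OF x] f_eq[OF y] simps inv)
    show "g (x \<otimes>\<^bsub>A\<^esub> y) = g x ** g y"
      unfolding g_def[of "x \<otimes>\<^bsub>A\<^esub> y"]
      by (simp only: ring_hom_mult[OF ring_hom x y] f_eq[OF x] f_eq[OF y] simps inv)
  next
    show "g \<one>\<^bsub>A\<^esub> = mat 1"
      by (simp only: g_def ring_hom_one[OF ring_hom] simps inv)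
  next
    fix x c assume x: "x \<in> carrier A"
    show "g (c \<odot>\<^bsub>A\<^esub> x) = cscale c (g x)"
      unfolding g_def[of "c \<odot>\<^bsub>A\<^esub> x"] by (simp only: scale[OF x] f_eq[OF x] simps inv)
  next
    fix i j assume "i \<in> {1..n}" "j \<in> {1..n}"
    then show "g (u i j) = v i j"
      using fu by (simp only: g_def inv)
  qed
qed

section \<open>Sums over words\<close>

definition words :: "nat \<Rightarrow> nat \<Rightarrow> nat list set" where
  "words n k = {w. set w \<subseteq> {1..n} \<and> length w = k}"

lemma finite_words: "finite (words n k)"
  unfolding words_def by (rule finite_lists_length_eq) simp

lemma words_0 [simp]: "words n 0 = {[]}"
  by (auto simp: words_def)

lemma words_Suc: "words n (Suc k) = (\<lambda>(x, w). x # w) ` ({1..n} \<times> words n k)"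
  by (auto simp: words_def length_Suc_conv image_iff)

lemma sum_words_Suc: "(\<Sum>w\<in>words n (Suc k). f w) = (\<Sum>x\<in>{1..n}. \<Sum>w\<in>words n k. f (x # w))"
proof -
  have "(\<Sum>w\<in>words n (Suc k). f w) = (\<Sum>(x, w)\<in>{1..n} \<times> words n k. f (x # w))"
    unfolding words_Suc by (subst sum.reindex) (auto simp: inj_on_def intro!: sum.cong)
  then show ?thesis by (simp add: sum.cartesian_product)
qed

lemma sum_words_append:
  "(\<Sum>w\<in>words n (j + k). f w) = (\<Sum>v\<in>words n j. \<Sum>w\<in>words n k. f (v @ w))"
  by (induction j arbitrary: f) (simp_all add: sum_words_Suc)

lemma words_split:
  assumes "w \<in> words n (j + k)"
  obtains v u where "w = v @ u" "v \<in> words n j" "u \<in> words n k"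
proof
  show "w = take j w @ drop j w" by simp
  show "take j w \<in> words n j" "drop j w \<in> words n k"
    using assms set_take_subset[of j w] set_drop_subset[of j w] by (auto simp: words_def)
qed


section \<open>Words in the entries of a cubic unitary\<close>

text \<open>Relations in an algebra are tested through additive maps into ordinary groups. This
  turns \<open>finsum\<close> into \<open>sum\<close> and lets one computation serve both the Haar
  functional and the identity of a matrix algebra.\<close>

definition additive_on :: "('a, 'm) ring_scheme \<Rightarrow> ('a \<Rightarrow> 'b::ab_group_add) \<Rightarrow> bool" where
  "additive_on A \<phi> \<longleftrightarrow> (\<forall>x\<in>carrier A. \<forall>y\<in>carrier A. \<phi> (x \<oplus>\<^bsub>A\<^esub> y) = \<phi> x + \<phi> y)"

lemma (in ring) additive_on_zero: "additive_on R \<phi> \<Longrightarrow> \<phi> \<zero> = 0"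
  unfolding additive_on_def using zero_closed by (metis add_cancel_right_right l_zero)

lemma (in ring) additive_on_finsum:
  assumes "additive_on R \<phi>" and "finite S" and "f \<in> S \<rightarrow> carrier R"
  shows "\<phi> (\<Oplus>i\<in>S. f i) = (\<Sum>i\<in>S. \<phi> (f i))"
  using assms(2,3)
proof (induction S)
  case empty
  then show ?case using additive_on_zero[OF assms(1)] by simp
next
  case (insert x S)
  have "f x \<in> carrier R" "f \<in> S \<rightarrow> carrier R" "(\<Oplus>i\<in>S. f i) \<in> carrier R"
    using insert by (auto simp: Pi_def)
  with insert show ?case
    using assms(1) unfolding additive_on_def by (simp add: finsum_insert)
qed

lemma (in ring) additive_on_mult_left:
  "additive_on R \<phi> \<Longrightarrow> a \<in> carrier R \<Longrightarrow> additive_on R (\<lambda>x. \<phi> (a \<otimes> x))"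
  unfolding additive_on_def by (simp add: r_distr)

lemma (in ring) additive_on_mult_right:
  "additive_on R \<phi> \<Longrightarrow> a \<in> carrier R \<Longrightarrow> additive_on R (\<lambda>x. \<phi> (x \<otimes> a))"
  unfolding additive_on_def by (simp add: l_distr)

text \<open>For words of equal length, the entry in row \<open>w\<close> and column \<open>l\<close>
  of the tensor power of \<open>u\<close>.\<close>

fun uword :: "('a, 'm) monoid_scheme \<Rightarrow> (nat \<Rightarrow> nat \<Rightarrow> 'a) \<Rightarrow> nat list \<Rightarrow> nat list \<Rightarrow> 'a" where
  "uword A u (x # w) (y # l) = u x y \<otimes>\<^bsub>A\<^esub> uword A u w l"
| "uword A u _ _ = \<one>\<^bsub>A\<^esub>"

locale cubic_algebra = cstar_algebra A for A :: "('a, 'm) cstar_scheme" (structure) +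
  fixes n :: nat and u :: "nat \<Rightarrow> nat \<Rightarrow> 'a"
  assumes cubic: "cubic_unitary A n u"
begin

lemma u_closed: "i \<in> {1..n} \<Longrightarrow> j \<in> {1..n} \<Longrightarrow> u i j \<in> carrier A"
  using cubic unfolding cubic_unitary_def unitary_matrix_def by blast

lemma u_adj: "i \<in> {1..n} \<Longrightarrow> j \<in> {1..n} \<Longrightarrow> adj A (u i j) = u i j"
  using cubic unfolding cubic_unitary_def by blast

lemma u_orth:
  assumes "i \<in> {1..n}" "j \<in> {1..n}" "k \<in> {1..n}" "j \<noteq> k"
  shows "u i j \<otimes> u i k = \<zero>" "u j i \<otimes> u k i = \<zero>"
  using cubic assms unfolding cubic_unitary_def by blast+

lemma uword_closed: "w \<in> words n k \<Longrightarrow> l \<in> words n k \<Longrightarrow> uword A u w l \<in> carrier A"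
proof (induction k arbitrary: w l)
  case (Suc k)
  then obtain x w' y l' where "w = x # w'" "l = y # l'" "w' \<in> words n k" "l' \<in> words n k"
    "x \<in> {1..n}" "y \<in> {1..n}"
    by (cases w; cases l; auto simp: words_def)
  with Suc.IH show ?case
    by (simp only: uword.simps) (intro m_closed u_closed)
qed auto

lemma uword_append:
  assumes "v \<in> words n j" "l \<in> words n j" "w \<in> words n k" "m \<in> words n k"
  shows "uword A u (v @ w) (l @ m) = uword A u v l \<otimes> uword A u w m"
  using assms
proof (induction j arbitrary: v l)
  case (Suc j)
  then obtain x v' y l' where "v = x # v'" "l = y # l'" "v' \<in> words n j" "l' \<in> words n j"
    "x \<in> {1..n}" "y \<in> {1..n}"
    by (cases v; cases l; auto simp: words_def)
  moreover have "uword A u v' l' \<in> carrier A" "uword A u w m \<in> carrier A" "u x y \<in> carrier A"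
    using calculation Suc.prems uword_closed u_closed by blast+
  ultimately show ?case
    using Suc by (simp add: m_assoc)
qed (auto simp: uword_closed)

lemma additive_row_squares:
  assumes "additive_on A \<phi>" and "i \<in> {1..n}"
  shows "(\<Sum>k\<in>{1..n}. \<phi> (u i k \<otimes> u i k)) = \<phi> \<one>" "(\<Sum>k\<in>{1..n}. \<phi> (u k i \<otimes> u k i)) = \<phi> \<one>"
proof -
  have "(\<Oplus>k\<in>{1..n}. u i k \<otimes> adj A (u i k)) = \<one>" "(\<Oplus>k\<in>{1..n}. adj A (u k i) \<otimes> u k i) = \<one>"
    using cubic assms(2) unfolding cubic_unitary_def unitary_matrix_def by auto
  moreover have "\<phi> (\<Oplus>k\<in>{1..n}. u i k \<otimes> adj A (u i k)) = (\<Sum>k\<in>{1..n}. \<phi> (u i k \<otimes> adj A (u i k)))"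
    by (rule additive_on_finsum[OF assms(1)]) (use assms(2) in \<open>auto simp: u_adj u_closed\<close>)
  moreover have "\<phi> (\<Oplus>k\<in>{1..n}. adj A (u k i) \<otimes> u k i) = (\<Sum>k\<in>{1..n}. \<phi> (adj A (u k i) \<otimes> u k i))"
    by (rule additive_on_finsum[OF assms(1)]) (use assms(2) in \<open>auto simp: u_adj u_closed\<close>)
  moreover have "(\<Sum>k\<in>{1..n}. \<phi> (u i k \<otimes> adj A (u i k))) = (\<Sum>k\<in>{1..n}. \<phi> (u i k \<otimes> u i k))"
    "(\<Sum>k\<in>{1..n}. \<phi> (adj A (u k i) \<otimes> u k i)) = (\<Sum>k\<in>{1..n}. \<phi> (u k i \<otimes> u k i))"
    using assms(2) by (auto simp: u_adj intro!: sum.cong)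
  ultimately show "(\<Sum>k\<in>{1..n}. \<phi> (u i k \<otimes> u i k)) = \<phi> \<one>" "(\<Sum>k\<in>{1..n}. \<phi> (u k i \<otimes> u k i)) = \<phi> \<one>"
    by simp_all
qed

text \<open>In the product of \<open>u i j\<close> with the sum of the squares of row
  \<open>i\<close>, orthogonality leaves only the cube.\<close>

lemma additive_cube:
  assumes \<phi>: "additive_on A \<phi>" and i: "i \<in> {1..n}" and j: "j \<in> {1..n}"
  shows "\<phi> (u i j \<otimes> (u i j \<otimes> u i j)) = \<phi> (u i j)"
proof -
  have "(\<Sum>k\<in>{1..n}. \<phi> (u i j \<otimes> (u i k \<otimes> u i k))) = \<phi> (u i j \<otimes> \<one>)"
    by (rule additive_row_squares(1)[OF additive_on_mult_left[OF \<phi> u_closed[OF i j]] i])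
  moreover have "(\<Sum>k\<in>{1..n}. \<phi> (u i j \<otimes> (u i k \<otimes> u i k))) =
      (\<Sum>k\<in>{1..n}. if k = j then \<phi> (u i j \<otimes> (u i j \<otimes> u i j)) else 0)"
  proof (rule sum.cong[OF refl])
    fix k assume k: "k \<in> {1..n}"
    have "u i j \<otimes> (u i k \<otimes> u i k) = \<zero>" if "k \<noteq> j"
      using u_orth(1)[OF i j k] that i j k by (simp add: m_assoc[symmetric] u_closed)
    then show "\<phi> (u i j \<otimes> (u i k \<otimes> u i k)) = (if k = j then \<phi> (u i j \<otimes> (u i j \<otimes> u i j)) else 0)"
      using additive_on_zero[OF \<phi>] by simp
  qed
  moreover have "(\<Sum>k\<in>{1..n}. if k = j then \<phi> (u i j \<otimes> (u i j \<otimes> u i j)) else 0) = \<phi> (u i j \<otimes> (u i j \<otimes> u i j))"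
    using j by simp
  ultimately show ?thesis using u_closed[OF i j] by simp
qed

text \<open>The vectors \<open>\<lambda>l. of_bool (compat c l)\<close> of the noncrossing even partitions \<open>c\<close> are fixed.
  Restricting the first letter of \<open>l\<close> makes an induction over the codes possible: two pieces of a
  block are joined by the relations \<open>u x y u z y = 0\<close> for \<open>x \<noteq> z\<close>.\<close>

lemma fixed_from_restricted:
  fixes \<phi> :: "'a \<Rightarrow> 'b::ab_group_add"
  assumes "\<And>\<phi> :: 'a \<Rightarrow> 'b. \<And>w y. additive_on A \<phi> \<Longrightarrow> w \<in> words n (length c) \<Longrightarrow> c \<noteq> [] \<Longrightarrow> y \<in> {1..n} \<Longrightarrow>
      (\<Sum>l\<in>words n (length c). if hd l = y \<and> compat c l then \<phi> (uword A u w l) else 0) =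
      (if compat c w then \<phi> (u (hd w) y \<otimes> u (hd w) y) else 0)"
    and \<phi>: "additive_on A \<phi>" and w: "w \<in> words n (length c)"
  shows "(\<Sum>l\<in>words n (length c). if compat c l then \<phi> (uword A u w l) else 0) =
    (if compat c w then \<phi> \<one> else 0)"
proof (cases "c = []")
  case False
  then obtain d c' x w' where c: "c = d # c'" "w = x # w'" and x: "x \<in> {1..n}"
    using w by (cases c; cases w; auto simp: words_def)
  have "(\<Sum>l\<in>words n (length c). if compat c l then \<phi> (uword A u w l) else 0) =
      (\<Sum>l\<in>words n (length c). \<Sum>y\<in>{1..n}. if hd l = y \<and> compat c l then \<phi> (uword A u w l) else 0)"
  proof (rule sum.cong[OF refl])
    fix l assume "l \<in> words n (length c)"
    then have "hd l \<in> {1..n}" by (cases l) (auto simp: words_def c)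
    then show "(if compat c l then \<phi> (uword A u w l) else 0) =
        (\<Sum>y\<in>{1..n}. if hd l = y \<and> compat c l then \<phi> (uword A u w l) else 0)"
      by (cases "compat c l") simp_all
  qed
  also have "\<dots> = (\<Sum>y\<in>{1..n}. if compat c w then \<phi> (u x y \<otimes> u x y) else 0)"
  proof -
    have "hd w = x" by (simp add: c)
    then show ?thesis
      by (subst sum.swap) (cases "compat c w"; simp add: assms(1)[OF \<phi> w False])
  qed
  also have "\<dots> = (if compat c w then \<phi> \<one> else 0)"
    using additive_row_squares(1)[OF \<phi> x] by simp
  finally show ?thesis .
qed (use w in auto)

text \<open>\<open>F z y\<close> is what the piece \<open>d\<close> leaves behind when its words
  start with \<open>y\<close>: an entry of \<open>u\<close> if its first block is odd, the square of
  one if it is even. This treats \<open>Cons\<close> and \<open>Next\<close> together. Orthogonality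
  kills the product with \<open>u x y\<close> unless both pieces of the block carry the same letter
  in \<open>w\<close>.\<close>

lemma restricted_join:
  fixes \<phi> :: "'a \<Rightarrow> 'b::ab_group_add"
  assumes fixed_e: "\<And>\<phi> :: 'a \<Rightarrow> 'b. \<And>w. additive_on A \<phi> \<Longrightarrow> w \<in> words n (length e) \<Longrightarrow>
      (\<Sum>l\<in>words n (length e). if compat e l then \<phi> (uword A u w l) else 0) =
      (if compat e w then \<phi> \<one> else 0)"
    and restr_d: "\<And>\<phi> :: 'a \<Rightarrow> 'b. \<And>w y. additive_on A \<phi> \<Longrightarrow> w \<in> words n (length d) \<Longrightarrow> y \<in> {1..n} \<Longrightarrow>
      (\<Sum>l\<in>words n (length d). if hd l = y \<and> compat d l then \<phi> (uword A u w l) else 0) =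
      (if compat d w then \<phi> (F (hd w) y) else 0)"
    and F: "\<And>x z y. x \<in> {1..n} \<Longrightarrow> z \<in> {1..n} \<Longrightarrow> y \<in> {1..n} \<Longrightarrow> F x y \<in> carrier A \<and> (x \<noteq> z \<longrightarrow> u x y \<otimes> F z y = \<zero>)"
    and e: "self_contained e" and d: "d \<noteq> []"
    and \<phi>: "additive_on A \<phi>" and w: "w \<in> words n (Suc (length e + length d))" and y: "y \<in> {1..n}"
  shows "(\<Sum>l\<in>words n (Suc (length e + length d)).
      if hd l = y \<and> compat (Suc (length e) # e @ d) l then \<phi> (uword A u w l) else 0) =
    (if compat (Suc (length e) # e @ d) w then \<phi> (u (hd w) y \<otimes> F (hd w) y) else 0)"
proof -
  obtain x w' where w': "w = x # w'" "x \<in> {1..n}" "w' \<in> words n (length e + length d)"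
    using w by (cases w) (auto simp: words_def)
  obtain w1 w2 where w12: "w' = w1 @ w2" "w1 \<in> words n (length e)" "w2 \<in> words n (length d)"
    using words_split[OF w'(3)] by blast
  have compat_join: "compat (Suc (length e) # e @ d) (z # l @ m) \<longleftrightarrow> hd m = z \<and> compat e l \<and> compat d m"
    if "l \<in> words n (length e)" "m \<in> words n (length d)" for z l m
  proof -
    have "m \<noteq> []" "length l = length e" "length m = length d" "Suc 0 \<le> length d"
      using that d by (cases d; auto simp: words_def)+
    then show ?thesis
      using compat_append[OF e, of l d m] by (auto simp: nth_append hd_conv_nth)
  qed
  have hd_w2: "hd w2 \<in> {1..n}"
    using w12(3) d by (cases w2) (auto simp: words_def)
  have uxy: "u x y \<in> carrier A" using w' y by (simp add: u_closed)
  have "(\<Sum>l\<in>words n (Suc (length e + length d)).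
      if hd l = y \<and> compat (Suc (length e) # e @ d) l then \<phi> (uword A u w l) else 0) =
    (\<Sum>z\<in>{1..n}. \<Sum>l\<in>words n (length e). \<Sum>m\<in>words n (length d).
      if z = y then (if hd m = y \<and> compat d m then
        (if compat e l then \<phi> (u x y \<otimes> (uword A u w1 l \<otimes> uword A u w2 m)) else 0) else 0) else 0)"
    unfolding sum_words_Suc sum_words_append
  proof (intro sum.cong refl)
    fix z l m assume l: "l \<in> words n (length e)" and m: "m \<in> words n (length d)"
    have "uword A u w (z # l @ m) = u x z \<otimes> (uword A u w1 l \<otimes> uword A u w2 m)"
      by (simp only: w'(1) w12(1) uword.simps uword_append[OF w12(2) l w12(3) m])
    then show "(if hd (z # l @ m) = y \<and> compat (Suc (length e) # e @ d) (z # l @ m) then \<phi> (uword A u w (z # l @ m)) else 0) =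
      (if z = y then (if hd m = y \<and> compat d m then
        (if compat e l then \<phi> (u x y \<otimes> (uword A u w1 l \<otimes> uword A u w2 m)) else 0) else 0) else 0)"
      by (simp only: compat_join[OF l m] list.sel) (auto split: if_splits)
  qed
  also have "\<dots> = (\<Sum>m\<in>words n (length d). if hd m = y \<and> compat d m then
      (\<Sum>l\<in>words n (length e). if compat e l then \<phi> (u x y \<otimes> (uword A u w1 l \<otimes> uword A u w2 m)) else 0) else 0)"
    using y by (subst sum.swap, subst sum.swap, subst sum.swap)
      (auto simp: if_distrib[of "\<lambda>f. sum f _"] sum.delta intro!: sum.cong)
  \<comment> \<open>The inner code \<open>e\<close> is summed out between its neighbours, which is
    why \<open>fixed_e\<close> is assumed for all additive maps.\<close>
  also have "\<dots> = (\<Sum>m\<in>words n (length d). if hd m = y \<and> compat d m then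
      (if compat e w1 then \<phi> (u x y \<otimes> uword A u w2 m) else 0) else 0)"
  proof (intro sum.cong if_cong refl)
    fix m assume "m \<in> words n (length d)"
    then have m: "uword A u w2 m \<in> carrier A" using uword_closed w12 by blast
    show "(\<Sum>l\<in>words n (length e). if compat e l then \<phi> (u x y \<otimes> (uword A u w1 l \<otimes> uword A u w2 m)) else 0) =
        (if compat e w1 then \<phi> (u x y \<otimes> uword A u w2 m) else 0)"
      using fixed_e[OF additive_on_mult_right[OF additive_on_mult_left[OF \<phi> uxy] m] w12(2)] m by simp
  qed
  also have "\<dots> = (if compat e w1 then if compat d w2 then \<phi> (u x y \<otimes> F (hd w2) y) else 0 else 0)"
    using restr_d[OF additive_on_mult_left[OF \<phi> uxy] w12(3) y] by (cases "compat e w1") (simp_all cong: if_cong)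
  also have "\<dots> = (if compat (Suc (length e) # e @ d) w then \<phi> (u (hd w) y \<otimes> F (hd w) y) else 0)"
    using F[OF w'(2) hd_w2 y] additive_on_zero[OF \<phi>] compat_join[OF w12(2,3), of x]
    by (auto simp: w'(1) w12(1))
  finally show ?thesis .
qed

text \<open>The first block produces a power of a single entry with its size as exponent. As the
  cube of an entry is the entry, the power is the square for an even block and the entry itself for
  an odd one.\<close>

lemma restricted_codes:
  fixes \<phi> :: "'a \<Rightarrow> 'b::ab_group_add"
  shows
  "even_code c \<Longrightarrow> additive_on A \<phi> \<Longrightarrow> w \<in> words n (length c) \<Longrightarrow> c \<noteq> [] \<Longrightarrow> y \<in> {1..n} \<Longrightarrow>
      (\<Sum>l\<in>words n (length c). if hd l = y \<and> compat c l then \<phi> (uword A u w l) else 0) =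
      (if compat c w then \<phi> (u (hd w) y \<otimes> u (hd w) y) else 0)"
  "odd_code d \<Longrightarrow> additive_on A \<phi> \<Longrightarrow> w \<in> words n (length d) \<Longrightarrow> y \<in> {1..n} \<Longrightarrow>
      (\<Sum>l\<in>words n (length d). if hd l = y \<and> compat d l then \<phi> (uword A u w l) else 0) =
      (if compat d w then \<phi> (u (hd w) y) else 0)"
proof (induction arbitrary: \<phi> w y and \<phi> w y rule: even_code_odd_code.inducts)
  case Nil
  then show ?case by simp
next
  case (Cons e d)
  have "(\<Sum>l\<in>words n (Suc (length e + length d)).
      if hd l = y \<and> compat (Suc (length e) # e @ d) l then \<phi> (uword A u w l) else 0) =
    (if compat (Suc (length e) # e @ d) w then \<phi> (u (hd w) y \<otimes> u (hd w) y) else 0)"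
  proof (rule restricted_join)
    show "(\<Sum>l\<in>words n (length e). if compat e l then \<phi> (uword A u w l) else 0) =
        (if compat e w then \<phi> \<one> else 0)"
      if "additive_on A \<phi>" "w \<in> words n (length e)" for \<phi> :: "'a \<Rightarrow> 'b" and w
      by (rule fixed_from_restricted[OF Cons.IH(1) that])
  qed (use Cons in \<open>auto simp: u_closed u_orth self_contained_code not_odd_code_Nil\<close>)
  then show ?case by simp
next
  case (Last e)
  obtain x w' where w': "w = x # w'" "x \<in> {1..n}" "w' \<in> words n (length e)"
    using Last.prems(2) by (cases w) (auto simp: words_def)
  have uxy: "u x y \<in> carrier A" using w' Last.prems by (simp add: u_closed)
  have "(\<Sum>l\<in>words n (length (0 # e)). if hd l = y \<and> compat (0 # e) l then \<phi> (uword A u w l) else 0) =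
      (\<Sum>z\<in>{1..n}. if z = y then (\<Sum>l\<in>words n (length e). if compat e l then \<phi> (u x y \<otimes> uword A u w' l) else 0) else 0)"
    unfolding length_Cons sum_words_Suc
  proof (rule sum.cong[OF refl])
    fix z
    show "(\<Sum>l\<in>words n (length e). if hd (z # l) = y \<and> compat (0 # e) (z # l) then \<phi> (uword A u w (z # l)) else 0) =
      (if z = y then \<Sum>l\<in>words n (length e). if compat e l then \<phi> (u x y \<otimes> uword A u w' l) else 0 else 0)"
      unfolding w'(1) by (cases "z = y") (simp_all cong: if_cong)
  qed
  also have "\<dots> = (\<Sum>l\<in>words n (length e). if compat e l then \<phi> (u x y \<otimes> uword A u w' l) else 0)"
    using Last.prems(3) by simp
  also have "\<dots> = (if compat e w' then \<phi> (u x y \<otimes> \<one>) else 0)"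
    by (rule fixed_from_restricted[OF Last.IH(1) additive_on_mult_left[OF Last.prems(1) uxy] w'(3)])
  finally show ?case using uxy by (simp add: w')
next
  case (Next e f)
  have "(\<Sum>l\<in>words n (Suc (length e + length f)).
      if hd l = y \<and> compat (Suc (length e) # e @ f) l then \<phi> (uword A u w l) else 0) =
    (if compat (Suc (length e) # e @ f) w then \<phi> (u (hd w) y \<otimes> (u (hd w) y \<otimes> u (hd w) y)) else 0)"
  proof (rule restricted_join)
    show "(\<Sum>l\<in>words n (length e). if compat e l then \<phi> (uword A u w l) else 0) =
        (if compat e w then \<phi> \<one> else 0)"
      if "additive_on A \<phi>" "w \<in> words n (length e)" for \<phi> :: "'a \<Rightarrow> 'b" and w
      by (rule fixed_from_restricted[OF Next.IH(1) that])
    show "u x y \<otimes> u x y \<in> carrier A \<and> (x \<noteq> z \<longrightarrow> u x y \<otimes> (u z y \<otimes> u z y) = \<zero>)"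
      if "x \<in> {1..n}" "z \<in> {1..n}" "y \<in> {1..n}" for x z y
      using that u_orth(2)[of y x z] by (simp add: m_assoc[symmetric] u_closed)
  qed (use Next in \<open>auto simp: self_contained_code\<close>)
  moreover have "\<phi> (u (hd w) y \<otimes> (u (hd w) y \<otimes> u (hd w) y)) = \<phi> (u (hd w) y)"
    using Next.prems by (intro additive_cube) (cases w; auto simp: words_def)+
  ultimately show ?case by simp
qed

theorem even_code_fixed:
  fixes \<phi> :: "'a \<Rightarrow> 'b::ab_group_add"
  assumes "even_code c" and "additive_on A \<phi>" and "w \<in> words n (length c)"
  shows "(\<Sum>l\<in>words n (length c). if compat c l then \<phi> (uword A u w l) else 0) =
    (if compat c w then \<phi> \<one> else 0)"
  by (rule fixed_from_restricted[OF restricted_codes(1)[OF assms(1)] assms(2,3)])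

end

section \<open>Fixed vectors of two-by-two matrix models\<close>

fun mword :: "(nat \<Rightarrow> nat \<Rightarrow> complex^2^2) \<Rightarrow> nat list \<Rightarrow> nat list \<Rightarrow> complex^2^2" where
  "mword v (x # w) (y # l) = v x y ** mword v w l"
| "mword v _ _ = mat 1"

lemma matrix_cstar_id:
  "M \<otimes>\<^bsub>matrix_cstar id\<^esub> N = M ** N"
  "M \<oplus>\<^bsub>matrix_cstar id\<^esub> N = M + N"
  "\<one>\<^bsub>matrix_cstar id\<^esub> = mat 1"
  by (simp_all add: matrix_cstar_def)

lemma uword_matrix_cstar: "uword (matrix_cstar id) v w l = mword v w l"
  by (induction v w l rule: mword.induct) (simp_all only: uword.simps mword.simps matrix_cstar_id)

lemma matrix_zero_mult: "0 ** M = 0" "M ** 0 = 0" for M :: "complex^'n^'m"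
  by (simp_all add: matrix_matrix_mult_def vec_eq_iff)

text \<open>Invariance of the column vector \<open>\<xi>\<close> under the tensor power of
  \<open>u\<close>, tested in models by 2-by-2 matrices. The Haar coefficients satisfy it, and a few
  well chosen models determine all its solutions.\<close>

definition common_fixed :: "nat \<Rightarrow> nat \<Rightarrow> (nat list \<Rightarrow> complex) \<Rightarrow> bool" where
  "common_fixed n k \<xi> \<longleftrightarrow> (\<forall>v. cubic_matrix n v \<longrightarrow>
    (\<forall>w\<in>words n k. (\<Sum>l\<in>words n k. cscale (\<xi> l) (mword v w l)) = cscale (\<xi> w) (mat 1)))"

lemma cscale_diff: "cscale (c - d) M = cscale c M - cscale d M"
  by (simp add: cscale_def vec_eq_iff left_diff_distrib)

lemma cscale_sum: "cscale (\<Sum>i\<in>S. f i) M = (\<Sum>i\<in>S. cscale (f i) M)"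
  by (induction S rule: infinite_finite_induct) (simp_all add: cscale_simps)

lemma cscale_sum_right: "cscale c (\<Sum>i\<in>S. M i) = (\<Sum>i\<in>S. cscale c (M i))"
  by (induction S rule: infinite_finite_induct) (simp_all add: cscale_simps, simp_all add: cscale_def vec_eq_iff)

lemma cscale_left_commute: "cscale c (cscale d M) = cscale d (cscale c M)"
  by (simp add: cscale_def vec_eq_iff mult.left_commute)

lemma cscale_0_right: "cscale c 0 = 0"
  by (simp add: cscale_def vec_eq_iff)

lemma matrix_sum_mult: "(\<Sum>i\<in>S. M i) ** N = (\<Sum>i\<in>S. M i ** (N :: complex^'n^'m))"
  by (induction S rule: infinite_finite_induct)
    (simp_all add: matrix_mult_add_left matrix_zero_mult)

lemma matrix_mult_sum: "N ** (\<Sum>i\<in>S. M i) = (\<Sum>i\<in>S. (N :: complex^'n^'m) ** M i)"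
  by (induction S rule: infinite_finite_induct)
    (simp_all add: matrix_add_ldistrib matrix_zero_mult)

text \<open>The 2-by-2 matrices together with \<open>v\<close> form a cubic algebra themselves, and
  the identity is additive on it.\<close>

lemma code_common_fixed:
  assumes "even_code c" and "length c = k"
  shows "common_fixed n k (\<lambda>l. of_bool (compat c l))"
  unfolding common_fixed_def
proof (intro allI impI ballI)
  fix v w assume v: "cubic_matrix n v" and w: "w \<in> words n k"
  let ?B = "matrix_cstar id :: (complex^2^2) cstar"
  interpret B: cubic_algebra ?B n v
  proof (intro cubic_algebra.intro cubic_algebra_axioms.intro)
    show "cubic_unitary ?B n v"
      using cubic_unitary_matrix_cstar[OF inj_on_id v] by (simp only: id_apply)
  qed (rule matrix_cstar_algebra[OF inj_on_id])
  have "additive_on ?B (\<lambda>x. x)"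
    unfolding additive_on_def by (simp only: matrix_cstar_id) simp
  from B.even_code_fixed[OF assms(1) this, of w]
  have "(\<Sum>l\<in>words n k. if compat c l then mword v w l else 0) = (if compat c w then mat 1 else 0)"
    using w assms(2) by (simp only: uword_matrix_cstar matrix_cstar_id)
  moreover have "cscale (of_bool b) M = (if b then M else 0)" for b and M :: "complex^2^2"
    by (simp add: cscale_simps)
  ultimately show "(\<Sum>l\<in>words n k. cscale (of_bool (compat c l)) (mword v w l)) =
      cscale (of_bool (compat c w)) (mat 1)"
    by simp
qed

lemma common_fixed_diff_sum:
  assumes "common_fixed n k \<xi>" and "\<And>c. c \<in> S \<Longrightarrow> common_fixed n k (\<eta> c)"
  shows "common_fixed n k (\<lambda>l. \<xi> l - (\<Sum>c\<in>S. \<alpha> c * \<eta> c l))"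
  unfolding common_fixed_def
proof (intro allI impI ballI)
  fix v w assume v: "cubic_matrix n v" and w: "w \<in> words n k"
  have "(\<Sum>l\<in>words n k. cscale (\<xi> l - (\<Sum>c\<in>S. \<alpha> c * \<eta> c l)) (mword v w l)) =
      (\<Sum>l\<in>words n k. cscale (\<xi> l) (mword v w l)) -
      (\<Sum>c\<in>S. cscale (\<alpha> c) (\<Sum>l\<in>words n k. cscale (\<eta> c l) (mword v w l)))"
    by (simp add: cscale_diff cscale_sum cscale_sum_right cscale_simps(3) sum_subtractf)
      (rule sum.swap)
  also have "\<dots> = cscale (\<xi> w) (mat 1) - (\<Sum>c\<in>S. cscale (\<alpha> c) (cscale (\<eta> c w) (mat 1)))"
    using assms v w unfolding common_fixed_def by simp
  also have "\<dots> = cscale (\<xi> w - (\<Sum>c\<in>S. \<alpha> c * \<eta> c w)) (mat 1)"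
    by (simp add: cscale_diff cscale_sum cscale_simps(3))
  finally show "(\<Sum>l\<in>words n k. cscale (\<xi> l - (\<Sum>c\<in>S. \<alpha> c * \<eta> c l)) (mword v w l)) =
      cscale (\<xi> w - (\<Sum>c\<in>S. \<alpha> c * \<eta> c w)) (mat 1)" .
qed

lemma cscale_mat_1_eq: "cscale c (mat 1 :: complex^2^2) = cscale d (mat 1) \<longleftrightarrow> c = d"
  by (auto simp: cscale_def mat_def vec_eq_iff)

subsection \<open>Signed permutations\<close>

definition signed_perm :: "(nat \<Rightarrow> nat) \<Rightarrow> (nat \<Rightarrow> complex) \<Rightarrow> nat \<Rightarrow> nat \<Rightarrow> complex^2^2" where
  "signed_perm \<sigma> \<epsilon> i j = (if j = \<sigma> i then cscale (\<epsilon> i) (mat 1) else 0)"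

lemma cubic_signed_perm:
  assumes \<sigma>: "bij_betw \<sigma> {1..n} {1..n}" and \<epsilon>: "\<And>i. \<epsilon> i = 1 \<or> \<epsilon> i = -1"
  shows "cubic_matrix n (signed_perm \<sigma> \<epsilon>)"
proof -
  have sq: "cscale (\<epsilon> i) (mat 1) ** cscale (\<epsilon> i) (mat 1) = (mat 1 :: complex^2^2)" for i
    using \<epsilon>[of i] by (auto simp: cscale_mult cscale_simps(3)[symmetric] cscale_simps(4))
  have hadj: "hadj (cscale (\<epsilon> i) (mat 1)) = (cscale (\<epsilon> i) (mat 1) :: complex^2^2)" for i
    using \<epsilon>[of i] by (auto simp: hadj_def cscale_def mat_def vec_eq_iff)
  have hadj0: "hadj 0 = (0 :: complex^2^2)" by (simp add: hadj_def vec_eq_iff)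
  note zero = matrix_zero_mult
  have inj: "\<sigma> i = \<sigma> j \<longleftrightarrow> i = j" if "i \<in> {1..n}" "j \<in> {1..n}" for i j
    by (rule inj_on_eq_iff[OF bij_betw_imp_inj_on[OF \<sigma>] that])
  have range: "\<sigma> i \<in> {1..n}" if "i \<in> {1..n}" for i
    by (rule bij_betwE[OF \<sigma>, rule_format, OF that])
  show ?thesis
    unfolding cubic_matrix_def
  proof (intro conjI ballI impI)
    fix i assume i: "i \<in> {1..n}"
    have "(\<Sum>k\<in>{1..n}. signed_perm \<sigma> \<epsilon> i k ** signed_perm \<sigma> \<epsilon> i k) = (\<Sum>k\<in>{1..n}. if k = \<sigma> i then mat 1 else 0)"
      by (rule sum.cong) (auto simp: signed_perm_def sq zero)
    then show "(\<Sum>k\<in>{1..n}. signed_perm \<sigma> \<epsilon> i k ** signed_perm \<sigma> \<epsilon> i k) = mat 1"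
      using range[OF i] by simp
    obtain j where j: "j \<in> {1..n}" "\<sigma> j = i"
      using i bij_betw_imp_surj_on[OF \<sigma>] by (metis imageE)
    have "(\<Sum>k\<in>{1..n}. signed_perm \<sigma> \<epsilon> k i ** signed_perm \<sigma> \<epsilon> k i) = (\<Sum>k\<in>{1..n}. if k = j then mat 1 else 0)"
    proof (rule sum.cong[OF refl])
      fix k assume "k \<in> {1..n}"
      then show "signed_perm \<sigma> \<epsilon> k i ** signed_perm \<sigma> \<epsilon> k i = (if k = j then mat 1 else 0)"
        using inj[of k j] j by (cases "k = j") (simp_all add: signed_perm_def sq zero)
    qed
    then show "(\<Sum>k\<in>{1..n}. signed_perm \<sigma> \<epsilon> k i ** signed_perm \<sigma> \<epsilon> k i) = mat 1"
      using j by simp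
  next
    fix i j assume i: "i \<in> {1..n}" and j: "j \<in> {1..n}"
    show "hadj (signed_perm \<sigma> \<epsilon> i j) = signed_perm \<sigma> \<epsilon> i j"
      by (simp add: signed_perm_def hadj hadj0)
    fix k assume k: "k \<in> {1..n}" "j \<noteq> k"
    then show "signed_perm \<sigma> \<epsilon> i j ** signed_perm \<sigma> \<epsilon> i k = 0"
      by (simp add: signed_perm_def zero)
    show "signed_perm \<sigma> \<epsilon> j i ** signed_perm \<sigma> \<epsilon> k i = 0"
      using inj[OF j k(1)] k(2) by (auto simp: signed_perm_def zero)
  qed
qed

lemma mword_signed_perm:
  "length l = length w \<Longrightarrow> mword (signed_perm \<sigma> \<epsilon>) w l =
    (if l = map \<sigma> w then cscale (prod_list (map \<epsilon> w)) (mat 1) else 0)"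
proof (induction l w rule: list_induct2)
  case (Cons y l x w)
  note zero = matrix_zero_mult
  show ?case
    using Cons by (auto simp: mword.simps signed_perm_def zero cscale_mult cscale_simps(3) cscale_left_commute cscale_0_right)
qed (simp add: mword.simps cscale_simps)

lemma common_fixed_signed_perm:
  assumes "common_fixed n k \<xi>" and "w \<in> words n k"
    and \<sigma>: "bij_betw \<sigma> {1..n} {1..n}" and \<epsilon>: "\<And>i. \<epsilon> i = 1 \<or> \<epsilon> i = -1"
  shows "\<xi> (map \<sigma> w) * prod_list (map \<epsilon> w) = \<xi> w"
proof -
  have "map \<sigma> w \<in> words n k"
    using assms(2) \<sigma> unfolding words_def bij_betw_def by auto
  have "cscale (\<xi> w) (mat 1 :: complex^2^2) = (\<Sum>l\<in>words n k. cscale (\<xi> l) (mword (signed_perm \<sigma> \<epsilon>) w l))"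
    using assms(1,2) cubic_signed_perm[OF \<sigma> \<epsilon>] unfolding common_fixed_def by simp
  also have "\<dots> = (\<Sum>l\<in>words n k. if l = map \<sigma> w then cscale (\<xi> (map \<sigma> w) * prod_list (map \<epsilon> w)) (mat 1) else 0)"
    using assms(2) by (intro sum.cong) (auto simp: words_def mword_signed_perm cscale_simps(3) cscale_0_right)
  also have "\<dots> = cscale (\<xi> (map \<sigma> w) * prod_list (map \<epsilon> w)) (mat 1)"
    using \<open>map \<sigma> w \<in> words n k\<close> finite_words by simp
  finally show ?thesis by (simp add: cscale_mat_1_eq)
qed

lemma kernel_eq_permutation:
  assumes "kernel w = kernel w'" and w: "w \<in> words n k" and w': "w' \<in> words n k"
  shows "\<exists>\<sigma>. bij_betw \<sigma> {1..n} {1..n} \<and> map \<sigma> w = w'"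
proof -
  have len: "length w = length w'" using w w' by (simp add: words_def)
  obtain g where g: "w' = map g w"
    using compat_kernel_imp_map[of w w'] compat_kernel[of w'] assms(1) by auto
  have "inj_on g (set w)"
  proof (rule inj_onI)
    fix x y assume "x \<in> set w" "y \<in> set w" "g x = g y"
    then obtain i j where "i < length w" "j < length w" "x = w ! i" "y = w ! j"
      by (auto simp: in_set_conv_nth)
    with kernel_eq_nth[OF assms(1)] g \<open>g x = g y\<close> show "x = y" by simp
  qed
  moreover have sub: "set w \<subseteq> {1..n}" "set w' \<subseteq> {1..n}" using w w' by (auto simp: words_def)
  ultimately have bij: "bij_betw g (set w) (set w')"
    by (simp add: bij_betw_def g)
  have "card ({1..n} - set w) = card ({1..n} - set w')"
    using sub bij_betw_same_card[OF bij] by (simp add: card_Diff_subset)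
  then obtain h where h: "bij_betw h ({1..n} - set w) ({1..n} - set w')"
    using finite_same_card_bij[of "{1..n} - set w" "{1..n} - set w'"] by blast
  define \<sigma> where "\<sigma> x = (if x \<in> set w then g x else h x)" for x
  have "bij_betw \<sigma> (set w) (set w')"
    using bij bij_betw_cong[of "set w" \<sigma> g] by (simp add: \<sigma>_def)
  moreover have "bij_betw \<sigma> ({1..n} - set w) ({1..n} - set w')"
    using h bij_betw_cong[of "{1..n} - set w" \<sigma> h] by (simp add: \<sigma>_def)
  ultimately have "bij_betw \<sigma> (set w \<union> ({1..n} - set w)) (set w' \<union> ({1..n} - set w'))"
    by (rule bij_betw_combine) auto
  moreover have "set w \<union> ({1..n} - set w) = {1..n}" "set w' \<union> ({1..n} - set w') = {1..n}"
    using sub by auto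
  moreover have "map \<sigma> w = w'" by (simp add: g \<sigma>_def)
  ultimately show ?thesis by auto
qed

lemma common_fixed_kernel:
  assumes "common_fixed n k \<xi>" "w \<in> words n k" "w' \<in> words n k" "kernel w = kernel w'"
  shows "\<xi> w = \<xi> w'"
proof -
  obtain \<sigma> where "bij_betw \<sigma> {1..n} {1..n}" "map \<sigma> w = w'"
    using kernel_eq_permutation[OF assms(4,2,3)] by blast
  moreover have "prod_list (map (\<lambda>_. 1 :: complex) w) = 1"
    by (induction w) auto
  ultimately show ?thesis
    using common_fixed_signed_perm[OF assms(1,2), of \<sigma> "\<lambda>_. 1"] by simp
qed

text \<open>Changing the sign of the letter \<open>x\<close> alone multiplies the value by -1 to the
  power of its number of occurrences.\<close>

lemma common_fixed_odd_letter:
  assumes "common_fixed n k \<xi>" "w \<in> words n k" "odd (count_list w x)"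
  shows "\<xi> w = 0"
proof -
  define \<epsilon> :: "nat \<Rightarrow> complex" where "\<epsilon> i = (if i = x then -1 else 1)" for i
  have "prod_list (map \<epsilon> w) = (-1) ^ count_list w x"
    by (induction w) (auto simp: \<epsilon>_def)
  then show ?thesis
    using common_fixed_signed_perm[OF assms(1,2), of "\<lambda>x. x" \<epsilon>] assms(3)
    by (auto simp: \<epsilon>_def bij_betw_def)
qed

subsection \<open>A noncommutative model\<close>

text \<open>Each index is coupled to its partner \<open>\<sigma> i\<close>: on the range of the
  projection \<open>D i\<close> it stays, on the range of \<open>F i\<close> it is exchanged with
  its partner. Different pairs may use noncommuting projections.\<close>

definition pair_matrix :: "(nat \<Rightarrow> nat) \<Rightarrow> (nat \<Rightarrow> complex^2^2) \<Rightarrow> (nat \<Rightarrow> complex^2^2) \<Rightarrow>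
    nat \<Rightarrow> nat \<Rightarrow> complex^2^2" where
  "pair_matrix \<sigma> D F i j = (if j = i then D i else if j = \<sigma> i then F i else 0)"

text \<open>At a fixed point of \<open>\<sigma>\<close> there is nothing to exchange, and
  \<open>F i\<close> must vanish: the first case of \<open>pair_matrix\<close> takes precedence
  there and would lose it.\<close>

definition pair_data :: "nat \<Rightarrow> (nat \<Rightarrow> nat) \<Rightarrow> (nat \<Rightarrow> complex^2^2) \<Rightarrow> (nat \<Rightarrow> complex^2^2) \<Rightarrow> bool" where
  "pair_data n \<sigma> D F \<longleftrightarrow> (\<forall>i\<in>{1..n}. \<sigma> i \<in> {1..n}) \<and> (\<forall>i. \<sigma> (\<sigma> i) = i \<and>
    D (\<sigma> i) = D i \<and> F (\<sigma> i) = F i \<and> hadj (D i) = D i \<and> hadj (F i) = F i \<and>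
    D i ** D i = D i \<and> F i ** F i = F i \<and> D i ** F i = 0 \<and> F i ** D i = 0 \<and>
    D i + F i = mat 1 \<and> (\<sigma> i = i \<longrightarrow> F i = 0))"

lemma cubic_pair_matrix:
  assumes "pair_data n \<sigma> D F"
  shows "cubic_matrix n (pair_matrix \<sigma> D F)"
proof -
  have \<sigma>: "\<sigma> i \<in> {1..n}" if "i \<in> {1..n}" for i
    using assms that unfolding pair_data_def by blast
  have inv: "\<sigma> (\<sigma> i) = i" and D\<sigma>: "D (\<sigma> i) = D i" and F\<sigma>: "F (\<sigma> i) = F i"
    and hadj: "hadj (D i) = D i" "hadj (F i) = F i"
    and proj: "D i ** D i = D i" "F i ** F i = F i" "D i ** F i = 0" "F i ** D i = 0"
    and one: "D i + F i = mat 1" and fixpoint: "\<sigma> i = i \<Longrightarrow> F i = 0" for i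
    using assms unfolding pair_data_def by blast+
  have hadj0: "hadj 0 = (0 :: complex^2^2)" by (simp add: hadj_def vec_eq_iff)
  note zero = matrix_zero_mult
  let ?v = "pair_matrix \<sigma> D F"
  \<comment> \<open>The matrix is symmetric, so column relations are row relations.\<close>
  have sym: "?v j i = ?v i j" for i j
  proof (cases "j = \<sigma> i")
    case True
    then show ?thesis by (simp add: pair_matrix_def inv D\<sigma> F\<sigma>)
  next
    case False
    then have "i \<noteq> \<sigma> j" using inv[of j] by auto
    with False show ?thesis by (auto simp: pair_matrix_def)
  qed
  have orth: "?v i j ** ?v i k = 0" if "j \<noteq> k" for i j k
    using that by (simp add: pair_matrix_def proj zero)
  have squares: "(\<Sum>k\<in>{1..n}. ?v i k ** ?v i k) = mat 1" if i: "i \<in> {1..n}" for i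
  proof -
    have "(\<Sum>k\<in>{1..n}. ?v i k ** ?v i k) = (\<Sum>k\<in>{1..n}. (if k = i then D i else 0) + (if k = \<sigma> i then F i else 0))"
      by (rule sum.cong[OF refl]) (auto simp: pair_matrix_def proj zero dest: fixpoint fixpoint[OF HOL.sym])
    also have "\<dots> = mat 1"
      using i \<sigma>[OF i] one[of i] by (simp add: sum.distrib)
    finally show ?thesis .
  qed
  show ?thesis
    unfolding cubic_matrix_def
  proof (intro conjI ballI impI)
    fix i assume i: "i \<in> {1..n}"
    show "(\<Sum>k\<in>{1..n}. ?v i k ** ?v i k) = mat 1" "(\<Sum>k\<in>{1..n}. ?v k i ** ?v k i) = mat 1"
      using squares[OF i] by (simp_all only: sym[of _ i])
  next
    fix i j
    show "hadj (?v i j) = ?v i j" by (simp add: pair_matrix_def hadj hadj0)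
    fix k assume "j \<noteq> k"
    then show "?v i j ** ?v i k = 0" "?v j i ** ?v k i = 0"
      using orth by (simp_all only: sym[of i j] sym[of i k]) (simp_all add: sym orth)
  qed
qed

text \<open>The letter \<open>z\<close> flagged \<open>f\<close> stands for the covector \<open>e z + e (\<sigma> z)\<close> if \<open>f\<close> is false and
  \<open>e z - e (\<sigma> z)\<close> if \<open>f\<close> is true; the model acts on it by \<open>1\<close> and \<open>D z - F z\<close>, respectively.\<close>

definition covector :: "(nat \<Rightarrow> nat) \<Rightarrow> nat \<times> bool \<Rightarrow> nat \<Rightarrow> complex" where
  "covector \<sigma> a i = (if i = fst a then 1 else if i = \<sigma> (fst a) then (if snd a then -1 else 1) else 0)"

fun covector_word :: "(nat \<Rightarrow> nat) \<Rightarrow> (nat \<times> bool) list \<Rightarrow> nat list \<Rightarrow> complex" where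
  "covector_word \<sigma> (a # ws) (i # is) = covector \<sigma> a i * covector_word \<sigma> ws is"
| "covector_word \<sigma> _ _ = 1"

definition act :: "(nat \<Rightarrow> complex^2^2) \<Rightarrow> (nat \<Rightarrow> complex^2^2) \<Rightarrow> nat \<times> bool \<Rightarrow> complex^2^2" where
  "act D F a = (if snd a then D (fst a) - F (fst a) else mat 1)"

definition act_word :: "(nat \<Rightarrow> complex^2^2) \<Rightarrow> (nat \<Rightarrow> complex^2^2) \<Rightarrow> (nat \<times> bool) list \<Rightarrow> complex^2^2" where
  "act_word D F ws = foldr (\<lambda>a M. act D F a ** M) ws (mat 1)"

text \<open>The exchange of \<open>z\<close> and \<open>\<sigma> z\<close> has eigenvalue 1 on the
  sum and -1 on the difference, so the model acts by \<open>D z\<close> plus or minus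
  \<open>F z\<close>.\<close>

lemma covector_pair_matrix:
  assumes data: "pair_data n \<sigma> D F" and z: "fst a \<in> {1..n}"
  shows "(\<Sum>i\<in>{1..n}. cscale (covector \<sigma> a i) (pair_matrix \<sigma> D F i j)) = cscale (covector \<sigma> a j) (act D F a)"
proof -
  define z where "z = fst a"
  define s :: complex where "s = (if snd a then -1 else 1)"
  have \<sigma>z: "\<sigma> z \<in> {1..n}"
    using data z unfolding pair_data_def z_def by blast
  have inv: "\<sigma> (\<sigma> z) = z" and D\<sigma>: "D (\<sigma> z) = D z" and F\<sigma>: "F (\<sigma> z) = F z"
    and one: "D z + F z = mat 1" and fixpoint: "\<sigma> z = z \<Longrightarrow> F z = 0"
    using data unfolding pair_data_def by blast+
  let ?v = "pair_matrix \<sigma> D F"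
  have act_eq: "act D F a = D z + cscale s (F z)"
    using one by (simp add: act_def z_def s_def cscale_simps(4)) (simp add: cscale_def vec_eq_iff)
  have s2: "s * s = 1" by (simp add: s_def)
  show ?thesis
  proof (cases "\<sigma> z = z")
    case True
    have "(\<Sum>i\<in>{1..n}. cscale (covector \<sigma> a i) (?v i j)) = (\<Sum>i\<in>{1..n}. if i = z then ?v z j else 0)"
      using True by (intro sum.cong) (auto simp: covector_def z_def[symmetric] cscale_simps)
    also have "\<dots> = ?v z j" using z by (simp add: z_def)
    also have "\<dots> = cscale (covector \<sigma> a j) (act D F a)"
      using True fixpoint by (auto simp: pair_matrix_def covector_def z_def[symmetric] act_eq cscale_simps cscale_0_right)
    finally show ?thesis .
  next
    case False
    have "(\<Sum>i\<in>{1..n}. cscale (covector \<sigma> a i) (?v i j)) =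
        (\<Sum>i\<in>{1..n}. (if i = z then ?v z j else 0) + (if i = \<sigma> z then cscale s (?v (\<sigma> z) j) else 0))"
      using False by (intro sum.cong) (auto simp: covector_def z_def[symmetric] s_def[symmetric] cscale_simps)
    also have "\<dots> = ?v z j + cscale s (?v (\<sigma> z) j)"
      using z \<sigma>z by (simp add: z_def[symmetric] sum.distrib)
    also have "\<dots> = cscale (covector \<sigma> a j) (act D F a)"
    proof -
      consider "j = z" | "j = \<sigma> z" | "j \<noteq> z" "j \<noteq> \<sigma> z" by blast
      then show ?thesis
      proof cases
        case 1
        with False inv have "?v z j = D z" "?v (\<sigma> z) j = F z" "covector \<sigma> a j = 1"
          by (auto simp: pair_matrix_def covector_def z_def[symmetric] F\<sigma>)
        then show ?thesis by (simp add: act_eq cscale_simps(4))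
      next
        case 2
        with False inv have "?v z j = F z" "?v (\<sigma> z) j = D z" "covector \<sigma> a j = s"
          by (auto simp: pair_matrix_def covector_def z_def[symmetric] s_def[symmetric] D\<sigma>)
        then show ?thesis
          by (simp add: act_eq cscale_simps(1,4) cscale_simps(3)[symmetric] s2 add.commute)
      next
        case 3
        with inv have "?v z j = 0" "?v (\<sigma> z) j = 0" "covector \<sigma> a j = 0"
          by (auto simp: pair_matrix_def covector_def z_def[symmetric])
        then show ?thesis by (simp add: cscale_simps(5) cscale_0_right)
      qed
    qed
    finally show ?thesis .
  qed
qed

lemma covector_word_pair_matrix:
  assumes data: "pair_data n \<sigma> D F"
  shows "fst ` set ws \<subseteq> {1..n} \<Longrightarrow> length l = length ws \<Longrightarrow>
    (\<Sum>i\<in>words n (length ws). cscale (covector_word \<sigma> ws i) (mword (pair_matrix \<sigma> D F) i l)) =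
    cscale (covector_word \<sigma> ws l) (act_word D F ws)"
proof (induction ws arbitrary: l)
  case Nil
  then show ?case by (simp add: act_word_def mword.simps)
next
  case (Cons a ws)
  then obtain j l' where l: "l = j # l'" "length l' = length ws" by (cases l) auto
  let ?v = "pair_matrix \<sigma> D F"
  let ?R = "\<Sum>is\<in>words n (length ws). cscale (covector_word \<sigma> ws is) (mword ?v is l')"
  have "(\<Sum>i\<in>words n (length (a # ws)). cscale (covector_word \<sigma> (a # ws) i) (mword ?v i l)) =
      (\<Sum>i\<in>{1..n}. cscale (covector \<sigma> a i) (?v i j) ** ?R)"
    unfolding length_Cons sum_words_Suc l(1) covector_word.simps mword.simps matrix_mult_sum
    by (simp add: cscale_mult cscale_simps(3) cscale_left_commute)
  also have "\<dots> = (\<Sum>i\<in>{1..n}. cscale (covector \<sigma> a i) (?v i j)) ** ?R"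
    by (rule matrix_sum_mult[symmetric])
  also have "\<dots> = cscale (covector_word \<sigma> (a # ws) l) (act_word D F (a # ws))"
    using Cons.IH[of l'] Cons.prems l(2) covector_pair_matrix[OF data, of a j]
    by (simp add: l(1) act_word_def cscale_mult cscale_simps(3) cscale_left_commute)
  finally show ?case .
qed

text \<open>The model is placed between the covector and \<open>\<xi>\<close>: the vector absorbs
  it, the covector turns it into -1, so the pairing equals its own negative.\<close>

lemma common_fixed_covector_word:
  assumes fixed: "common_fixed n k \<xi>" and data: "pair_data n \<sigma> D F"
    and ws: "fst ` set ws \<subseteq> {1..n}" "length ws = k"
    and act: "act_word D F ws = cscale (-1) (mat 1)"
  shows "(\<Sum>i\<in>words n k. covector_word \<sigma> ws i * \<xi> i) = 0"
proof -
  let ?v = "pair_matrix \<sigma> D F"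
  let ?S = "\<Sum>i\<in>words n k. covector_word \<sigma> ws i * \<xi> i"
  have "cscale ?S (mat 1 :: complex^2^2) = (\<Sum>i\<in>words n k. cscale (covector_word \<sigma> ws i) (cscale (\<xi> i) (mat 1)))"
    by (simp add: cscale_sum cscale_simps(3))
  also have "\<dots> = (\<Sum>i\<in>words n k. cscale (covector_word \<sigma> ws i) (\<Sum>l\<in>words n k. cscale (\<xi> l) (mword ?v i l)))"
    using fixed cubic_pair_matrix[OF data] unfolding common_fixed_def by simp
  also have "\<dots> = (\<Sum>l\<in>words n k. cscale (\<xi> l) (\<Sum>i\<in>words n k. cscale (covector_word \<sigma> ws i) (mword ?v i l)))"
    unfolding cscale_sum_right by (subst sum.swap, subst cscale_left_commute) (rule refl)
  also have "\<dots> = (\<Sum>l\<in>words n k. cscale (\<xi> l) (cscale (covector_word \<sigma> ws l) (cscale (-1) (mat 1))))"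
    using covector_word_pair_matrix[OF data ws(1)] ws(2) act by (intro sum.cong) (auto simp: words_def)
  also have "\<dots> = cscale (- ?S) (mat 1)"
  proof -
    have "cscale (\<xi> l) (cscale (covector_word \<sigma> ws l) (cscale (-1) (mat 1))) =
        (cscale (- (covector_word \<sigma> ws l * \<xi> l)) (mat 1) :: complex^2^2)" for l
      by (simp add: cscale_def vec_eq_iff)
    then show ?thesis by (simp only: cscale_sum[symmetric] sum_negf)
  qed
  finally have "?S = - ?S" by (simp only: cscale_mat_1_eq)
  then show ?thesis by simp
qed

section \<open>Crossing partitions excluded by anticommuting reflections\<close>

definition mat2 :: "complex \<Rightarrow> complex \<Rightarrow> complex \<Rightarrow> complex \<Rightarrow> complex^2^2" where
  "mat2 a b c d = vector [vector [a, b], vector [c, d]]"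

lemma mat2_simps:
  "mat2 a b c d ** mat2 a' b' c' d' = mat2 (a * a' + b * c') (a * b' + b * d') (c * a' + d * c') (c * b' + d * d')"
  "mat2 a b c d + mat2 a' b' c' d' = mat2 (a + a') (b + b') (c + c') (d + d')"
  "mat2 a b c d - mat2 a' b' c' d' = mat2 (a - a') (b - b') (c - c') (d - d')"
  "hadj (mat2 a b c d) = mat2 (cnj a) (cnj c) (cnj b) (cnj d)"
  "cscale x (mat2 a b c d) = mat2 (x * a) (x * b) (x * c) (x * d)"
  "mat2 1 0 0 1 = mat 1"
  "mat2 0 0 0 0 = 0"
  by (simp_all add: mat2_def vec_eq_iff forall_2 matrix_matrix_mult_def sum_2 hadj_def cscale_def mat_def)

lemma act_word_append: "act_word D F (v @ w) = act_word D F v ** act_word D F w"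
  by (induction v) (simp_all add: act_word_def matrix_mul_assoc)

lemma act_word_unflagged: "act_word D F (map (\<lambda>z. (z, False)) w) = mat 1"
  by (induction w) (simp_all add: act_word_def act_def)

lemma covector_word_append:
  "length v = length i \<Longrightarrow> covector_word \<sigma> (v @ w) (i @ j) = covector_word \<sigma> v i * covector_word \<sigma> w j"
  by (induction v i rule: list_induct2) simp_all

lemma covector_word_unflagged: "covector_word \<sigma> (map (\<lambda>z. (z, False)) w) i \<in> {0, 1}"
proof (induction w arbitrary: i)
  case (Cons x w)
  then show ?case
    using Cons.IH[of "tl i"] by (cases i) (auto simp: covector_def)
qed simp

lemma covector_word_self: "covector_word \<sigma> ws (map fst ws) = 1"
  by (induction ws) (simp_all add: covector_def)

text \<open>Every word in the support arises by exchanging letters with their partners, and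
  \<open>\<pi>\<close> undoes the exchange.\<close>

lemma covector_word_support:
  assumes "length i = length ws" and "covector_word \<sigma> ws i \<noteq> 0"
    and "\<And>z. z \<in> fst ` set ws \<Longrightarrow> \<pi> z = z \<and> \<pi> (\<sigma> z) = z"
  shows "map \<pi> i = map fst ws"
  using assms
proof (induction i ws rule: list_induct2)
  case (Cons x i a ws)
  then have "x = fst a \<or> x = \<sigma> (fst a)" by (auto simp: covector_def split: if_splits)
  with Cons show ?case by auto
qed simp

lemma list_split_at:
  assumes "length i = length (p @ x # r)"
  obtains p' x' r' where "i = p' @ x' # r'" "length p' = length p" "length r' = length r"
proof
  have "length p < length i" using assms by simp
  then show "i = take (length p) i @ i ! length p # drop (Suc (length p)) i"
    by (rule id_take_nth_drop)
  show "length (take (length p) i) = length p" "length (drop (Suc (length p)) i) = length r"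
    using assms by simp_all
qed

lemma weight_le:
  "self_contained c \<Longrightarrow> length c \<le> K \<Longrightarrow> weight K c \<le> K * length c"
  by (induction c) (auto simp: add_mono)

text \<open>Two noncommuting reflections exclude a crossing: if \<open>w\<close> has letters \<open>x\<close>, \<open>y\<close>, \<open>x\<close>, \<open>y\<close> in
  this order, they act on a covector flagged at these four positions by \<open>(g h)\<^sup>2 = -1\<close>.\<close>

lemma crossing_covector:
  assumes w: "w = p @ x # q @ y # r @ x # s @ y # t" "w \<in> words n k" "x \<noteq> y" and n: "k + 2 \<le> n"
  shows "\<exists>\<theta> :: nat list \<Rightarrow> complex. (\<forall>\<xi>. common_fixed n k \<xi> \<longrightarrow> (\<Sum>i\<in>words n k. \<theta> i * \<xi> i) = 0) \<and> \<theta> w = 1 \<and>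
    (\<forall>i\<in>words n k. \<theta> i \<noteq> 0 \<longrightarrow> compat (kernel i) w) \<and>
    (\<forall>i\<in>words n k. kernel i = kernel w \<longrightarrow> \<theta> i \<in> {0, 1})"
proof -
  have sw: "set w \<subseteq> {1..n}" "length w = k" using w(2) by (auto simp: words_def)
  then have xy: "x \<in> {1..n}" "y \<in> {1..n}" "x \<in> set w" "y \<in> set w" using w(1) by auto
  have "card (set w) \<le> k" using card_length[of w] sw by simp
  then have card: "2 \<le> card ({1..n} - set w)"
    using sw n by (subst card_Diff_subset) auto
  then obtain x' where x': "x' \<in> {1..n} - set w"
    by (metis card.empty not_numeral_le_zero ex_in_conv)
  with card have "1 \<le> card ({1..n} - set w - {x'})" by simp
  then obtain y' where y': "y' \<in> {1..n} - set w" "y' \<noteq> x'"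
    by (metis card.empty not_one_le_zero ex_in_conv Diff_iff singletonI)
  have distinct: "x' \<noteq> x" "x' \<noteq> y" "y' \<noteq> x" "y' \<noteq> y" "x' \<noteq> y'" "x \<noteq> y"
    using x' y' xy w(3) by auto
  define \<sigma> where "\<sigma> i = (if i = x then x' else if i = x' then x else if i = y then y' else if i = y' then y else i)" for i
  define \<pi> where "\<pi> i = (if i = x' then x else if i = y' then y else i)" for i
  \<comment> \<open>\<open>D - F\<close> is the diagonal reflection with entries 1 and -1 at
    \<open>x\<close> and the exchange of coordinates at \<open>y\<close>. The two anticommute, so
    the square of their product is -1.\<close>
  define D where "D i = (if i = x \<or> i = x' then mat2 1 0 0 0
    else if i = y \<or> i = y' then mat2 (1/2) (1/2) (1/2) (1/2) else mat 1)" for i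
  define F where "F i = (if i = x \<or> i = x' then mat2 0 0 0 1
    else if i = y \<or> i = y' then mat2 (1/2) (-1/2) (-1/2) (1/2) else 0)" for i
  have one: "hadj (mat 1) = (mat 1 :: complex^2^2)" "hadj 0 = (0 :: complex^2^2)"
    using mat2_simps(4)[of 1 0 0 1] mat2_simps(4)[of 0 0 0 0] by (simp_all add: mat2_simps(6,7))
  have data: "pair_data n \<sigma> D F"
    unfolding pair_data_def
  proof (intro conjI allI ballI impI)
    fix i
    show "\<sigma> i \<in> {1..n}" if "i \<in> {1..n}"
      using that xy x' y' by (auto simp: \<sigma>_def)
    show "\<sigma> (\<sigma> i) = i" using distinct by (simp add: \<sigma>_def)
    show "D (\<sigma> i) = D i" "F (\<sigma> i) = F i" using distinct by (simp_all add: \<sigma>_def D_def F_def)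
    show "hadj (D i) = D i" "hadj (F i) = F i" by (simp_all add: D_def F_def mat2_simps(4) one)
    show "D i ** D i = D i" "F i ** F i = F i" "D i ** F i = 0" "F i ** D i = 0" "D i + F i = mat 1"
      by (simp_all add: D_def F_def mat2_simps(1,2,6,7) matrix_zero_mult)
    show "F i = 0" if "\<sigma> i = i"
      using that distinct by (auto simp: \<sigma>_def F_def split: if_splits)
  qed
  define m where "m = map (\<lambda>z :: nat. (z, False))"
  define ws where "ws = m p @ (x, True) # m q @ (y, True) # m r @ (x, True) # m s @ (y, True) # m t"
  have fst_ws: "map fst ws = w" by (simp add: ws_def m_def w(1) comp_def)
  have set_ws: "fst ` set ws = set w" using fst_ws by (metis set_map)
  have len_ws: "length ws = k" using fst_ws sw(2) by (metis length_map)
  have flag: "act_word D F (a # v) = act D F a ** act_word D F v" for a v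
    by (simp add: act_word_def)
  have "act D F (x, True) = mat2 1 0 0 (-1)" "act D F (y, True) = mat2 0 1 1 0"
    using distinct by (simp_all add: act_def D_def F_def mat2_simps(3))
  then have "act_word D F ws = mat2 1 0 0 (-1) ** (mat2 0 1 1 0 ** (mat2 1 0 0 (-1) ** mat2 0 1 1 0))"
    by (simp add: ws_def m_def act_word_append act_word_unflagged flag)
  also have "\<dots> = cscale (-1) (mat 1)"
    by (simp add: mat2_simps(1) mat2_simps(5) flip: mat2_simps(6))
  finally have act: "act_word D F ws = cscale (-1) (mat 1)" .
  have zero: "(\<Sum>i\<in>words n k. covector_word \<sigma> ws i * \<xi> i) = 0" if "common_fixed n k \<xi>" for \<xi>
    by (rule common_fixed_covector_word[OF that data _ len_ws act]) (simp only: set_ws sw)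
  have support: "compat (kernel i) w" if "i \<in> words n k" "covector_word \<sigma> ws i \<noteq> 0" for i
  proof -
    have "\<pi> z = z \<and> \<pi> (\<sigma> z) = z" if "z \<in> fst ` set ws" for z
    proof -
      have "z \<noteq> x'" "z \<noteq> y'" using that x' y' by (auto simp: set_ws)
      then show ?thesis using distinct by (simp add: \<pi>_def \<sigma>_def)
    qed
    then have "map \<pi> i = map fst ws"
      using that by (intro covector_word_support) (auto simp: words_def len_ws)
    then show ?thesis
      using compat_map[OF compat_kernel[of i], of \<pi>] by (simp add: fst_ws)
  qed
  \<comment> \<open>If \<open>i\<close> has the kernel of \<open>w\<close>, its letters agree at
    both flagged positions of \<open>x\<close> and at both of \<open>y\<close>, so each sign occurs
    squared. Thus no cancellation is possible among the words with the kernel of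
    \<open>w\<close>.\<close>
  have vals: "covector_word \<sigma> ws i \<in> {0, 1}" if i: "i \<in> words n k" "kernel i = kernel w" for i
  proof -
    have len: "length i = length (p @ x # q @ y # r @ x # s @ y # t)"
      using i(1) sw w(1) by (simp add: words_def)
    obtain p' a i1 where i1: "i = p' @ a # i1" "length p' = length p" "length i1 = length (q @ y # r @ x # s @ y # t)"
      using list_split_at[OF len] by blast
    obtain q' b i2 where i2: "i1 = q' @ b # i2" "length q' = length q" "length i2 = length (r @ x # s @ y # t)"
      using list_split_at[OF i1(3)] by blast
    obtain r' a2 i3 where i3: "i2 = r' @ a2 # i3" "length r' = length r" "length i3 = length (s @ y # t)"
      using list_split_at[OF i2(3)] by blast
    obtain s' b2 t' where i4: "i3 = s' @ b2 # t'" "length s' = length s" "length t' = length t"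
      using list_split_at[OF i3(3)] by blast
    have i_eq: "i = p' @ a # q' @ b # r' @ a2 # s' @ b2 # t'"
      using i1 i2 i3 i4 by simp
    let ?P = "length p" and ?Q = "Suc (length p + length q)"
      and ?R = "Suc (Suc (length p + length q + length r))"
      and ?S = "Suc (Suc (Suc (length p + length q + length r + length s)))"
    have "w ! ?P = x" "w ! ?R = x" "w ! ?Q = y" "w ! ?S = y"
      by (simp_all add: w(1) nth_append)
    moreover have "i ! ?P = a" "i ! ?R = a2" "i ! ?Q = b" "i ! ?S = b2"
      using i1(2) i2(2) i3(2) i4(2) by (simp_all add: i_eq nth_append)
    moreover have "?P < length i" "?Q < length i" "?R < length i" "?S < length i"
      using i1(2) i2(2) i3(2) i4(2) by (simp_all add: i_eq)
    ultimately have ab: "a = a2" "b = b2"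
      using kernel_eq_nth[OF i(2), of ?P ?R] kernel_eq_nth[OF i(2), of ?Q ?S] by simp_all
    have "covector_word \<sigma> ws i = covector_word \<sigma> (m p) p' * covector_word \<sigma> (m q) q' * covector_word \<sigma> (m r) r' *
        covector_word \<sigma> (m s) s' * covector_word \<sigma> (m t) t' *
        (covector \<sigma> (x, True) a * covector \<sigma> (x, True) a) * (covector \<sigma> (y, True) b * covector \<sigma> (y, True) b)"
      using i1(2) i2(2) i3(2) i4(2) by (simp add: ws_def i_eq covector_word_append m_def ab)
    moreover have "covector_word \<sigma> (m v) j \<in> {0, 1}" for v j
      unfolding m_def by (rule covector_word_unflagged)
    moreover have "covector \<sigma> c j * covector \<sigma> c j \<in> {0, 1}" for c j
      by (simp add: covector_def)
    moreover have "u * v \<in> {0, 1}" if "u \<in> {0, 1}" "v \<in> {0, 1}" for u v :: complex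
      using that by auto
    ultimately show ?thesis by (simp only:)
  qed
  show ?thesis
    using zero support vals covector_word_self[of \<sigma> ws] by (intro exI[of _ "covector_word \<sigma> ws"]) (simp add: fst_ws)
qed

text \<open>Induction from fine kernels to coarse ones, that is, from large weight to small. At a
  crossing word \<open>w\<close> with even multiplicities, the covector only sees words whose kernel
  is that of \<open>w\<close> or strictly finer. The latter vanish by induction; the former share
  the value \<open>\<xi> w\<close> and enter with coefficient 0 or 1, and with 1 at \<open>w\<close>
  itself.\<close>

lemma common_fixed_vanish:
  assumes fixed: "common_fixed n k \<xi>" and n: "k + 2 \<le> n"
    and vanish: "\<And>w. w \<in> words n k \<Longrightarrow> even_code (kernel w) \<Longrightarrow> \<xi> w = 0"
    and "w \<in> words n k"
  shows "\<xi> w = 0"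
  using assms(4)
proof (induction "k * k - weight k (kernel w)" arbitrary: w rule: less_induct)
  case less
  show ?case
  proof (cases "(\<forall>x. even (count_list w x)) \<and> \<not> noncrossing w")
    case False
    then show ?thesis
      using common_fixed_odd_letter[OF fixed less.prems] noncrossing_kernel_code[of w]
        vanish[OF less.prems] by blast
  next
    case True
    then obtain p x q y r s t where "w = p @ x # q @ y # r @ x # s @ y # t" "x \<noteq> y"
      unfolding noncrossing_def by blast
    from crossing_covector[OF this(1) less.prems this(2) n]
    obtain \<theta> where zero: "(\<Sum>i\<in>words n k. \<theta> i * \<xi> i) = 0" and \<theta>w: "\<theta> w = 1"
      and support: "\<And>i. i \<in> words n k \<Longrightarrow> \<theta> i \<noteq> 0 \<Longrightarrow> compat (kernel i) w"
      and vals: "\<And>i. i \<in> words n k \<Longrightarrow> kernel i = kernel w \<Longrightarrow> \<theta> i \<in> {0, 1}"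
      using fixed by blast
    let ?G = "{i \<in> words n k. kernel i = kernel w \<and> \<theta> i = 1}"
    have len: "length w = k" using less.prems by (simp add: words_def)
    have "\<theta> i * \<xi> i = (if kernel i = kernel w \<and> \<theta> i = 1 then \<xi> w else 0)" if i: "i \<in> words n k" for i
    proof (cases "kernel i = kernel w")
      case True
      with vals[OF i True] common_fixed_kernel[OF fixed i less.prems True] show ?thesis by auto
    next
      case False
      show ?thesis
      proof (cases "\<theta> i = 0")
        case nonzero: False
        have li: "length i = k" using i by (simp add: words_def)
        have "weight k (kernel w) < weight k (kernel i)"
          using weight_kernel[OF support[OF i nonzero], of k] False len by auto
        moreover have "weight k (kernel i) \<le> k * k"
          using weight_le[OF self_contained_kernel[of i], of k] li by simp
        ultimately have "\<xi> i = 0"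
          using less.hyps[OF _ i] by simp
        with False show ?thesis by simp
      qed (use False in simp)
    qed
    then have "0 = (\<Sum>i\<in>words n k. if kernel i = kernel w \<and> \<theta> i = 1 then \<xi> w else 0)"
      using zero by (simp cong: sum.cong)
    also have "\<dots> = of_nat (card ?G) * \<xi> w"
      by (subst sum.inter_filter[symmetric]) (simp_all add: finite_words)
    finally have "of_nat (card ?G) * \<xi> w = 0" by simp
    moreover have "w \<in> ?G" "finite ?G" using less.prems \<theta>w finite_words by auto
    then have "card ?G \<noteq> 0" by auto
    ultimately show ?thesis by simp
  qed
qed


section \<open>The span of the noncrossing even partitions\<close>

text \<open>The inserted \<open>x\<close> has maximal rank, so its row has only the diagonal entry
  and fixes the unknown at \<open>x\<close>; the other equations are then solved on the smaller
  set.\<close>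

lemma triangular_solve:
  fixes Z :: "'c \<Rightarrow> 'c \<Rightarrow> complex" and m :: "'c \<Rightarrow> nat"
  assumes "finite C" and diag: "\<And>c. Z c c = 1"
    and triangular: "\<And>c d. c \<in> C \<Longrightarrow> d \<in> C \<Longrightarrow> c \<noteq> d \<Longrightarrow> Z c d \<noteq> 0 \<Longrightarrow> m c < m d"
  shows "\<exists>\<alpha>. \<forall>c\<in>C. (\<Sum>d\<in>C. Z c d * \<alpha> d) = f c"
  using assms(1,3)
proof (induction C arbitrary: f rule: finite_ranking_induct[where f = m])
  case (insert x S)
  have row: "Z x d = 0" if "d \<in> S" "d \<noteq> x" for d
    using insert.prems[of x d] insert.hyps(2)[of d] that by fastforce
  show ?case
  proof (cases "x \<in> S")
    case True
    then show ?thesis using insert.IH[of f] insert.prems by (simp add: insert_absorb)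
  next
    case False
    obtain \<alpha> where \<alpha>: "\<forall>c\<in>S. (\<Sum>d\<in>S. Z c d * \<alpha> d) = f c - Z c x * f x"
      using insert.IH[of "\<lambda>c. f c - Z c x * f x"] insert.prems by blast
    have "(\<Sum>d\<in>insert x S. Z c d * (\<alpha>(x := f x)) d) = f c" if "c \<in> insert x S" for c
    proof -
      have "(\<Sum>d\<in>insert x S. Z c d * (\<alpha>(x := f x)) d) = Z c x * f x + (\<Sum>d\<in>S. Z c d * \<alpha> d)"
        using False insert.hyps(1) by (simp, intro sum.cong) auto
      moreover have "(\<Sum>d\<in>S. Z x d * \<alpha> d) = 0"
        using row False by (intro sum.neutral) auto
      ultimately show ?thesis using that \<alpha> diag by auto
    qed
    then show ?thesis by blast
  qed
qed simp

lemma triangular_injective: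
  fixes Z :: "'c \<Rightarrow> 'c \<Rightarrow> complex" and m :: "'c \<Rightarrow> nat"
  assumes "finite C" and diag: "\<And>c. Z c c = 1"
    and triangular: "\<And>c d. c \<in> C \<Longrightarrow> d \<in> C \<Longrightarrow> c \<noteq> d \<Longrightarrow> Z c d \<noteq> 0 \<Longrightarrow> m c < m d"
    and zero: "\<And>c. c \<in> C \<Longrightarrow> (\<Sum>d\<in>C. Z c d * \<alpha> d) = 0" and "d \<in> C"
  shows "\<alpha> d = 0"
proof -
  have "\<forall>d\<in>C. \<alpha> d = 0"
    using assms(1,3) zero
  proof (induction C rule: finite_ranking_induct[where f = m])
    case (insert x S)
    show ?case
    proof (cases "x \<in> S")
      case True
      then show ?thesis using insert.IH insert.prems by (simp add: insert_absorb)
    next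
      case False
      have "Z x d = 0" if "d \<in> S" for d
        using insert.prems(1)[of x d] insert.hyps(2)[of d] that False by fastforce
      then have "(\<Sum>d\<in>insert x S. Z x d * \<alpha> d) = \<alpha> x"
        using False insert.hyps(1) by (simp add: diag)
      with insert.prems(2) have x: "\<alpha> x = 0" by simp
      have "(\<Sum>d\<in>S. Z c d * \<alpha> d) = 0" if "c \<in> S" for c
        using insert.prems(2)[of c] that False insert.hyps(1) x by simp
      then have "\<forall>d\<in>S. \<alpha> d = 0" using insert.IH insert.prems(1) by blast
      with x show ?thesis by blast
    qed
  qed simp
  with assms(5) show ?thesis by blast
qed

section \<open>Coordinates of a fixed vector from its values at canonical words\<close>

definition canonical :: "nat list \<Rightarrow> nat list" where
  "canonical c = (SOME w. kernel w = c \<and> set w \<subseteq> {1..length c})"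

lemma canonical:
  assumes "c \<in> even_codes k"
  shows "kernel (canonical c) = c" and "k \<le> n \<Longrightarrow> canonical c \<in> words n k"
proof -
  have c: "even_code c" "length c = k" using assms by (auto simp: even_codes_def)
  have "kernel (canonical c) = c \<and> set (canonical c) \<subseteq> {1..length c}"
    unfolding canonical_def by (rule someI_ex) (rule code_realisation(1)[OF c(1)])
  then show "kernel (canonical c) = c" "k \<le> n \<Longrightarrow> canonical c \<in> words n k"
    using c(2) length_kernel[of "canonical c"] by (auto simp: words_def)
qed

text \<open>A word of kernel \<open>c\<close> that respects \<open>d\<close> shows that
  \<open>c\<close> is coarser than \<open>d\<close>. Hence evaluation of partitions at canonical
  words gives a triangular matrix.\<close>

lemma canonical_triangular:
  assumes "c \<in> even_codes k" "d \<in> even_codes k" "c \<noteq> d" "compat d (canonical c)"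
  shows "weight k c < weight k d"
proof -
  have "length (canonical c) = k"
    using assms(1) canonical(1)[OF assms(1)] length_kernel[of "canonical c"] by (auto simp: even_codes_def)
  then show ?thesis
    using weight_kernel[OF assms(4), of k] canonical(1)[OF assms(1)] assms(3) by auto
qed

text \<open>\<open>K\<close> inverts the matrix of evaluations of partitions at canonical words. It
  does not depend on \<open>n\<close>, since canonical words use letters up to
  \<open>k\<close>.\<close>

definition dual_basis :: "nat \<Rightarrow> (nat list \<Rightarrow> nat list \<Rightarrow> complex) \<Rightarrow> bool" where
  "dual_basis k K \<longleftrightarrow> (\<forall>d\<in>even_codes k. \<forall>c\<in>even_codes k.
    (\<Sum>e\<in>even_codes k. of_bool (compat e (canonical c)) * K e d) = of_bool (c = d))"

lemma canonical_compat:
  assumes "c \<in> even_codes k"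
  shows "(if e = c then 1 else of_bool (compat e (canonical c))) = (of_bool (compat e (canonical c)) :: complex)"
  using compat_kernel[of "canonical c"] canonical(1)[OF assms] by auto

lemma dual_basis_exists: "\<exists>K. dual_basis k K"
proof -
  \<comment> \<open>The diagonal is written as 1 outright, because \<open>triangular_solve\<close>
    asks for it at every list and not only at codes.\<close>
  define Z :: "nat list \<Rightarrow> nat list \<Rightarrow> complex"
    where "Z c e = (if e = c then 1 else of_bool (compat e (canonical c)))" for c e
  have "\<exists>\<alpha>. \<forall>c\<in>even_codes k. (\<Sum>e\<in>even_codes k. Z c e * \<alpha> e) = of_bool (c = d)" for d
  proof (rule triangular_solve[where m = "weight k"])
    show "weight k c < weight k e" if "c \<in> even_codes k" "e \<in> even_codes k" "c \<noteq> e" "Z c e \<noteq> 0" for c e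
      using that by (intro canonical_triangular) (auto simp: Z_def)
  qed (simp_all add: Z_def finite_codes)
  then obtain \<alpha> where \<alpha>: "\<And>d. \<forall>c\<in>even_codes k. (\<Sum>e\<in>even_codes k. Z c e * \<alpha> d e) = of_bool (c = d)"
    by metis
  have "(\<Sum>e\<in>even_codes k. of_bool (compat e (canonical c)) * \<alpha> d e) = of_bool (c = d)"
    if "c \<in> even_codes k" for c d
    using bspec[OF \<alpha>[of d] that] by (simp only: Z_def canonical_compat[OF that])
  then have "dual_basis k (\<lambda>e d. \<alpha> d e)" by (simp only: dual_basis_def) blast
  then show ?thesis by blast
qed

lemma codes_independent:
  assumes zero: "\<And>w. w \<in> words n k \<Longrightarrow> (\<Sum>d\<in>even_codes k. \<alpha> d * of_bool (compat d w)) = (0 :: complex)"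
    and "k \<le> n" and "d \<in> even_codes k"
  shows "\<alpha> d = 0"
proof -
  define Z :: "nat list \<Rightarrow> nat list \<Rightarrow> complex"
    where "Z c e = (if e = c then 1 else of_bool (compat e (canonical c)))" for c e
  show ?thesis
  proof (rule triangular_injective[where m = "weight k" and Z = Z])
    show "weight k c < weight k e" if "c \<in> even_codes k" "e \<in> even_codes k" "c \<noteq> e" "Z c e \<noteq> 0" for c e
      using that by (intro canonical_triangular) (auto simp: Z_def)
    show "(\<Sum>e\<in>even_codes k. Z c e * \<alpha> e) = 0" if "c \<in> even_codes k" for c
      using zero[OF canonical(2)[OF that assms(2)]] by (simp only: Z_def canonical_compat[OF that] mult.commute)
  qed (rule finite_codes | simp add: Z_def | rule assms(3))+
qed

text \<open>The combination of partitions with the values of \<open>\<xi>\<close> at canonical words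
  is subtracted. The difference is fixed as well and depends on kernels only, so it vanishes at all
  words with even noncrossing kernel, hence everywhere by
  \<open>common_fixed_vanish\<close>.\<close>

theorem common_fixed_span:
  assumes fixed: "common_fixed n k \<xi>" and n: "k + 2 \<le> n" and K: "dual_basis k K" and w: "w \<in> words n k"
  shows "\<xi> w = (\<Sum>c\<in>even_codes k. (\<Sum>d\<in>even_codes k. K c d * \<xi> (canonical d)) * of_bool (compat c w))"
proof -
  define \<alpha> where "\<alpha> c = (\<Sum>d\<in>even_codes k. K c d * \<xi> (canonical d))" for c
  define \<eta> where "\<eta> l = \<xi> l - (\<Sum>c\<in>even_codes k. \<alpha> c * of_bool (compat c l))" for l
  have \<eta>: "common_fixed n k \<eta>"
    unfolding \<eta>_def
    by (rule common_fixed_diff_sum[OF fixed]) (auto simp: even_codes_def intro: code_common_fixed)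
  have "\<eta> w = 0"
  proof (rule common_fixed_vanish[OF \<eta> n _ w])
    fix v assume v: "v \<in> words n k" "even_code (kernel v)"
    define c where "c = kernel v"
    have c: "c \<in> even_codes k" using v by (simp add: c_def even_codes_def words_def)
    have can: "canonical c \<in> words n k" using canonical(2)[OF c] n by simp
    have "(\<Sum>e\<in>even_codes k. \<alpha> e * of_bool (compat e (canonical c))) =
        (\<Sum>d\<in>even_codes k. \<xi> (canonical d) * (\<Sum>e\<in>even_codes k. of_bool (compat e (canonical c)) * K e d))"
      unfolding \<alpha>_def sum_distrib_left sum_distrib_right
      by (subst sum.swap) (simp add: mult_ac)
    also have "\<dots> = (\<Sum>d\<in>even_codes k. \<xi> (canonical d) * of_bool (c = d))"
      using K c unfolding dual_basis_def by simp
    also have "\<dots> = \<xi> (canonical c)"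
      using c finite_codes(1)[of k] by (simp add: of_bool_def if_distrib[of "\<lambda>x. _ * x"] cong: if_cong)
    finally have "\<eta> (canonical c) = 0" by (simp add: \<eta>_def)
    then show "\<eta> v = 0"
      using common_fixed_kernel[OF \<eta> v(1) can] canonical(1)[OF c] by (simp add: c_def)
  qed
  then show ?thesis by (simp add: \<eta>_def \<alpha>_def)
qed


section \<open>Counting words that respect two partitions\<close>

definition joint_words :: "nat \<Rightarrow> nat \<Rightarrow> nat list \<Rightarrow> nat list \<Rightarrow> nat list set" where
  "joint_words n k c d = {w \<in> words n k. compat c w \<and> compat d w}"

lemma finite_joint_words: "finite (joint_words n k c d)"
  using finite_words by (simp add: joint_words_def)

lemma compat_words_image:
  assumes "length v = k"
  shows "{w \<in> words n k. compat (kernel v) w} = (\<lambda>g. map g v) ` (set v \<rightarrow>\<^sub>E {1..n})"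
proof (intro equalityI subsetI)
  fix w assume "w \<in> {w \<in> words n k. compat (kernel v) w}"
  then have w: "w \<in> words n k" "compat (kernel v) w" by auto
  then obtain g where g: "w = map g v" using compat_kernel_imp_map by blast
  then have "w = map (restrict g (set v)) v" "restrict g (set v) \<in> set v \<rightarrow>\<^sub>E {1..n}"
    using w(1) by (auto simp: words_def)
  then show "w \<in> (\<lambda>g. map g v) ` (set v \<rightarrow>\<^sub>E {1..n})" by blast
next
  fix w assume "w \<in> (\<lambda>g. map g v) ` (set v \<rightarrow>\<^sub>E {1..n})"
  then obtain g where "w = map g v" "g \<in> set v \<rightarrow>\<^sub>E {1..n}" by blast
  then show "w \<in> {w \<in> words n k. compat (kernel v) w}"
    using assms compat_map[OF compat_kernel] by (auto simp: words_def PiE_def)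
qed

lemma card_compat_words:
  assumes "c \<in> even_codes k"
  shows "card {w \<in> words n k. compat c w} = n ^ blocks c"
proof -
  let ?v = "canonical c"
  have v: "kernel ?v = c" "length ?v = k"
    using canonical(1)[OF assms] length_kernel[of ?v] assms by (auto simp: even_codes_def)
  have "inj_on (\<lambda>g. map g ?v) (set ?v \<rightarrow>\<^sub>E {1..n})"
    by (rule inj_onI) (auto intro: PiE_ext)
  then have "card {w \<in> words n k. compat c w} = card (set ?v \<rightarrow>\<^sub>E {1..n})"
    using compat_words_image[OF v(2), of n] v(1) by (simp add: card_image)
  also have "\<dots> = n ^ card (set ?v)" by (simp add: card_PiE)
  finally show ?thesis using zeros_kernel[of ?v] by (simp add: v(1) blocks_def)
qed

lemma card_joint_words_le:
  assumes "c \<in> even_codes k"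
  shows "card (joint_words n k c d) \<le> n ^ blocks c"
proof -
  have "card (joint_words n k c d) \<le> card {w \<in> words n k. compat c w}"
    by (rule card_mono) (simp_all add: finite_words joint_words_def Collect_mono_iff)
  then show ?thesis by (simp only: card_compat_words[OF assms])
qed

text \<open>Words respecting \<open>c\<close> are maps on the letters of \<open>canonical c\<close>.
  Respecting \<open>d\<close> as well forces two different letters \<open>a\<close> and
  \<open>b\<close> to the same value, so the map is determined by its restriction to the letters
  other than \<open>a\<close>.\<close>

lemma card_joint_words_less:
  assumes c: "c \<in> even_codes k" and d: "d \<in> even_codes k" and fails: "\<not> compat d (canonical c)"
  shows "n * card (joint_words n k c d) \<le> n ^ blocks c"
proof -
  let ?v = "canonical c"
  have v: "kernel ?v = c" by (rule canonical(1)[OF c])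
  have len: "length ?v = k" "length d = k"
    using c d length_kernel[of ?v] by (simp_all add: v even_codes_def)
  have sc: "self_contained d" using d by (simp add: even_codes_def self_contained_code)
  have len': "length ?v = length d" by (simp only: len)
  obtain i j where *: "i < j \<and> j < length ?v \<and> ?v ! i \<noteq> ?v ! j \<and>
      (\<forall>u :: nat list. compat d u \<longrightarrow> u ! i = u ! j)"
    using compat_fails[where 'b = nat, OF len' sc fails] by (elim exE) (rule that)
  from * have ij: "i < j" "j < length ?v" "?v ! i \<noteq> ?v ! j" by simp_all
  from * have forced: "u ! i = u ! j" if "compat d u" for u :: "nat list"
    using that by (elim conjE allE[of _ u]) simp
  define a b where "a = ?v ! i" and "b = ?v ! j"
  have ab: "a \<in> set ?v" "b \<in> set ?v" "a \<noteq> b"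
    using ij by (simp_all add: a_def b_def)
  let ?G = "{g \<in> set ?v \<rightarrow>\<^sub>E {1..n}. g a = g b}"
  have "joint_words n k c d \<subseteq> (\<lambda>g. map g ?v) ` ?G"
  proof
    fix w assume w: "w \<in> joint_words n k c d"
    then have "w \<in> {w \<in> words n k. compat (kernel ?v) w}" and "compat d w"
      by (simp_all add: joint_words_def v)
    then have "w \<in> (\<lambda>g. map g ?v) ` (set ?v \<rightarrow>\<^sub>E {1..n})"
      by (simp only: compat_words_image[OF len(1)])
    then obtain g where g: "w = map g ?v" "g \<in> set ?v \<rightarrow>\<^sub>E {1..n}"
      by (rule imageE)
    have "w ! i = w ! j" by (rule forced) fact
    then have "g a = g b" using g(1) ij(1,2) by (simp add: a_def b_def)
    with g(2) have "g \<in> ?G" by simp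
    then show "w \<in> (\<lambda>g. map g ?v) ` ?G" unfolding g(1) by (rule imageI)
  qed
  note sub = this
  have fin: "finite ?G"
  proof (rule finite_subset)
    show "?G \<subseteq> set ?v \<rightarrow>\<^sub>E {1..n}" by (rule Collect_subset)
    show "finite (set ?v \<rightarrow>\<^sub>E {1..n})" by (rule finite_PiE) simp_all
  qed
  have "card (joint_words n k c d) \<le> card ((\<lambda>g. map g ?v) ` ?G)"
    by (rule card_mono[OF finite_imageI[OF fin] sub])
  also have "\<dots> \<le> card ?G" by (rule card_image_le[OF fin])
  finally have "card (joint_words n k c d) \<le> card ?G" .
  also have "card ?G \<le> card (set ?v - {a} \<rightarrow>\<^sub>E {1..n})"
  proof (rule card_inj_on_le)
    show "inj_on (\<lambda>g. restrict g (set ?v - {a})) ?G"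
    proof (rule inj_onI)
      fix g h assume g: "g \<in> ?G" and h: "h \<in> ?G"
        and eq: "restrict g (set ?v - {a}) = restrict h (set ?v - {a})"
      have off: "g x = h x" if "x \<in> set ?v - {a}" for x
        using fun_cong[OF eq, of x] that by simp
      have "g x = h x" if "x \<in> set ?v" for x
      proof (cases "x = a")
        case True
        have "g a = g b" "h a = h b" using g h by simp_all
        with True off[of b] ab show ?thesis by simp
      next
        case False
        with that off[of x] show ?thesis by simp
      qed
      moreover have "g \<in> set ?v \<rightarrow>\<^sub>E {1..n}" "h \<in> set ?v \<rightarrow>\<^sub>E {1..n}" using g h by simp_all
      ultimately show "g = h" by (intro PiE_ext[of g "set ?v" "\<lambda>_. {1..n}" h])
    qed
    show "(\<lambda>g. restrict g (set ?v - {a})) ` ?G \<subseteq> set ?v - {a} \<rightarrow>\<^sub>E {1..n}"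
    proof (intro image_subsetI)
      fix g assume "g \<in> ?G"
      then have "g \<in> set ?v \<rightarrow>\<^sub>E {1..n}" by simp
      then have "\<forall>x\<in>set ?v. g x \<in> {1..n}" unfolding PiE_iff by (rule conjunct1)
      then show "restrict g (set ?v - {a}) \<in> set ?v - {a} \<rightarrow>\<^sub>E {1..n}"
        unfolding restrict_PiE_iff by simp
    qed
    show "finite (set ?v - {a} \<rightarrow>\<^sub>E {1..n})" by (rule finite_PiE) simp_all
  qed
  also have "\<dots> = n ^ (card (set ?v) - 1)" using ab by (simp add: card_PiE)
  finally have "n * card (joint_words n k c d) \<le> n * n ^ (card (set ?v) - 1)" by simp
  also have "\<dots> = n ^ card (set ?v)"
  proof -
    have "0 < card (set ?v)" using ab(1) by (auto simp: card_gt_0_iff)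
    then show ?thesis by (cases "card (set ?v)") simp_all
  qed
  finally show ?thesis using zeros_kernel[of ?v] by (simp add: v blocks_def)
qed

text \<open>Two different partitions cannot refine each other both ways, so one of the bounds
  \<open>n ^ blocks c\<close> and \<open>n ^ blocks d\<close> gains a factor \<open>n\<close>. The
  square root of this inequality makes the normalised Gram matrix nearly diagonal.\<close>

lemma card_joint_words_distinct:
  assumes c: "c \<in> even_codes k" and d: "d \<in> even_codes k" and "c \<noteq> d"
  shows "n * (card (joint_words n k c d))\<^sup>2 \<le> n ^ blocks c * n ^ blocks d"
proof -
  have comm: "joint_words n k c d = joint_words n k d c" by (auto simp: joint_words_def)
  have "\<not> compat d (canonical c) \<or> \<not> compat c (canonical d)"
    using canonical_triangular[OF c d assms(3)] canonical_triangular[OF d c assms(3)[symmetric]]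
    by (meson less_asym)
  then show ?thesis
  proof
    assume "\<not> compat d (canonical c)"
    from mult_mono[OF card_joint_words_less[OF c d this, of n] card_joint_words_le[OF d, of n c]] show ?thesis
      by (simp add: comm power2_eq_square mult.assoc)
  next
    assume "\<not> compat c (canonical d)"
    from mult_mono[OF card_joint_words_less[OF d c this, of n] card_joint_words_le[OF c, of n d]] show ?thesis
      by (simp add: comm power2_eq_square mult_ac)
  qed
qed

section \<open>Coefficients of the Haar functional\<close>

lemma cubic_matrix_transpose: "cubic_matrix n v \<Longrightarrow> cubic_matrix n (\<lambda>i j. v j i)"
  unfolding cubic_matrix_def by blast

lemma mword_transpose: "length l = length w \<Longrightarrow> mword (\<lambda>i j. v j i) l w = mword v w l"
  by (induction l w rule: list_induct2) simp_all

locale haar_cubic =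
  fixes n :: nat and A :: "'a cstar" and u :: "nat \<Rightarrow> nat \<Rightarrow> 'a" and T :: "'c cstar"
    and \<tau> :: "'a \<Rightarrow> 'a \<Rightarrow> 'c" and \<Delta> :: "'a \<Rightarrow> 'c" and h :: "'a \<Rightarrow> complex"
  assumes universal: "is_A_h n A u"
    and tensor: "cstar_tensor_product A A T \<tau>"
    and comult: "is_comult n A u T \<tau> \<Delta>"
    and haar: "is_haar A T \<tau> \<Delta> h"
begin

sublocale cubic_algebra A n u
  using universal unfolding is_A_h_def cubic_algebra_def cubic_algebra_axioms_def by blast

sublocale M: Module.module complex_field A
  by (rule complex_module)

lemma smult_closed: "x \<in> carrier A \<Longrightarrow> c \<odot>\<^bsub>A\<^esub> x \<in> carrier A"
  using M.smult_closed[of c x] by (simp add: complex_field_def)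

lemma haar_state:
  "additive_on A h" "x \<in> carrier A \<Longrightarrow> h (c \<odot>\<^bsub>A\<^esub> x) = c * h x"
  "x \<in> carrier A \<Longrightarrow> h (adj A x \<otimes>\<^bsub>A\<^esub> x) \<in> \<real>\<^sub>\<ge>\<^sub>0" "h \<one>\<^bsub>A\<^esub> = 1"
  using haar unfolding is_haar_def state_def additive_on_def by blast+

lemma haar_add: "x \<in> carrier A \<Longrightarrow> y \<in> carrier A \<Longrightarrow> h (x \<oplus>\<^bsub>A\<^esub> y) = h x + h y"
  using haar_state(1) unfolding additive_on_def by blast

lemma nonzero: "\<one>\<^bsub>A\<^esub> \<noteq> \<zero>\<^bsub>A\<^esub>"
  using additive_on_zero[OF haar_state(1)] haar_state(4) by auto

lemma representation:
  assumes "cubic_matrix n v"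
  shows "\<exists>g. additive_on A g \<and> (\<forall>x\<in>carrier A. \<forall>c. g (c \<odot>\<^bsub>A\<^esub> x) = cscale c (g x)) \<and>
    g \<one>\<^bsub>A\<^esub> = mat 1 \<and> (\<forall>w\<in>words n k. \<forall>l\<in>words n k. g (uword A u w l) = mword v w l)"
proof -
  obtain g where
    mult: "\<And>x y. x \<in> carrier A \<Longrightarrow> y \<in> carrier A \<Longrightarrow> g (x \<oplus>\<^bsub>A\<^esub> y) = g x + g y \<and> g (x \<otimes>\<^bsub>A\<^esub> y) = g x ** g y"
    and one: "g \<one>\<^bsub>A\<^esub> = mat 1" and scale: "\<And>x c. x \<in> carrier A \<Longrightarrow> g (c \<odot>\<^bsub>A\<^esub> x) = cscale c (g x)"
    and gu: "\<And>i j. i \<in> {1..n} \<Longrightarrow> j \<in> {1..n} \<Longrightarrow> g (u i j) = v i j"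
    using matrix_representation[OF universal nonzero assms] by blast
  have "g (uword A u w l) = mword v w l" if "w \<in> words n k" "l \<in> words n k" for w l
    using that
  proof (induction k arbitrary: w l)
    case (Suc k)
    then obtain x w' y l' where *: "w = x # w'" "l = y # l'" "w' \<in> words n k" "l' \<in> words n k"
      "x \<in> {1..n}" "y \<in> {1..n}"
      by (cases w; cases l; auto simp: words_def)
    then have "u x y \<in> carrier A" "uword A u w' l' \<in> carrier A"
      by (auto intro: u_closed uword_closed)
    then show ?case
      using Suc.IH[OF *(3,4)] mult gu[OF *(5,6)] by (simp only: *(1,2) uword.simps mword.simps)
  qed (simp add: one)
  note words = this
  show ?thesis
  proof (intro exI conjI ballI allI)
    show "additive_on A g"
      using mult by (simp add: additive_on_def)
  qed (rule scale one words; assumption)+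
qed

lemma tensor_algebra: "cstar_algebra T"
  using tensor unfolding cstar_tensor_product_def by blast

sublocale T: cstar_algebra T
  by (rule tensor_algebra)

lemma tensor_closed: "a \<in> carrier A \<Longrightarrow> b \<in> carrier A \<Longrightarrow> \<tau> a b \<in> carrier T"
  using tensor unfolding cstar_tensor_product_def cstar_generates_def by blast

lemma tensor_mult:
  "a \<in> carrier A \<Longrightarrow> a' \<in> carrier A \<Longrightarrow> b \<in> carrier A \<Longrightarrow> b' \<in> carrier A \<Longrightarrow>
    \<tau> a b \<otimes>\<^bsub>T\<^esub> \<tau> a' b' = \<tau> (a \<otimes>\<^bsub>A\<^esub> a') (b \<otimes>\<^bsub>A\<^esub> b')"
  using tensor[unfolded cstar_tensor_product_def, THEN conjunct2, THEN conjunct2, THEN conjunct2, THEN conjunct2, THEN conjunct1] by simp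

lemma tensor_one: "\<tau> \<one>\<^bsub>A\<^esub> \<one>\<^bsub>A\<^esub> = \<one>\<^bsub>T\<^esub>"
  by (rule tensor[unfolded cstar_tensor_product_def, THEN conjunct2, THEN conjunct2, THEN conjunct2, THEN conjunct2, THEN conjunct2, THEN conjunct2, THEN conjunct1])

lemma comult_hom: "\<Delta> \<in> ring_hom A T"
  using comult unfolding is_comult_def star_hom_def by blast

lemma comult_entry: "i \<in> {1..n} \<Longrightarrow> j \<in> {1..n} \<Longrightarrow> \<Delta> (u i j) = (\<Oplus>\<^bsub>T\<^esub>k\<in>{1..n}. \<tau> (u i k) (u k j))"
  using comult unfolding is_comult_def by blast

text \<open>On the tensor power of \<open>u\<close>, comultiplication is again matrix
  multiplication. The factor \<open>t\<close> collects the letters to the left that the induction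
  has already split off.\<close>

lemma comult_word:
  fixes G :: "'c \<Rightarrow> 'b::ab_group_add"
  assumes "additive_on T G" and "w \<in> words n k" and "w' \<in> words n k" and "t \<in> carrier T"
  shows "G (t \<otimes>\<^bsub>T\<^esub> \<Delta> (uword A u w w')) = (\<Sum>l\<in>words n k. G (t \<otimes>\<^bsub>T\<^esub> \<tau> (uword A u w l) (uword A u l w')))"
  using assms(2-4)
proof (induction k arbitrary: w w' t)
  case 0
  then show ?case by (simp add: ring_hom_one[OF comult_hom] tensor_one)
next
  case (Suc k)
  then obtain x v y v' where *: "w = x # v" "w' = y # v'" "v \<in> words n k" "v' \<in> words n k"
    "x \<in> {1..n}" "y \<in> {1..n}"
    by (cases w; cases w'; auto simp: words_def)
  have uxy: "u x y \<in> carrier A" using * by (simp only: u_closed)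
  have U: "uword A u v v' \<in> carrier A" using * uword_closed by blast
  have \<Delta>_closed: "\<Delta> (u x y) \<in> carrier T" "\<Delta> (uword A u v v') \<in> carrier T"
    using ring_hom_closed[OF comult_hom] uxy U by auto
  have t: "t \<in> carrier T" by fact
  have "G (t \<otimes>\<^bsub>T\<^esub> \<Delta> (uword A u w w')) = G ((t \<otimes>\<^bsub>T\<^esub> \<Delta> (u x y)) \<otimes>\<^bsub>T\<^esub> \<Delta> (uword A u v v'))"
    by (simp only: *(1,2) uword.simps ring_hom_mult[OF comult_hom uxy U] T.m_assoc[OF t \<Delta>_closed])
  also have "\<dots> = (\<Sum>l\<in>words n k. G ((t \<otimes>\<^bsub>T\<^esub> \<Delta> (u x y)) \<otimes>\<^bsub>T\<^esub> \<tau> (uword A u v l) (uword A u l v')))"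
    by (rule Suc.IH[OF *(3,4)]) (intro T.m_closed t \<Delta>_closed)
  also have "\<dots> = (\<Sum>l\<in>words n k. \<Sum>z\<in>{1..n}. G (t \<otimes>\<^bsub>T\<^esub> \<tau> (uword A u w (z # l)) (uword A u (z # l) w')))"
  proof (rule sum.cong[OF refl])
    fix l assume l: "l \<in> words n k"
    have closed: "uword A u v l \<in> carrier A" "uword A u l v' \<in> carrier A"
      using * l uword_closed by blast+
    let ?r = "\<tau> (uword A u v l) (uword A u l v')"
    have r: "?r \<in> carrier T" using closed by (rule tensor_closed)
    have entry: "\<tau> (u x z) (u z y) \<in> carrier T" if "z \<in> {1..n}" for z
      using that * by (intro tensor_closed u_closed)
    have "G ((t \<otimes>\<^bsub>T\<^esub> \<Delta> (u x y)) \<otimes>\<^bsub>T\<^esub> ?r) = (\<lambda>s. G ((t \<otimes>\<^bsub>T\<^esub> s) \<otimes>\<^bsub>T\<^esub> ?r)) (\<Oplus>\<^bsub>T\<^esub>z\<in>{1..n}. \<tau> (u x z) (u z y))"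
      using * by (simp only: comult_entry)
    also have "\<dots> = (\<Sum>z\<in>{1..n}. G ((t \<otimes>\<^bsub>T\<^esub> \<tau> (u x z) (u z y)) \<otimes>\<^bsub>T\<^esub> ?r))"
    proof (rule T.additive_on_finsum)
      show "additive_on T (\<lambda>s. G ((t \<otimes>\<^bsub>T\<^esub> s) \<otimes>\<^bsub>T\<^esub> ?r))"
        using T.additive_on_mult_left[OF T.additive_on_mult_right[OF assms(1) r] t] .
    qed (use entry in auto)
    also have "\<dots> = (\<Sum>z\<in>{1..n}. G (t \<otimes>\<^bsub>T\<^esub> \<tau> (uword A u w (z # l)) (uword A u (z # l) w')))"
    proof (rule sum.cong[OF refl])
      fix z assume z: "z \<in> {1..n}"
      have "(t \<otimes>\<^bsub>T\<^esub> \<tau> (u x z) (u z y)) \<otimes>\<^bsub>T\<^esub> ?r = t \<otimes>\<^bsub>T\<^esub> (\<tau> (u x z) (u z y) \<otimes>\<^bsub>T\<^esub> ?r)"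
        by (rule T.m_assoc[OF t entry[OF z] r])
      also have "\<tau> (u x z) (u z y) \<otimes>\<^bsub>T\<^esub> ?r = \<tau> (uword A u w (z # l)) (uword A u (z # l) w')"
        using z * closed by (simp only: *(1,2) uword.simps tensor_mult u_closed)
      finally show "G ((t \<otimes>\<^bsub>T\<^esub> \<tau> (u x z) (u z y)) \<otimes>\<^bsub>T\<^esub> ?r) =
          G (t \<otimes>\<^bsub>T\<^esub> \<tau> (uword A u w (z # l)) (uword A u (z # l) w'))"
        by (rule arg_cong)
    qed
    finally show "G ((t \<otimes>\<^bsub>T\<^esub> \<Delta> (u x y)) \<otimes>\<^bsub>T\<^esub> ?r) =
        (\<Sum>z\<in>{1..n}. G (t \<otimes>\<^bsub>T\<^esub> \<tau> (uword A u w (z # l)) (uword A u (z # l) w')))" .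
  qed
  also have "\<dots> = (\<Sum>l\<in>words n (Suc k). G (t \<otimes>\<^bsub>T\<^esub> \<tau> (uword A u w l) (uword A u l w')))"
    unfolding sum_words_Suc by (rule sum.swap)
  finally show ?case .
qed

section \<open>Invariance of the matrix of Haar coefficients\<close>

definition coeff :: "nat list \<Rightarrow> nat list \<Rightarrow> complex" where
  "coeff w l = h (uword A u w l)"

lemma slice_coeff:
  fixes g :: "'a \<Rightarrow> 'b::ab_group_add"
  assumes S: "bounded_linear_map T A S" and g: "additive_on A g"
    and inv: "\<And>a. a \<in> carrier A \<Longrightarrow> S (\<Delta> a) = h a \<odot>\<^bsub>A\<^esub> \<one>\<^bsub>A\<^esub>"
    and w: "w \<in> words n k" "w' \<in> words n k"
  shows "g (coeff w w' \<odot>\<^bsub>A\<^esub> \<one>\<^bsub>A\<^esub>) = (\<Sum>l\<in>words n k. g (S (\<tau> (uword A u w l) (uword A u l w'))))"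
proof -
  have S_closed: "S x \<in> carrier A" if "x \<in> carrier T" for x
    using S that unfolding bounded_linear_map_def by blast
  have "additive_on T (\<lambda>x. g (S x))"
    unfolding additive_on_def
  proof (intro ballI)
    fix x y assume x: "x \<in> carrier T" and y: "y \<in> carrier T"
    have "S (x \<oplus>\<^bsub>T\<^esub> y) = S x \<oplus>\<^bsub>A\<^esub> S y"
      using S x y unfolding bounded_linear_map_def by blast
    then show "g (S (x \<oplus>\<^bsub>T\<^esub> y)) = g (S x) + g (S y)"
      using g S_closed[OF x] S_closed[OF y] unfolding additive_on_def by simp
  qed
  from comult_word[OF this w T.one_closed]
  have "g (S (\<one>\<^bsub>T\<^esub> \<otimes>\<^bsub>T\<^esub> \<Delta> (uword A u w w'))) =
      (\<Sum>l\<in>words n k. g (S (\<one>\<^bsub>T\<^esub> \<otimes>\<^bsub>T\<^esub> \<tau> (uword A u w l) (uword A u l w'))))" .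
  moreover have "uword A u w w' \<in> carrier A" using uword_closed w by blast
  moreover have "\<tau> (uword A u w l) (uword A u l w') \<in> carrier T" if "l \<in> words n k" for l
    using that w by (intro tensor_closed uword_closed)
  ultimately show ?thesis
    using ring_hom_closed[OF comult_hom] inv by (simp add: coeff_def)
qed

text \<open>Slicing with \<open>R\<close> gives \<open>u P = P\<close> for the matrix
  \<open>P\<close> of coefficients and the tensor power \<open>u\<close>; the representation of
  \<open>A\<close> carries this to the model.\<close>

lemma coeff_column_fixed:
  assumes w': "w' \<in> words n k"
  shows "common_fixed n k (\<lambda>l. coeff l w')"
  unfolding common_fixed_def
proof (intro allI impI ballI)
  fix v w assume v: "cubic_matrix n v" and w: "w \<in> words n k"
  obtain g where "additive_on A g \<and> (\<forall>x\<in>carrier A. \<forall>c. g (c \<odot>\<^bsub>A\<^esub> x) = cscale c (g x)) \<and>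
      g \<one>\<^bsub>A\<^esub> = mat 1 \<and> (\<forall>w\<in>words n k. \<forall>l\<in>words n k. g (uword A u w l) = mword v w l)"
    using representation[OF v] by blast
  then have G: "additive_on A g" "\<And>x c. x \<in> carrier A \<Longrightarrow> g (c \<odot>\<^bsub>A\<^esub> x) = cscale c (g x)" "g \<one>\<^bsub>A\<^esub> = mat 1"
    "\<And>w l. w \<in> words n k \<Longrightarrow> l \<in> words n k \<Longrightarrow> g (uword A u w l) = mword v w l"
    by simp_all
  obtain R where R: "bounded_linear_map T A R" "\<And>a. a \<in> carrier A \<Longrightarrow> R (\<Delta> a) = h a \<odot>\<^bsub>A\<^esub> \<one>\<^bsub>A\<^esub>"
    and slice: "\<And>a b. a \<in> carrier A \<Longrightarrow> b \<in> carrier A \<Longrightarrow> R (\<tau> a b) = h b \<odot>\<^bsub>A\<^esub> a"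
    using haar[unfolded is_haar_def, THEN conjunct2, THEN conjunct2] by blast
  have "(\<Sum>l\<in>words n k. cscale (coeff l w') (mword v w l)) = (\<Sum>l\<in>words n k. g (R (\<tau> (uword A u w l) (uword A u l w'))))"
    using w w' by (intro sum.cong refl) (simp add: slice uword_closed[of _ k] G(2,4) coeff_def)
  also have "\<dots> = g (coeff w w' \<odot>\<^bsub>A\<^esub> \<one>\<^bsub>A\<^esub>)"
    by (rule slice_coeff[OF R(1) G(1) R(2) w w', symmetric])
  also have "\<dots> = cscale (coeff w w') (mat 1)"
    by (simp add: G(2,3))
  finally show "(\<Sum>l\<in>words n k. cscale (coeff l w') (mword v w l)) = cscale (coeff w w') (mat 1)" .
qed

text \<open>Slicing with \<open>L\<close> gives \<open>P u = P\<close>, that is, invariance of the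
  rows under the transpose of \<open>u\<close>. The transposed model is therefore used, which is
  cubic again.\<close>

lemma coeff_row_fixed:
  assumes w: "w \<in> words n k"
  shows "common_fixed n k (\<lambda>l. coeff w l)"
  unfolding common_fixed_def
proof (intro allI impI ballI)
  fix v w' assume v: "cubic_matrix n v" and w': "w' \<in> words n k"
  obtain g where "additive_on A g \<and> (\<forall>x\<in>carrier A. \<forall>c. g (c \<odot>\<^bsub>A\<^esub> x) = cscale c (g x)) \<and>
      g \<one>\<^bsub>A\<^esub> = mat 1 \<and> (\<forall>w\<in>words n k. \<forall>l\<in>words n k. g (uword A u w l) = mword (\<lambda>i j. v j i) w l)"
    using representation[OF cubic_matrix_transpose[OF v], of k] by (elim exE) (rule that)
  then have G: "additive_on A g" "\<And>x c. x \<in> carrier A \<Longrightarrow> g (c \<odot>\<^bsub>A\<^esub> x) = cscale c (g x)" "g \<one>\<^bsub>A\<^esub> = mat 1"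
    "\<And>w l. w \<in> words n k \<Longrightarrow> l \<in> words n k \<Longrightarrow> g (uword A u w l) = mword (\<lambda>i j. v j i) w l"
    by simp_all
  obtain L where L: "bounded_linear_map T A L" "\<And>a. a \<in> carrier A \<Longrightarrow> L (\<Delta> a) = h a \<odot>\<^bsub>A\<^esub> \<one>\<^bsub>A\<^esub>"
    and slice: "\<And>a b. a \<in> carrier A \<Longrightarrow> b \<in> carrier A \<Longrightarrow> L (\<tau> a b) = h a \<odot>\<^bsub>A\<^esub> b"
    using haar[unfolded is_haar_def, THEN conjunct2, THEN conjunct1] by blast
  have transpose: "mword (\<lambda>i j. v j i) l w' = mword v w' l" if "l \<in> words n k" for l
    using that w' by (intro mword_transpose) (simp add: words_def)
  have "(\<Sum>l\<in>words n k. cscale (coeff w l) (mword v w' l)) = (\<Sum>l\<in>words n k. g (L (\<tau> (uword A u w l) (uword A u l w'))))"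
  proof (rule sum.cong[OF refl])
    fix l assume l: "l \<in> words n k"
    show "cscale (coeff w l) (mword v w' l) = g (L (\<tau> (uword A u w l) (uword A u l w')))"
      using uword_closed[OF w l] uword_closed[OF l w']
      by (simp only: slice G(2) G(4)[OF l w'] transpose[OF l] coeff_def)
  qed
  also have "\<dots> = g (coeff w w' \<odot>\<^bsub>A\<^esub> \<one>\<^bsub>A\<^esub>)"
    by (rule slice_coeff[OF L(1) G(1) L(2) w w', symmetric])
  also have "\<dots> = cscale (coeff w w') (mat 1)"
    by (simp add: G(2,3))
  finally show "(\<Sum>l\<in>words n k. cscale (coeff w l) (mword v w' l)) = cscale (coeff w w') (mat 1)" .
qed

lemma coeff_fixes_code:
  assumes "d \<in> even_codes k" and "w \<in> words n k"
  shows "(\<Sum>l\<in>words n k. coeff w l * of_bool (compat d l)) = of_bool (compat d w)"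
proof -
  have "(\<Sum>l\<in>words n k. coeff w l * of_bool (compat d l)) =
      (\<Sum>l\<in>words n k. if compat d l then h (uword A u w l) else 0)"
    by (rule sum.cong) (simp_all add: coeff_def)
  then show ?thesis
    using even_code_fixed[OF _ haar_state(1), of d w] assms haar_state(4) by (simp add: even_codes_def)
qed

text \<open>Since rows and columns of the matrix of coefficients lie in the span of the noncrossing even
  partitions and the matrix fixes this span, it is given by the inverse \<open>W\<close> of the Gram matrix.\<close>

theorem weingarten:
  assumes k: "k + 2 \<le> n"
  shows "\<exists>W.
    (\<forall>w\<in>words n k. \<forall>w'\<in>words n k. coeff w w' =
      (\<Sum>c\<in>even_codes k. \<Sum>e\<in>even_codes k. W c e * of_bool (compat c w) * of_bool (compat e w'))) \<and>
    (\<forall>c\<in>even_codes k. \<forall>d\<in>even_codes k.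
      (\<Sum>e\<in>even_codes k. W c e * of_nat (card (joint_words n k e d))) = of_bool (c = d))"
proof -
  let ?E = "even_codes k"
  obtain K where K: "dual_basis k K" using dual_basis_exists by blast
  define W where "W c e = (\<Sum>d\<in>?E. \<Sum>f\<in>?E. K c d * K e f * coeff (canonical d) (canonical f))" for c e
  have can: "canonical d \<in> words n k" if "d \<in> ?E" for d
    using canonical(2)[OF that] k by simp
  have expand: "coeff w w' = (\<Sum>c\<in>?E. \<Sum>e\<in>?E. W c e * of_bool (compat c w) * of_bool (compat e w'))"
    if w: "w \<in> words n k" "w' \<in> words n k" for w w'
  proof -
    have "coeff w w' = (\<Sum>c\<in>?E. (\<Sum>d\<in>?E. K c d * coeff (canonical d) w') * of_bool (compat c w))"
      by (rule common_fixed_span[OF coeff_column_fixed[OF w(2)] k K w(1)])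
    also have "\<dots> = (\<Sum>c\<in>?E. (\<Sum>d\<in>?E. K c d *
        (\<Sum>e\<in>?E. (\<Sum>f\<in>?E. K e f * coeff (canonical d) (canonical f)) * of_bool (compat e w'))) * of_bool (compat c w))"
    proof -
      have "coeff (canonical d) w' =
          (\<Sum>e\<in>?E. (\<Sum>f\<in>?E. K e f * coeff (canonical d) (canonical f)) * of_bool (compat e w'))"
        if "d \<in> ?E" for d
        by (rule common_fixed_span[OF coeff_row_fixed[OF can[OF that]] k K w(2)])
      then show ?thesis by (simp only: cong: sum.cong)
    qed
    also have "\<dots> = (\<Sum>c\<in>?E. \<Sum>e\<in>?E. W c e * of_bool (compat c w) * of_bool (compat e w'))"
    proof (rule sum.cong[OF refl])
      fix c
      have "(\<Sum>d\<in>?E. K c d * (\<Sum>e\<in>?E. (\<Sum>f\<in>?E. K e f * coeff (canonical d) (canonical f)) * of_bool (compat e w'))) =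
          (\<Sum>d\<in>?E. \<Sum>e\<in>?E. (\<Sum>f\<in>?E. K c d * K e f * coeff (canonical d) (canonical f)) * of_bool (compat e w'))"
        by (simp add: sum_distrib_left sum_distrib_right mult.assoc)
      also have "\<dots> = (\<Sum>e\<in>?E. W c e * of_bool (compat e w'))"
        unfolding W_def by (subst sum.swap) (simp only: sum_distrib_right)
      finally show "(\<Sum>d\<in>?E. K c d *
          (\<Sum>e\<in>?E. (\<Sum>f\<in>?E. K e f * coeff (canonical d) (canonical f)) * of_bool (compat e w'))) * of_bool (compat c w) =
          (\<Sum>e\<in>?E. W c e * of_bool (compat c w) * of_bool (compat e w'))"
        by (simp add: sum_distrib_right mult_ac)
    qed
    finally show ?thesis .
  qed
  have gram: "(\<Sum>l\<in>words n k. of_bool (compat e l) * of_bool (compat d l)) = (of_nat (card (joint_words n k e d)) :: complex)" for e d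
  proof -
    have "(\<Sum>l\<in>words n k. of_bool (compat e l) * of_bool (compat d l)) =
        (\<Sum>l\<in>words n k. if compat e l \<and> compat d l then 1 else (0 :: complex))"
      by (rule sum.cong) auto
    also have "\<dots> = (\<Sum>l\<in>joint_words n k e d. 1)"
      unfolding joint_words_def by (rule sum.inter_filter[OF finite_words, symmetric])
    finally show ?thesis by simp
  qed
  have inverse: "(\<Sum>e\<in>?E. W c e * of_nat (card (joint_words n k e d))) = of_bool (c = d)"
    if c: "c \<in> ?E" and d: "d \<in> ?E" for c d
  proof -
    \<comment> \<open>The matrix of coefficients fixes the vector of \<open>d\<close>. Expanding
      this in the vectors of partitions, independence turns an identity of vectors into one of
      coordinates.\<close>
    define \<alpha> where "\<alpha> c = (\<Sum>e\<in>?E. W c e * of_nat (card (joint_words n k e d))) - of_bool (c = d)" for c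
    have "(\<Sum>c\<in>?E. \<alpha> c * of_bool (compat c w)) = 0" if w: "w \<in> words n k" for w
    proof -
      have "of_bool (compat d w) = (\<Sum>l\<in>words n k. coeff w l * of_bool (compat d l))"
        by (rule coeff_fixes_code[OF d w, symmetric])
      also have "\<dots> = (\<Sum>l\<in>words n k. \<Sum>c\<in>?E. \<Sum>e\<in>?E.
          W c e * of_bool (compat c w) * (of_bool (compat e l) * of_bool (compat d l)))"
        by (intro sum.cong refl) (simp add: expand[OF w] sum_distrib_right mult.assoc)
      also have "\<dots> = (\<Sum>c\<in>?E. \<Sum>e\<in>?E. \<Sum>l\<in>words n k.
          W c e * of_bool (compat c w) * (of_bool (compat e l) * of_bool (compat d l)))"
        by (subst sum.swap) (rule sum.cong[OF refl], rule sum.swap)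
      also have "\<dots> = (\<Sum>c\<in>?E. (\<Sum>e\<in>?E. W c e * of_nat (card (joint_words n k e d))) * of_bool (compat c w))"
        by (simp only: sum_distrib_left[symmetric] gram) (simp add: sum_distrib_left mult_ac)
      finally have "(\<Sum>c\<in>?E. (\<Sum>e\<in>?E. W c e * of_nat (card (joint_words n k e d))) * of_bool (compat c w)) =
          of_bool (compat d w)" by simp
      moreover have "(\<Sum>c\<in>?E. of_bool (c = d) * of_bool (compat c w)) = (of_bool (compat d w) :: complex)"
        using d finite_codes(1)[of k] by (simp add: of_bool_def if_distrib[of "\<lambda>x. x * _"] cong: if_cong)
      ultimately show ?thesis
        by (simp only: \<alpha>_def left_diff_distrib sum_subtractf) simp
    qed
    moreover have "k \<le> n" using k by simp
    ultimately have "\<alpha> c = 0"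
      by (rule codes_independent[OF _ _ c])
    then show ?thesis by (simp add: \<alpha>_def)
  qed
  show ?thesis by (intro exI[of _ W] conjI ballI expand inverse)
qed

end

section \<open>The law of a partial trace\<close>

primrec poly_element :: "('a, 'm) cstar_scheme \<Rightarrow> 'a \<Rightarrow> (nat \<Rightarrow> real) \<Rightarrow> nat \<Rightarrow> 'a" where
  "poly_element A a c 0 = complex_of_real (c 0) \<odot>\<^bsub>A\<^esub> (a [^]\<^bsub>A\<^esub> (0 :: nat))"
| "poly_element A a c (Suc N) =
    poly_element A a c N \<oplus>\<^bsub>A\<^esub> complex_of_real (c (Suc N)) \<odot>\<^bsub>A\<^esub> (a [^]\<^bsub>A\<^esub> Suc N)"

context haar_cubic
begin

section \<open>Positivity of the Haar functional and its seminorm\<close>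

lemma adj_zero: "adj A \<zero>\<^bsub>A\<^esub> = \<zero>\<^bsub>A\<^esub>"
proof -
  have "adj A \<zero>\<^bsub>A\<^esub> \<oplus>\<^bsub>A\<^esub> adj A \<zero>\<^bsub>A\<^esub> = adj A \<zero>\<^bsub>A\<^esub>"
    using adj_add[of "\<zero>\<^bsub>A\<^esub>" "\<zero>\<^bsub>A\<^esub>"] by simp
  then show ?thesis
    using add.l_cancel_one[of "adj A \<zero>\<^bsub>A\<^esub>" "adj A \<zero>\<^bsub>A\<^esub>"] adj_closed[of "\<zero>\<^bsub>A\<^esub>"] by simp
qed

lemma adj_one: "adj A \<one>\<^bsub>A\<^esub> = \<one>\<^bsub>A\<^esub>"
  using adj_mult[of "adj A \<one>\<^bsub>A\<^esub>" "\<one>\<^bsub>A\<^esub>"] adj_adj[of "\<one>\<^bsub>A\<^esub>"] adj_closed[of "\<one>\<^bsub>A\<^esub>"] by simp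

lemma adj_power:
  assumes "a \<in> carrier A" "adj A a = a"
  shows "adj A (a [^]\<^bsub>A\<^esub> (k :: nat)) = a [^]\<^bsub>A\<^esub> k"
proof (induction k)
  case (Suc k)
  have "adj A (a [^]\<^bsub>A\<^esub> Suc k) = a \<otimes>\<^bsub>A\<^esub> a [^]\<^bsub>A\<^esub> k"
    using Suc assms by (simp add: adj_mult)
  then show ?case using nat_pow_Suc2[OF assms(1), of k] by simp
qed (simp add: adj_one)

text \<open>The square of the GNS seminorm of the state. The row relations bound multiplication by
  entries of \<open>u\<close> with respect to it, and this yields bounds for moments.\<close>

definition sqnorm :: "'a \<Rightarrow> real" where
  "sqnorm x = Re (h (adj A x \<otimes>\<^bsub>A\<^esub> x))"

lemma haar_square:
  assumes "x \<in> carrier A"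
  shows "h (adj A x \<otimes>\<^bsub>A\<^esub> x) = complex_of_real (sqnorm x)" and "0 \<le> sqnorm x"
  using haar_state(3)[OF assms] by (auto simp: sqnorm_def complex_nonneg_Reals_iff complex_eq_iff)

lemma haar_square_expand:
  assumes x: "x \<in> carrier A" and y: "y \<in> carrier A"
  shows "h (adj A (x \<oplus>\<^bsub>A\<^esub> complex_of_real r \<odot>\<^bsub>A\<^esub> y) \<otimes>\<^bsub>A\<^esub> (x \<oplus>\<^bsub>A\<^esub> complex_of_real r \<odot>\<^bsub>A\<^esub> y)) =
    h (adj A x \<otimes>\<^bsub>A\<^esub> x) + r * (h (adj A x \<otimes>\<^bsub>A\<^esub> y) + h (adj A y \<otimes>\<^bsub>A\<^esub> x)) + r\<^sup>2 * h (adj A y \<otimes>\<^bsub>A\<^esub> y)"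
proof -
  let ?c = "complex_of_real r"
  have closed: "adj A x \<in> carrier A" "adj A y \<in> carrier A" "?c \<odot>\<^bsub>A\<^esub> y \<in> carrier A" "?c \<odot>\<^bsub>A\<^esub> adj A y \<in> carrier A"
    using x y by (auto intro: adj_closed smult_closed)
  have "adj A (x \<oplus>\<^bsub>A\<^esub> ?c \<odot>\<^bsub>A\<^esub> y) = adj A x \<oplus>\<^bsub>A\<^esub> ?c \<odot>\<^bsub>A\<^esub> adj A y"
    using x y closed by (simp add: adj_add adj_smult)
  moreover have "(adj A x \<oplus>\<^bsub>A\<^esub> ?c \<odot>\<^bsub>A\<^esub> adj A y) \<otimes>\<^bsub>A\<^esub> (x \<oplus>\<^bsub>A\<^esub> ?c \<odot>\<^bsub>A\<^esub> y) =
      (adj A x \<otimes>\<^bsub>A\<^esub> x \<oplus>\<^bsub>A\<^esub> ?c \<odot>\<^bsub>A\<^esub> (adj A y \<otimes>\<^bsub>A\<^esub> x)) \<oplus>\<^bsub>A\<^esub>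
      ?c \<odot>\<^bsub>A\<^esub> (adj A x \<otimes>\<^bsub>A\<^esub> y \<oplus>\<^bsub>A\<^esub> ?c \<odot>\<^bsub>A\<^esub> (adj A y \<otimes>\<^bsub>A\<^esub> y))"
    using x y closed by (simp only: l_distr r_distr a_closed m_closed smult_mult_left smult_mult_right)
  ultimately show ?thesis
    using x y closed
    by (simp only: haar_add haar_state(2) a_closed m_closed smult_closed)
      (simp add: algebra_simps power2_eq_square)
qed

text \<open>The parallelogram law with the nonnegative term of the difference dropped.\<close>

lemma sqnorm_add:
  assumes x: "x \<in> carrier A" and y: "y \<in> carrier A"
  shows "sqnorm (x \<oplus>\<^bsub>A\<^esub> y) \<le> 2 * sqnorm x + 2 * sqnorm y"
proof -
  have one: "complex_of_real 1 \<odot>\<^bsub>A\<^esub> y = y"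
    using M.smult_one[OF y] by (simp add: complex_field_def)
  have closed: "x \<oplus>\<^bsub>A\<^esub> complex_of_real (- 1) \<odot>\<^bsub>A\<^esub> y \<in> carrier A"
    using x y by (intro a_closed smult_closed)
  have "sqnorm (x \<oplus>\<^bsub>A\<^esub> y) + sqnorm (x \<oplus>\<^bsub>A\<^esub> complex_of_real (- 1) \<odot>\<^bsub>A\<^esub> y) = 2 * sqnorm x + 2 * sqnorm y"
    using arg_cong[OF haar_square_expand[OF x y, of 1], of Re] arg_cong[OF haar_square_expand[OF x y, of "- 1"], of Re]
    unfolding one sqnorm_def by simp
  with haar_square(2)[OF closed] show ?thesis by linarith
qed

lemma haar_selfadjoint_square:
  assumes "x \<in> carrier A" "adj A x = x"
  shows "Im (h (x \<otimes>\<^bsub>A\<^esub> x)) = 0" "0 \<le> Re (h (x \<otimes>\<^bsub>A\<^esub> x))"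
  using arg_cong[OF haar_square(1)[OF assms(1)], of Im] haar_square(2)[OF assms(1)] assms(2)
  by (simp_all add: sqnorm_def)

text \<open>Positivity of the state on the squares of \<open>1 + x\<close> and
  \<open>1 - x\<close>.\<close>

lemma haar_selfadjoint_real:
  assumes x: "x \<in> carrier A" "adj A x = x"
  shows "Im (h x) = 0" and "\<bar>Re (h x)\<bar> \<le> (1 + sqnorm x) / 2"
proof -
  have expand: "h (adj A (\<one>\<^bsub>A\<^esub> \<oplus>\<^bsub>A\<^esub> complex_of_real r \<odot>\<^bsub>A\<^esub> x) \<otimes>\<^bsub>A\<^esub> (\<one>\<^bsub>A\<^esub> \<oplus>\<^bsub>A\<^esub> complex_of_real r \<odot>\<^bsub>A\<^esub> x)) =
      1 + 2 * complex_of_real r * h x + r\<^sup>2 * complex_of_real (sqnorm x)" for r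
    using haar_square_expand[OF one_closed x(1), of r] x haar_square(1)[OF x(1)] by (simp add: adj_one haar_state(4))
  have closed: "\<one>\<^bsub>A\<^esub> \<oplus>\<^bsub>A\<^esub> complex_of_real r \<odot>\<^bsub>A\<^esub> x \<in> carrier A" for r
    using x by (intro a_closed smult_closed one_closed)
  note sq = haar_square[OF closed, unfolded expand]
  show "Im (h x) = 0"
    using arg_cong[OF sq(1)[of 1], of Im] by simp
  have "Re (1 + 2 * complex_of_real r * h x + r\<^sup>2 * complex_of_real (sqnorm x)) \<ge> 0" for r
    using arg_cong[OF sq(1)[of r], of Re] haar_square(2)[OF closed[of r]] by simp
  from this[of 1] this[of "- 1"] show "\<bar>Re (h x)\<bar> \<le> (1 + sqnorm x) / 2"
    by (simp add: abs_le_iff field_simps)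
qed

lemma poly_element_closed: "a \<in> carrier A \<Longrightarrow> poly_element A a c N \<in> carrier A"
  by (induction N) (simp_all add: smult_closed del: nat_pow_Suc)

lemma poly_element_adj:
  assumes a: "a \<in> carrier A" "adj A a = a"
  shows "adj A (poly_element A a c N) = poly_element A a c N"
proof (induction N)
  case 0
  show ?case
    by (simp only: poly_element.simps adj_smult[OF nat_pow_closed[OF a(1)]] adj_power[OF a] complex_cnj_complex_of_real)
next
  case (Suc N)
  show ?case
    by (simp only: poly_element.simps adj_smult[OF nat_pow_closed[OF a(1)]] adj_power[OF a] complex_cnj_complex_of_real
        adj_add[OF poly_element_closed[OF a(1)] smult_closed[OF nat_pow_closed[OF a(1)]]] Suc)
qed

lemma poly_element_linear:
  assumes a: "a \<in> carrier A" and \<phi>: "additive_on A \<phi>"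
    and scale: "\<And>x r. x \<in> carrier A \<Longrightarrow> \<phi> (r \<odot>\<^bsub>A\<^esub> x) = r * \<phi> x"
  shows "\<phi> (poly_element A a c N) = (\<Sum>i\<le>N. complex_of_real (c i) * \<phi> (a [^]\<^bsub>A\<^esub> i))"
proof (induction N)
  case (Suc N)
  have "\<phi> (poly_element A a c (Suc N)) =
      \<phi> (poly_element A a c N) + \<phi> (complex_of_real (c (Suc N)) \<odot>\<^bsub>A\<^esub> (a [^]\<^bsub>A\<^esub> Suc N))"
    using \<phi> poly_element_closed[OF a] smult_closed[OF nat_pow_closed[OF a]]
    unfolding additive_on_def poly_element.simps by blast
  then show ?case
    by (simp only: Suc scale[OF nat_pow_closed[OF a]] sum.atMost_Suc)
qed (use scale[OF nat_pow_closed[OF a, of 0]] in simp)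

lemma haar_hankel:
  fixes c :: "nat \<Rightarrow> real"
  assumes a: "a \<in> carrier A" "adj A a = a"
  shows "0 \<le> (\<Sum>i\<le>N. \<Sum>j\<le>N. c i * c j * Re (h (a [^]\<^bsub>A\<^esub> (i + j))))"
proof -
  let ?X = "poly_element A a c N"
  have X: "?X \<in> carrier A" by (rule poly_element_closed[OF a(1)])
  have pow: "a [^]\<^bsub>A\<^esub> i \<in> carrier A" for i :: nat using a by simp
  have "h (?X \<otimes>\<^bsub>A\<^esub> ?X) = (\<Sum>i\<le>N. complex_of_real (c i) * h (a [^]\<^bsub>A\<^esub> i \<otimes>\<^bsub>A\<^esub> ?X))"
    by (rule poly_element_linear[where \<phi> = "\<lambda>z. h (z \<otimes>\<^bsub>A\<^esub> ?X)", OF a(1) additive_on_mult_right[OF haar_state(1) X]])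
      (simp add: smult_mult_left X haar_state(2))
  also have "\<dots> = (\<Sum>i\<le>N. complex_of_real (c i) * (\<Sum>j\<le>N. complex_of_real (c j) * h (a [^]\<^bsub>A\<^esub> i \<otimes>\<^bsub>A\<^esub> a [^]\<^bsub>A\<^esub> j)))"
  proof (rule sum.cong[OF refl])
    fix i :: nat
    have "h (a [^]\<^bsub>A\<^esub> i \<otimes>\<^bsub>A\<^esub> ?X) = (\<Sum>j\<le>N. complex_of_real (c j) * h (a [^]\<^bsub>A\<^esub> i \<otimes>\<^bsub>A\<^esub> a [^]\<^bsub>A\<^esub> j))"
      by (rule poly_element_linear[where \<phi> = "\<lambda>z. h (a [^]\<^bsub>A\<^esub> i \<otimes>\<^bsub>A\<^esub> z)", OF a(1) additive_on_mult_left[OF haar_state(1) pow]])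
        (simp add: smult_mult_right pow haar_state(2))
    then show "complex_of_real (c i) * h (a [^]\<^bsub>A\<^esub> i \<otimes>\<^bsub>A\<^esub> ?X) =
        complex_of_real (c i) * (\<Sum>j\<le>N. complex_of_real (c j) * h (a [^]\<^bsub>A\<^esub> i \<otimes>\<^bsub>A\<^esub> a [^]\<^bsub>A\<^esub> j))"
      by simp
  qed
  also have "\<dots> = (\<Sum>i\<le>N. \<Sum>j\<le>N. complex_of_real (c i * c j) * h (a [^]\<^bsub>A\<^esub> (i + j)))"
    using a by (simp add: sum_distrib_left nat_pow_mult mult.assoc)
  finally have "Re (h (?X \<otimes>\<^bsub>A\<^esub> ?X)) = (\<Sum>i\<le>N. \<Sum>j\<le>N. c i * c j * Re (h (a [^]\<^bsub>A\<^esub> (i + j))))"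
    by simp
  with haar_selfadjoint_square(2)[OF X poly_element_adj[OF a]] show ?thesis by simp
qed

subsection \<open>Partial traces\<close>

lemma partial_trace_closed: "s \<le> n \<Longrightarrow> partial_trace A u s \<in> carrier A"
  unfolding partial_trace_def by (rule finsum_closed) (auto intro: u_closed)

lemma partial_trace_Suc:
  assumes "Suc s \<le> n"
  shows "partial_trace A u (Suc s) = u (Suc s) (Suc s) \<oplus>\<^bsub>A\<^esub> partial_trace A u s"
proof -
  have "{1..Suc s} = insert (Suc s) {1..s}" by auto
  then show ?thesis
    unfolding partial_trace_def using assms
    by (simp only:) (rule finsum_insert; auto intro: u_closed)
qed

lemma partial_trace_adj: "s \<le> n \<Longrightarrow> adj A (partial_trace A u s) = partial_trace A u s"
proof (induction s)
  case 0
  then show ?case by (simp add: partial_trace_def adj_zero)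
next
  case (Suc s)
  then have "u (Suc s) (Suc s) \<in> carrier A" "partial_trace A u s \<in> carrier A"
    "adj A (u (Suc s) (Suc s)) = u (Suc s) (Suc s)"
    by (auto intro: u_closed partial_trace_closed u_adj)
  with Suc show ?case by (simp add: partial_trace_Suc adj_add)
qed

text \<open>Summed over all \<open>u i k\<close> in the row, the left-hand side becomes exactly
  \<open>sqnorm b\<close>, because the squares of a row add up to 1.\<close>

lemma sqnorm_entry:
  assumes b: "b \<in> carrier A" and i: "i \<in> {1..n}" "j \<in> {1..n}"
  shows "sqnorm (u i j \<otimes>\<^bsub>A\<^esub> b) \<le> sqnorm b"
proof -
  have b': "adj A b \<in> carrier A" by (rule adj_closed[OF b])
  have eq: "h (adj A (u i k \<otimes>\<^bsub>A\<^esub> b) \<otimes>\<^bsub>A\<^esub> (u i k \<otimes>\<^bsub>A\<^esub> b)) = h (adj A b \<otimes>\<^bsub>A\<^esub> (u i k \<otimes>\<^bsub>A\<^esub> u i k \<otimes>\<^bsub>A\<^esub> b))"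
    if "k \<in> {1..n}" for k
  proof -
    have "u i k \<in> carrier A" "adj A (u i k) = u i k" using that i by (auto intro: u_closed u_adj)
    then show ?thesis using b b' by (simp add: adj_mult m_assoc)
  qed
  have "(\<Sum>k\<in>{1..n}. h (adj A b \<otimes>\<^bsub>A\<^esub> (u i k \<otimes>\<^bsub>A\<^esub> u i k \<otimes>\<^bsub>A\<^esub> b))) = h (adj A b \<otimes>\<^bsub>A\<^esub> (\<one>\<^bsub>A\<^esub> \<otimes>\<^bsub>A\<^esub> b))"
    by (rule additive_row_squares(1)[OF additive_on_mult_right[OF additive_on_mult_left[OF haar_state(1) b'] b] i(1)])
  then have "(\<Sum>k\<in>{1..n}. sqnorm (u i k \<otimes>\<^bsub>A\<^esub> b)) = sqnorm b"
    using b eq unfolding sqnorm_def Re_sum[symmetric] by simp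
  moreover have "sqnorm (u i j \<otimes>\<^bsub>A\<^esub> b) \<le> (\<Sum>k\<in>{1..n}. sqnorm (u i k \<otimes>\<^bsub>A\<^esub> b))"
    by (rule member_le_sum[OF i(2)]) (use i b in \<open>auto intro!: haar_square(2) m_closed u_closed\<close>)
  ultimately show ?thesis by simp
qed

text \<open>The constants solve \<open>c (Suc s) = 2 + 2 * c s\<close> with \<open>c 0 = 0\<close>.
  They are crude, but for fixed \<open>n\<close> any exponential bound on the moments will
  do.\<close>

lemma sqnorm_partial_trace:
  assumes b: "b \<in> carrier A"
  shows "s \<le> n \<Longrightarrow> sqnorm (partial_trace A u s \<otimes>\<^bsub>A\<^esub> b) \<le> (2 ^ Suc s - 2) * sqnorm b"
proof (induction s)
  case 0
  have "partial_trace A u 0 = \<zero>\<^bsub>A\<^esub>" by (simp add: partial_trace_def)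
  then have "sqnorm (partial_trace A u 0 \<otimes>\<^bsub>A\<^esub> b) = 0"
    using b additive_on_zero[OF haar_state(1)] by (simp add: sqnorm_def adj_zero)
  then show ?case by simp
next
  case (Suc s)
  have i: "Suc s \<in> {1..n}" using Suc.prems by simp
  have closed: "u (Suc s) (Suc s) \<in> carrier A" "partial_trace A u s \<in> carrier A"
    using i Suc.prems by (auto intro: u_closed partial_trace_closed)
  have "sqnorm (partial_trace A u (Suc s) \<otimes>\<^bsub>A\<^esub> b) =
      sqnorm (u (Suc s) (Suc s) \<otimes>\<^bsub>A\<^esub> b \<oplus>\<^bsub>A\<^esub> partial_trace A u s \<otimes>\<^bsub>A\<^esub> b)"
    using Suc.prems closed b by (simp add: partial_trace_Suc l_distr)
  also have "\<dots> \<le> 2 * sqnorm (u (Suc s) (Suc s) \<otimes>\<^bsub>A\<^esub> b) + 2 * sqnorm (partial_trace A u s \<otimes>\<^bsub>A\<^esub> b)"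
    using closed b by (intro sqnorm_add m_closed)
  also have "\<dots> \<le> 2 * sqnorm b + 2 * ((2 ^ Suc s - 2) * sqnorm b)"
    using Suc sqnorm_entry[OF b i i] by simp
  finally show ?case by (simp add: algebra_simps)
qed

lemma partial_trace_moment_bound:
  assumes s: "s \<le> n"
  shows "\<bar>Re (h (partial_trace A u s [^]\<^bsub>A\<^esub> (k :: nat)))\<bar> \<le> 1 * (2 ^ Suc s) ^ k"
proof -
  let ?a = "partial_trace A u s"
  let ?C = "2 ^ Suc s :: real"
  have a: "?a \<in> carrier A" "adj A ?a = ?a" using s partial_trace_closed partial_trace_adj by auto
  have pow: "?a [^]\<^bsub>A\<^esub> i \<in> carrier A" for i :: nat using a by simp
  have "sqnorm (?a [^]\<^bsub>A\<^esub> k) \<le> ?C ^ k" for k :: nat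
  proof (induction k)
    case 0
    then show ?case using haar_state(4) by (simp add: sqnorm_def adj_one)
  next
    case (Suc k)
    have "sqnorm (?a [^]\<^bsub>A\<^esub> Suc k) = sqnorm (?a \<otimes>\<^bsub>A\<^esub> ?a [^]\<^bsub>A\<^esub> k)"
      using nat_pow_Suc2[OF a(1), of k] by simp
    also have "\<dots> \<le> (?C - 2) * sqnorm (?a [^]\<^bsub>A\<^esub> k)"
      by (rule sqnorm_partial_trace[OF pow s])
    also have "\<dots> \<le> ?C * sqnorm (?a [^]\<^bsub>A\<^esub> k)"
      using haar_square(2)[OF pow] by (intro mult_right_mono) auto
    also have "\<dots> \<le> ?C * ?C ^ k"
      using Suc by (intro mult_left_mono) auto
    finally show ?case by simp
  qed
  then have "\<bar>Re (h (?a [^]\<^bsub>A\<^esub> k))\<bar> \<le> (1 + ?C ^ k) / 2"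
    using haar_selfadjoint_real(2)[OF pow adj_power[OF a], of k] by (smt (verit) divide_right_mono)
  also have "\<dots> \<le> ?C ^ k"
    using one_le_power[of ?C k] one_le_power[of "2 :: real" "Suc s"] by simp
  finally show ?thesis by simp
qed

text \<open>\<open>law\<close> is a definite description: existence is the moment problem for the
  positive functional \<open>h\<close>, and uniqueness follows from the exponential bound.\<close>

theorem law_partial_trace:
  assumes s: "s \<le> n"
  shows "is_law A h (partial_trace A u s) (law A h (partial_trace A u s))"
proof -
  let ?a = "partial_trace A u s"
  have a: "?a \<in> carrier A" "adj A ?a = ?a" using s partial_trace_closed partial_trace_adj by auto
  have real: "h (?a [^]\<^bsub>A\<^esub> k) = complex_of_real (Re (h (?a [^]\<^bsub>A\<^esub> k)))" for k :: nat
    using haar_selfadjoint_real(1)[OF nat_pow_closed[OF a(1)] adj_power[OF a], of k] by (simp add: complex_eq_iff)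
  have "\<exists>\<mu>. real_distribution \<mu> \<and> (\<forall>k. integrable \<mu> (\<lambda>x. x ^ k) \<and> (\<integral>x. x ^ k \<partial>\<mu>) = Re (h (?a [^]\<^bsub>A\<^esub> k)))"
    by (rule moment_sequence_measure[OF _ haar_hankel[OF a] partial_trace_moment_bound[OF s]])
      (simp add: haar_state(4))
  then obtain \<mu> where \<mu>: "real_distribution \<mu>" "\<And>k. integrable \<mu> (\<lambda>x. x ^ k)"
    "\<And>k. (\<integral>x. x ^ k \<partial>\<mu>) = Re (h (?a [^]\<^bsub>A\<^esub> k))" by blast
  have law_iff: "is_law A h ?a \<nu> \<longleftrightarrow> real_distribution \<nu> \<and> (\<forall>k. integrable \<nu> (\<lambda>x. x ^ k)) \<and>
      (\<forall>k. (\<integral>x. x ^ k \<partial>\<nu>) = Re (h (?a [^]\<^bsub>A\<^esub> k)))" for \<nu>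
    unfolding is_law_def by (subst real) auto
  have "is_law A h ?a \<mu>" using \<mu> by (simp add: law_iff)
  moreover have "\<nu> = \<mu>" if "is_law A h ?a \<nu>" for \<nu>
  proof -
    have \<nu>: "real_distribution \<nu>" "\<And>k. integrable \<nu> (\<lambda>x. x ^ k)"
      "\<And>k. (\<integral>x. x ^ k \<partial>\<nu>) = Re (h (?a [^]\<^bsub>A\<^esub> k))"
      using that by (simp_all add: law_iff)
    show ?thesis
      by (rule moments_determine_measure[OF \<nu>(1) \<mu>(1) \<nu>(2) \<mu>(2), where C = 1 and R = "2 ^ Suc s"])
        (use partial_trace_moment_bound[OF s] in \<open>simp_all only: \<nu>(3) \<mu>(3)\<close>)
  qed
  ultimately show ?thesis unfolding law_def by (rule theI)
qed

lemma partial_trace_power: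
  fixes \<phi> :: "'a \<Rightarrow> 'b::ab_group_add"
  assumes s: "s \<le> n" and "additive_on A \<phi>"
  shows "\<phi> (partial_trace A u s [^]\<^bsub>A\<^esub> k) = (\<Sum>w\<in>words s k. \<phi> (uword A u w w))"
  using assms(2)
proof (induction k arbitrary: \<phi>)
  case (Suc k)
  let ?a = "partial_trace A u s"
  have a: "?a \<in> carrier A" by (rule partial_trace_closed[OF s])
  have u: "u i i \<in> carrier A" if "i \<in> {1..s}" for i
    using that s by (intro u_closed) auto
  have "\<phi> (?a [^]\<^bsub>A\<^esub> Suc k) = (\<lambda>z. \<phi> (z \<otimes>\<^bsub>A\<^esub> ?a [^]\<^bsub>A\<^esub> k)) (\<Oplus>\<^bsub>A\<^esub>i\<in>{1..s}. u i i)"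
    using nat_pow_Suc2[OF a, of k] by (simp only: partial_trace_def)
  also have "\<dots> = (\<Sum>i\<in>{1..s}. \<phi> (u i i \<otimes>\<^bsub>A\<^esub> ?a [^]\<^bsub>A\<^esub> k))"
    by (rule additive_on_finsum[OF additive_on_mult_right[OF Suc.prems nat_pow_closed[OF a]]]) (use u in auto)
  also have "\<dots> = (\<Sum>i\<in>{1..s}. \<Sum>w\<in>words s k. \<phi> (u i i \<otimes>\<^bsub>A\<^esub> uword A u w w))"
    by (rule sum.cong[OF refl]) (rule Suc.IH[OF additive_on_mult_left[OF Suc.prems u]])
  also have "\<dots> = (\<Sum>w\<in>words s (Suc k). \<phi> (uword A u w w))"
    by (simp only: sum_words_Suc uword.simps)
  finally show ?case .
qed simp

text \<open>One \<open>W\<close> serves all \<open>s\<close>: the partial trace restricts the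
  letters of words to \<open>{1..s}\<close>, while \<open>W\<close> inverts the Gram matrix counted
  with all \<open>n\<close> letters.\<close>

theorem partial_trace_moment:
  assumes k: "k + 2 \<le> n"
  shows "\<exists>W :: nat list \<Rightarrow> nat list \<Rightarrow> complex.
    (\<forall>s\<le>n. h (partial_trace A u s [^]\<^bsub>A\<^esub> k) =
      (\<Sum>c\<in>even_codes k. \<Sum>e\<in>even_codes k. W c e * of_nat (card (joint_words s k c e)))) \<and>
    (\<forall>c\<in>even_codes k. \<forall>d\<in>even_codes k.
      (\<Sum>e\<in>even_codes k. W c e * of_nat (card (joint_words n k e d))) = of_bool (c = d))"
proof -
  obtain W where W: "(\<forall>w\<in>words n k. \<forall>w'\<in>words n k. coeff w w' =
      (\<Sum>c\<in>even_codes k. \<Sum>e\<in>even_codes k. W c e * of_bool (compat c w) * of_bool (compat e w'))) \<and>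
    (\<forall>c\<in>even_codes k. \<forall>d\<in>even_codes k.
      (\<Sum>e\<in>even_codes k. W c e * of_nat (card (joint_words n k e d))) = of_bool (c = d))"
    using weingarten[OF k] by (elim exE) (rule that)
  have expand: "coeff w w' =
      (\<Sum>c\<in>even_codes k. \<Sum>e\<in>even_codes k. W c e * of_bool (compat c w) * of_bool (compat e w'))"
    if "w \<in> words n k" "w' \<in> words n k" for w w'
    by (rule bspec[OF bspec[OF conjunct1[OF W] that(1)] that(2)])
  have "h (partial_trace A u s [^]\<^bsub>A\<^esub> k) =
      (\<Sum>c\<in>even_codes k. \<Sum>e\<in>even_codes k. W c e * of_nat (card (joint_words s k c e)))"
    if s: "s \<le> n" for s
  proof -
    have sub: "w \<in> words n k" if "w \<in> words s k" for w
      using that s by (auto simp: words_def)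
    have "h (partial_trace A u s [^]\<^bsub>A\<^esub> k) = (\<Sum>w\<in>words s k. coeff w w)"
      by (simp only: partial_trace_power[OF s haar_state(1)] coeff_def)
    also have "\<dots> = (\<Sum>w\<in>words s k. \<Sum>c\<in>even_codes k. \<Sum>e\<in>even_codes k.
        W c e * of_bool (compat c w \<and> compat e w))"
      by (rule sum.cong[OF refl]) (simp add: expand sub of_bool_conj mult.assoc)
    also have "\<dots> = (\<Sum>c\<in>even_codes k. \<Sum>e\<in>even_codes k. \<Sum>w\<in>words s k. W c e * of_bool (compat c w \<and> compat e w))"
      by (subst sum.swap) (rule sum.cong[OF refl], rule sum.swap)
    also have "\<dots> = (\<Sum>c\<in>even_codes k. \<Sum>e\<in>even_codes k. W c e * of_nat (card (joint_words s k c e)))"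
    proof (intro sum.cong[OF refl])
      fix c e
      have "(\<Sum>w\<in>words s k. of_bool (compat c w \<and> compat e w)) = (\<Sum>w\<in>joint_words s k c e. 1 :: complex)"
        unfolding joint_words_def of_bool_def by (rule sum.inter_filter[OF finite_words, symmetric])
      then show "(\<Sum>w\<in>words s k. W c e * of_bool (compat c w \<and> compat e w)) = W c e * of_nat (card (joint_words s k c e))"
        by (simp only: sum_distrib_left[symmetric]) simp
    qed
    finally show ?thesis .
  qed
  then show ?thesis by (intro exI[of _ W] conjI allI impI conjunct2[OF W])
qed

end

section \<open>Asymptotics\<close>

text \<open>From \<open>X G = 1\<close> follows \<open>1 - X = X (G - 1)\<close>, so a row of
  \<open>X\<close> is close to that of the identity once its norm \<open>S\<close> is bounded. The
  same identity yields this bound, since it estimates \<open>S\<close> by 1 plus a small multiple of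
  \<open>S\<close>.\<close>

lemma approximate_inverse_tendsto:
  fixes X G :: "nat \<Rightarrow> 'c \<Rightarrow> 'c \<Rightarrow> complex"
  assumes "finite C"
    and inverse: "eventually (\<lambda>n. \<forall>c\<in>C. \<forall>d\<in>C. (\<Sum>e\<in>C. X n c e * G n e d) = of_bool (c = d)) sequentially"
    and lim: "\<And>c d. c \<in> C \<Longrightarrow> d \<in> C \<Longrightarrow> (\<lambda>n. G n c d) \<longlonglongrightarrow> of_bool (c = d)"
    and c: "c \<in> C" and d: "d \<in> C"
  shows "(\<lambda>n. X n c d) \<longlonglongrightarrow> of_bool (c = d)"
proof -
  define \<epsilon> where "\<epsilon> n = (\<Sum>e\<in>C. \<Sum>d\<in>C. norm (G n e d - of_bool (e = d)))" for n
  have "\<epsilon> \<longlonglongrightarrow> (\<Sum>e\<in>C. \<Sum>d\<in>C. 0)"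
    unfolding \<epsilon>_def by (intro tendsto_sum tendsto_norm_zero) (simp add: LIM_zero lim)
  then have \<epsilon>_lim: "\<epsilon> \<longlonglongrightarrow> 0" by simp
  have "0 < card C" using c \<open>finite C\<close> by (auto simp: card_gt_0_iff)
  \<comment> \<open>Below this threshold the row norm satisfies \<open>S \<le> 1 + S / 2\<close>,
    hence \<open>S \<le> 2\<close>.\<close>
  then have "eventually (\<lambda>n. \<epsilon> n < 1 / (2 * real (card C))) sequentially"
    using \<epsilon>_lim by (intro order_tendstoD(2)) auto
  with inverse have "eventually (\<lambda>n. norm (X n c d - of_bool (c = d)) \<le> 2 * \<epsilon> n) sequentially"
  proof eventually_elim
    case (elim n)
    define S where "S = (\<Sum>e\<in>C. norm (X n c e))"
    have S: "0 \<le> S" unfolding S_def by (simp add: sum_nonneg)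
    have entry: "norm (G n e f - of_bool (e = f)) \<le> \<epsilon> n" if "e \<in> C" "f \<in> C" for e f
    proof -
      have "norm (G n e f - of_bool (e = f)) \<le> (\<Sum>f\<in>C. norm (G n e f - of_bool (e = f)))"
        using that(2) \<open>finite C\<close> by (intro member_le_sum[of f C "\<lambda>f. norm (G n e f - of_bool (e = f))"]) auto
      also have "\<dots> \<le> \<epsilon> n"
        unfolding \<epsilon>_def using that(1) \<open>finite C\<close>
        by (intro member_le_sum[of e C "\<lambda>e. \<Sum>f\<in>C. norm (G n e f - of_bool (e = f))"]) (auto intro: sum_nonneg)
      finally show ?thesis .
    qed
    have diff: "norm (X n c f - of_bool (c = f)) \<le> S * \<epsilon> n" if f: "f \<in> C" for f
    proof -
      have "(\<Sum>e\<in>C. X n c e * of_bool (e = f)) = X n c f"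
        using f \<open>finite C\<close> by (simp add: of_bool_def if_distrib[of "\<lambda>x. _ * x"] cong: if_cong)
      then have "of_bool (c = f) - X n c f = (\<Sum>e\<in>C. X n c e * (G n e f - of_bool (e = f)))"
        using elim(1) c f by (simp add: right_diff_distrib sum_subtractf)
      then have "norm (X n c f - of_bool (c = f)) = norm (\<Sum>e\<in>C. X n c e * (G n e f - of_bool (e = f)))"
        by (simp add: norm_minus_commute)
      also have "\<dots> \<le> (\<Sum>e\<in>C. norm (X n c e) * \<epsilon> n)"
      proof (rule sum_norm_le)
        fix e assume e: "e \<in> C"
        show "norm (X n c e * (G n e f - of_bool (e = f))) \<le> norm (X n c e) * \<epsilon> n"
          unfolding norm_mult by (rule mult_left_mono[OF entry[OF e f] norm_ge_zero])
      qed
      finally show ?thesis by (simp add: S_def sum_distrib_right)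
    qed
    have "S \<le> (\<Sum>f\<in>C. of_bool (c = f) + S * \<epsilon> n)"
      unfolding S_def
    proof (rule sum_mono)
      fix f assume f: "f \<in> C"
      have "norm (X n c f) \<le> norm (of_bool (c = f) :: complex) + norm (X n c f - of_bool (c = f))"
        by (metis norm_triangle_sub)
      moreover have "norm (of_bool (c = f) :: complex) = of_bool (c = f)" by simp
      ultimately show "norm (X n c f) \<le> of_bool (c = f) + (\<Sum>e\<in>C. norm (X n c e)) * \<epsilon> n"
        using diff[OF f] unfolding S_def by linarith
    qed
    also have "\<dots> = 1 + S * (real (card C) * \<epsilon> n)"
      using c \<open>finite C\<close> by (simp add: sum.distrib of_bool_def)
    finally have "S \<le> 1 + S * (real (card C) * \<epsilon> n)" .
    moreover have "real (card C) * \<epsilon> n \<le> 1 / 2"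
      using elim(2) \<open>0 < card C\<close> by (simp add: field_simps)
    then have "S * (real (card C) * \<epsilon> n) \<le> S * (1 / 2)" by (rule mult_left_mono[OF _ S])
    ultimately have "S \<le> 2" by linarith
    moreover have "0 \<le> \<epsilon> n" unfolding \<epsilon>_def by (simp add: sum_nonneg)
    ultimately have "S * \<epsilon> n \<le> 2 * \<epsilon> n" by (rule mult_right_mono)
    with diff[OF d] show ?case by simp
  qed
  moreover have "(\<lambda>n. 2 * \<epsilon> n) \<longlonglongrightarrow> 0"
    using tendsto_mult_right_zero[OF \<epsilon>_lim, of 2] .
  ultimately have "(\<lambda>n. X n c d - of_bool (c = d)) \<longlonglongrightarrow> 0"
    by (rule Lim_null_comparison)
  then show ?thesis by (rule LIM_zero_cancel)
qed

lemma joint_words_mono: "s \<le> n \<Longrightarrow> joint_words s k c d \<subseteq> joint_words n k c d"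
  by (auto simp: joint_words_def words_def)

lemma card_joint_words_same: "c \<in> even_codes k \<Longrightarrow> card (joint_words n k c c) = n ^ blocks c"
  using card_compat_words[of c k n] by (simp add: joint_words_def)

lemma normalised_joint_words_bound:
  assumes "c \<in> even_codes k" "d \<in> even_codes k" "c \<noteq> d" and "0 < n" and "s \<le> n"
  shows "real (card (joint_words s k c d)) / (sqrt (real n) ^ blocks c * sqrt (real n) ^ blocks d) \<le> 1 / sqrt (real n)"
proof -
  define D where "D = sqrt (real n) ^ blocks c * sqrt (real n) ^ blocks d"
  define N where "N = real (card (joint_words n k c d))"
  define r where "r = sqrt (real n)"
  have r: "0 < r" "r\<^sup>2 = real n" using assms(4) by (simp_all add: r_def)
  have D: "0 < D" unfolding D_def r_def[symmetric] using r(1) by simp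
  have "(r ^ b)\<^sup>2 = real n ^ b" for b
    by (simp only: power_mult[symmetric] mult.commute[of b 2]) (simp only: power_mult r(2))
  then have D2: "D\<^sup>2 = real n ^ blocks c * real n ^ blocks d"
    unfolding D_def r_def[symmetric] by (simp only: power_mult_distrib)
  have "real (n * (card (joint_words n k c d))\<^sup>2) \<le> real (n ^ blocks c * n ^ blocks d)"
    by (rule of_nat_mono) (rule card_joint_words_distinct[OF assms(1-3)])
  then have "(r * N)\<^sup>2 \<le> D\<^sup>2"
    by (simp only: power_mult_distrib r(2) D2 N_def of_nat_mult of_nat_power)
  then have "r * N \<le> D" by (rule power2_le_imp_le) (rule less_imp_le[OF D])
  then have "N / D \<le> 1 / r" using D r(1) by (simp add: field_simps)
  moreover have "real (card (joint_words s k c d)) \<le> N"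
    unfolding N_def by (rule of_nat_mono) (rule card_mono[OF finite_joint_words joint_words_mono[OF assms(5)]])
  then have "real (card (joint_words s k c d)) / D \<le> N / D"
    using D by (intro divide_right_mono) auto
  ultimately show ?thesis unfolding D_def[symmetric] unfolding r_def[symmetric] by linarith
qed

lemma normalised_joint_words_tendsto:
  assumes c: "c \<in> even_codes k" and d: "d \<in> even_codes k"
    and s: "\<And>n. s n \<le> n" and lim: "(\<lambda>n. real (s n) / real n) \<longlonglongrightarrow> t"
  shows "(\<lambda>n. real (card (joint_words (s n) k c d)) / (sqrt (real n) ^ blocks c * sqrt (real n) ^ blocks d))
    \<longlonglongrightarrow> (if c = d then t ^ blocks c else 0)"
proof (cases "c = d")
  case True
  have "(\<lambda>n. (real (s n) / real n) ^ blocks c) \<longlonglongrightarrow> t ^ blocks c"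
    by (intro tendsto_power lim)
  moreover have "(real (s n) / real n) ^ blocks c =
      real (card (joint_words (s n) k c c)) / (sqrt (real n) ^ blocks c * sqrt (real n) ^ blocks c)" for n
  proof -
    have "sqrt (real n) ^ blocks c * sqrt (real n) ^ blocks c = real n ^ blocks c"
      by (subst power_mult_distrib[symmetric]) simp
    then show ?thesis
      by (simp only: card_joint_words_same[OF c] power_divide of_nat_power)
  qed
  ultimately have "(\<lambda>n. real (card (joint_words (s n) k c c)) / (sqrt (real n) ^ blocks c * sqrt (real n) ^ blocks c))
    \<longlonglongrightarrow> t ^ blocks c" by (simp only:)
  then show ?thesis unfolding True[symmetric] by (simp only: simp_thms if_True)
next
  case False
  have "(\<lambda>n. real (card (joint_words (s n) k c d)) / (sqrt (real n) ^ blocks c * sqrt (real n) ^ blocks d)) \<longlonglongrightarrow> 0"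
  proof (rule Lim_null_comparison)
    show "\<forall>\<^sub>F n in sequentially. norm (real (card (joint_words (s n) k c d)) /
        (sqrt (real n) ^ blocks c * sqrt (real n) ^ blocks d)) \<le> 1 / sqrt (real n)"
      using eventually_gt_at_top[of 0]
    proof eventually_elim
      case (elim n)
      have "0 \<le> real (card (joint_words (s n) k c d)) / (sqrt (real n) ^ blocks c * sqrt (real n) ^ blocks d)"
        by (intro divide_nonneg_nonneg mult_nonneg_nonneg zero_le_power) auto
      from abs_of_nonneg[OF this] normalised_joint_words_bound[OF c d False elim s] show ?case
        by (simp only: real_norm_def)
    qed
    show "(\<lambda>n. 1 / sqrt (real n)) \<longlonglongrightarrow> 0"
      using tendsto_real_sqrt[OF lim_1_over_n[where 'a = real]]
      by (simp only: real_sqrt_divide real_sqrt_one real_sqrt_zero)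
  qed
  then show ?thesis using False by simp
qed

text \<open>The factors \<open>D\<close> cancel between \<open>X\<close> and \<open>H\<close>, so
  the sum is unchanged, but the normalised Gram matrix tends to the identity. Then \<open>X\<close>
  does too, and only the diagonal of \<open>H\<close> survives, with limit
  \<open>t ^ blocks c\<close>.\<close>

lemma weingarten_sum_tendsto:
  fixes W :: "nat \<Rightarrow> nat list \<Rightarrow> nat list \<Rightarrow> complex"
  assumes inverse: "eventually (\<lambda>n. \<forall>c\<in>even_codes k. \<forall>d\<in>even_codes k.
      (\<Sum>e\<in>even_codes k. W n c e * of_nat (card (joint_words n k e d))) = of_bool (c = d)) sequentially"
    and s: "\<And>n. s n \<le> n" and lim: "(\<lambda>n. real (s n) / real n) \<longlonglongrightarrow> t"
  shows "(\<lambda>n. \<Sum>c\<in>even_codes k. \<Sum>e\<in>even_codes k. W n c e * of_nat (card (joint_words (s n) k c e)))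
    \<longlonglongrightarrow> complex_of_real (\<Sum>c\<in>even_codes k. t ^ blocks c)"
proof -
  let ?E = "even_codes k"
  define D where "D n c = complex_of_real (sqrt (real n) ^ blocks c)" for n c
  define X where "X n c e = D n c * W n c e * D n e" for n c e
  define H where "H s n c e = of_nat (card (joint_words (s n) k c e)) / (D n c * D n e)" for s n c e
  have D: "D n c \<noteq> 0" if "0 < n" for n c using that by (simp add: D_def)
  have H_lim: "(\<lambda>n. H s n c e) \<longlonglongrightarrow> complex_of_real (if c = e then t ^ blocks c else 0)"
    if "c \<in> ?E" "e \<in> ?E" "\<And>n. s n \<le> n" "(\<lambda>n. real (s n) / real n) \<longlonglongrightarrow> t" for c e s t
    using tendsto_of_real[OF normalised_joint_words_tendsto[OF that], where 'a = complex]
    by (simp only: H_def D_def of_real_divide of_real_mult of_real_of_nat_eq)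
  \<comment> \<open>At \<open>n = 0\<close> the normalising factors may vanish.\<close>
  have pos: "eventually (\<lambda>n. 0 < n) sequentially" by (rule eventually_gt_at_top)
  have X_lim: "(\<lambda>n. X n c e) \<longlonglongrightarrow> of_bool (c = e)" if "c \<in> ?E" "e \<in> ?E" for c e
  proof (rule approximate_inverse_tendsto[where G = "H (\<lambda>n. n)", OF finite_codes(1) _ _ that])
    show "eventually (\<lambda>n. \<forall>c\<in>?E. \<forall>d\<in>?E. (\<Sum>e\<in>?E. X n c e * H (\<lambda>n. n) n e d) = of_bool (c = d)) sequentially"
      using inverse pos
    proof eventually_elim
      case (elim n)
      have "(\<Sum>e\<in>?E. X n c e * H (\<lambda>n. n) n e d) = of_bool (c = d)" if "c \<in> ?E" "d \<in> ?E" for c d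
      proof -
        have "(\<Sum>e\<in>?E. X n c e * H (\<lambda>n. n) n e d) =
            (\<Sum>e\<in>?E. D n c / D n d * (W n c e * of_nat (card (joint_words n k e d))))"
          using D[OF elim(2)] by (intro sum.cong) (simp_all add: X_def H_def)
        also have "\<dots> = D n c / D n d * of_bool (c = d)"
          using elim(1) that by (simp only: sum_distrib_left[symmetric])
        also have "\<dots> = of_bool (c = d)"
          using D[OF elim(2), of d] by (cases "c = d") simp_all
        finally show ?thesis .
      qed
      then show ?case by blast
    qed
    have "(\<lambda>n. real n / real n) \<longlonglongrightarrow> 1"
    proof (rule Lim_transform_eventually[OF tendsto_const])
      show "\<forall>\<^sub>F n in sequentially. 1 = real n / real n"
        using pos by eventually_elim simp
    qed
    then show "(\<lambda>n. H (\<lambda>n. n) n c d) \<longlonglongrightarrow> of_bool (c = d)" if "c \<in> ?E" "d \<in> ?E" for c d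
      using H_lim[OF that, of "\<lambda>n. n" 1] by (simp add: of_bool_def if_distrib cong: if_cong)
  qed
  have "(\<lambda>n. \<Sum>c\<in>?E. \<Sum>e\<in>?E. X n c e * H s n c e) \<longlonglongrightarrow>
      (\<Sum>c\<in>?E. \<Sum>e\<in>?E. of_bool (c = e) * complex_of_real (if c = e then t ^ blocks c else 0))"
    by (intro tendsto_sum tendsto_mult X_lim H_lim s lim)
  also have "(\<Sum>c\<in>?E. \<Sum>e\<in>?E. of_bool (c = e) * complex_of_real (if c = e then t ^ blocks c else 0)) =
      complex_of_real (\<Sum>c\<in>?E. t ^ blocks c)"
  proof -
    have "(\<Sum>e\<in>?E. of_bool (c = e) * complex_of_real (if c = e then t ^ blocks c else 0)) = complex_of_real (t ^ blocks c)"
      if "c \<in> ?E" for c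
    proof -
      have "(\<Sum>e\<in>?E. of_bool (c = e) * complex_of_real (if c = e then t ^ blocks c else 0)) =
          (\<Sum>e\<in>?E. if c = e then complex_of_real (t ^ blocks c) else 0)"
        by (rule sum.cong) simp_all
      then show ?thesis using that finite_codes(1)[of k] by simp
    qed
    then show ?thesis by simp
  qed
  finally have "(\<lambda>n. \<Sum>c\<in>?E. \<Sum>e\<in>?E. X n c e * H s n c e) \<longlonglongrightarrow> complex_of_real (\<Sum>c\<in>?E. t ^ blocks c)" .
  moreover have "eventually (\<lambda>n. (\<Sum>c\<in>?E. \<Sum>e\<in>?E. X n c e * H s n c e) =
      (\<Sum>c\<in>?E. \<Sum>e\<in>?E. W n c e * of_nat (card (joint_words (s n) k c e)))) sequentially"
    using pos
  proof eventually_elim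
    case (elim n)
    show ?case
      using D[OF elim] by (intro sum.cong refl) (simp add: X_def H_def)
  qed
  ultimately show ?thesis by (rule Lim_transform_eventually)
qed

section \<open>The limit of the moments and its measure\<close>

lemma floor_ratio_tendsto:
  fixes t :: real
  assumes "0 \<le> t"
  shows "(\<lambda>n. real (nat \<lfloor>t * real n\<rfloor>) / real n) \<longlonglongrightarrow> t"
proof (rule tendsto_sandwich)
  show "\<forall>\<^sub>F n in sequentially. t - 1 / real n \<le> real (nat \<lfloor>t * real n\<rfloor>) / real n"
    using eventually_gt_at_top[of 0]
  proof eventually_elim
    case (elim n)
    have "t * real n - 1 \<le> real (nat \<lfloor>t * real n\<rfloor>)" using assms by linarith
    then have "(t * real n - 1) / real n \<le> real (nat \<lfloor>t * real n\<rfloor>) / real n"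
      by (rule divide_right_mono) simp
    then show ?case using elim by (simp add: diff_divide_distrib)
  qed
  show "\<forall>\<^sub>F n in sequentially. real (nat \<lfloor>t * real n\<rfloor>) / real n \<le> t"
    using eventually_gt_at_top[of 0]
  proof eventually_elim
    case (elim n)
    have "real (nat \<lfloor>t * real n\<rfloor>) \<le> t * real n" using assms by simp
    then have "real (nat \<lfloor>t * real n\<rfloor>) / real n \<le> t * real n / real n"
      by (rule divide_right_mono) simp
    then show ?case using elim by simp
  qed
  show "(\<lambda>n. t - 1 / real n) \<longlonglongrightarrow> t"
    using tendsto_diff[OF tendsto_const lim_1_over_n, of t] by simp
qed simp

text \<open>For \<open>k = 2 * j\<close>, bounding both binomial coefficients of the closed formula
  by powers of 2 gives \<open>j * 2 ^ (j - 1) * 2 ^ (2 * j)\<close>, which is at most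
  \<open>4 ^ k\<close>. This growth makes the limit measure determined by its moments.\<close>

lemma sum_even_codes_bound:
  fixes t :: real
  assumes "0 \<le> t" "t \<le> 1"
  shows "\<bar>\<Sum>c\<in>even_codes k. t ^ blocks c\<bar> \<le> 1 * 4 ^ k"
proof (cases "even k")
  case False
  then show ?thesis by (simp add: even_codes_odd_empty)
next
  case True
  then obtain j where j: "k = 2 * j" by blast
  show ?thesis
  proof (cases "j = 0")
    case True
    then show ?thesis by (simp add: j even_codes_0)
  next
    case False
    have choose: "real (m choose i) \<le> 2 ^ m" for m i
    proof (cases "i \<le> m")
      case True
      then have "m choose i \<le> (\<Sum>i\<le>m. m choose i)"
        by (intro member_le_sum) auto
      then show ?thesis by (simp add: choose_row_sum flip: of_nat_power)
    next
      case False
      then show ?thesis by (simp add: binomial_eq_0)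
    qed
    have "\<bar>\<Sum>c\<in>even_codes k. t ^ blocks c\<bar> = (\<Sum>c\<in>even_codes k. t ^ blocks c)"
      using assms by (simp add: sum_nonneg)
    also have "\<dots> = (\<Sum>b = 1..j. 1 / real b * real ((j - 1) choose (b - 1)) * real ((2 * j) choose (b - 1)) * t ^ b)"
      unfolding j using False by (intro sum_even_codes) simp
    also have "\<dots> \<le> (\<Sum>b = 1..j. 1 * 2 ^ (j - 1) * 2 ^ (2 * j) * 1)"
      using assms by (intro sum_mono mult_mono choose) (auto simp: power_le_one divide_le_eq)
    also have "\<dots> = real j * (2 ^ (j - 1) * 2 ^ (2 * j))" by simp
    also have "\<dots> \<le> 2 ^ j * (2 ^ j * 2 ^ (2 * j))"
    proof (intro mult_mono)
      show "real j \<le> 2 ^ j" by (rule order_less_imp_le) (rule of_nat_less_two_power)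
      show "(2 :: real) ^ (j - 1) \<le> 2 ^ j" by (intro power_increasing) auto
    qed simp_all
    also have "\<dots> = (2 ^ j * 2 ^ j) * 2 ^ (2 * j)" by (simp only: mult.assoc)
    also have "\<dots> = 4 ^ j * 4 ^ j"
      by (simp only: power_mult_distrib[symmetric] power_mult) simp
    also have "\<dots> = 4 ^ k" by (simp only: j mult_2 power_add)
    finally show ?thesis by simp
  qed
qed

theorem mainTheorem17:
  fixes t :: real
    and A :: "nat \<Rightarrow> 'a cstar" and u :: "nat \<Rightarrow> nat \<Rightarrow> nat \<Rightarrow> 'a"
    and T :: "nat \<Rightarrow> 'c cstar" and \<tau> :: "nat \<Rightarrow> 'a \<Rightarrow> 'a \<Rightarrow> 'c"
    and \<Delta> :: "nat \<Rightarrow> 'a \<Rightarrow> 'c" and h :: "nat \<Rightarrow> 'a \<Rightarrow> complex"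
    and \<nu> :: "nat \<Rightarrow> real measure"
  assumes "0 < t" and "t \<le> 1"
    and "\<And>n. n \<ge> 1 \<Longrightarrow> is_A_h n (A n) (u n)"
    and "\<And>n. n \<ge> 1 \<Longrightarrow> cstar_tensor_product (A n) (A n) (T n) (\<tau> n)"
    and "\<And>n. n \<ge> 1 \<Longrightarrow> is_comult n (A n) (u n) (T n) (\<tau> n) (\<Delta> n)"
    and "\<And>n. n \<ge> 1 \<Longrightarrow> is_haar (A n) (T n) (\<tau> n) (\<Delta> n) (h n)"
  defines "\<nu> \<equiv> \<lambda>n. law (A n) (h n) (partial_trace (A n) (u n) (nat \<lfloor>t * real n\<rfloor>))"
  shows "\<exists>\<mu>. converges_in_moments \<nu> \<mu> \<and>
           (\<forall>\<mu>'. converges_in_moments \<nu> \<mu>' \<longrightarrow> \<mu>' = \<mu>) \<and>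
           (\<forall>k\<ge>1. (\<integral>x. x ^ (2 * k) \<partial>\<mu>) =
              (\<Sum>b = 1..k. 1 / real b * real ((k - 1) choose (b - 1)) *
                 real ((2 * k) choose (b - 1)) * t ^ b)) \<and>
           (\<forall>k. odd k \<longrightarrow> (\<integral>x. x ^ k \<partial>\<mu>) = 0)"
proof -
  define s where "s n = nat \<lfloor>t * real n\<rfloor>" for n
  define a where "a n = partial_trace (A n) (u n) (s n)" for n
  define m where "m k = (\<Sum>c\<in>even_codes k. t ^ blocks c)" for k
  have s_le: "s n \<le> n" for n
  proof -
    have "t * real n \<le> real n" using assms(1,2) by (simp add: mult_left_le_one_le)
    then show ?thesis by (simp add: s_def) linarith
  qed
  have s_lim: "(\<lambda>n. real (s n) / real n) \<longlonglongrightarrow> t"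
    unfolding s_def using assms(1) by (intro floor_ratio_tendsto) simp
  have haar: "haar_cubic n (A n) (u n) (T n) (\<tau> n) (\<Delta> n) (h n)" if "1 \<le> n" for n
    using assms(3-6)[OF that] by (rule haar_cubic.intro)
  have law: "is_law (A n) (h n) (a n) (\<nu> n)" if "1 \<le> n" for n
    using haar_cubic.law_partial_trace[OF haar[OF that] s_le] by (simp add: \<nu>_def a_def s_def)
  have moment_lim: "(\<lambda>n. h n (a n [^]\<^bsub>A n\<^esub> k)) \<longlonglongrightarrow> complex_of_real (m k)" for k :: nat
  proof -
    \<comment> \<open>The implication lets a matrix be chosen for every \<open>n\<close>, although
      the formula is available for large \<open>n\<close> only.\<close>
    have "\<exists>W. k + 2 \<le> n \<longrightarrow> (h n (a n [^]\<^bsub>A n\<^esub> k) =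
        (\<Sum>c\<in>even_codes k. \<Sum>e\<in>even_codes k. W c e * of_nat (card (joint_words (s n) k c e)))) \<and>
      (\<forall>c\<in>even_codes k. \<forall>d\<in>even_codes k.
        (\<Sum>e\<in>even_codes k. W c e * of_nat (card (joint_words n k e d))) = of_bool (c = d))" for n
    proof (cases "k + 2 \<le> n")
      case True
      then have "1 \<le> n" by simp
      from haar_cubic.partial_trace_moment[OF haar[OF this] True] obtain W where
        W: "(\<forall>s\<le>n. h n (partial_trace (A n) (u n) s [^]\<^bsub>A n\<^esub> k) =
            (\<Sum>c\<in>even_codes k. \<Sum>e\<in>even_codes k. W c e * of_nat (card (joint_words s k c e)))) \<and>
          (\<forall>c\<in>even_codes k. \<forall>d\<in>even_codes k.
            (\<Sum>e\<in>even_codes k. W c e * of_nat (card (joint_words n k e d))) = of_bool (c = d))"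
        by (rule exE)
      show ?thesis
        unfolding a_def
        by (rule exI[of _ W], rule impI, rule conjI[OF mp[OF spec[OF conjunct1[OF W]] s_le] conjunct2[OF W]])
    qed simp
    then have "\<forall>n. \<exists>W. k + 2 \<le> n \<longrightarrow> (h n (a n [^]\<^bsub>A n\<^esub> k) =
        (\<Sum>c\<in>even_codes k. \<Sum>e\<in>even_codes k. W c e * of_nat (card (joint_words (s n) k c e)))) \<and>
      (\<forall>c\<in>even_codes k. \<forall>d\<in>even_codes k.
        (\<Sum>e\<in>even_codes k. W c e * of_nat (card (joint_words n k e d))) = of_bool (c = d))" ..
    from choice[OF this] obtain W where W: "\<forall>n. k + 2 \<le> n \<longrightarrow> (h n (a n [^]\<^bsub>A n\<^esub> k) =
        (\<Sum>c\<in>even_codes k. \<Sum>e\<in>even_codes k. W n c e * of_nat (card (joint_words (s n) k c e)))) \<and>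
      (\<forall>c\<in>even_codes k. \<forall>d\<in>even_codes k.
        (\<Sum>e\<in>even_codes k. W n c e * of_nat (card (joint_words n k e d))) = of_bool (c = d))"
      by (rule exE)
    have large: "eventually (\<lambda>n. k + 2 \<le> n) sequentially" by (rule eventually_ge_at_top)
    have "(\<lambda>n. \<Sum>c\<in>even_codes k. \<Sum>e\<in>even_codes k. W n c e * of_nat (card (joint_words (s n) k c e)))
        \<longlonglongrightarrow> complex_of_real (m k)"
      unfolding m_def
    proof (rule weingarten_sum_tendsto[OF _ s_le s_lim])
      show "\<forall>\<^sub>F n in sequentially. \<forall>c\<in>even_codes k. \<forall>d\<in>even_codes k.
          (\<Sum>e\<in>even_codes k. W n c e * of_nat (card (joint_words n k e d))) = of_bool (c = d)"
      proof (rule eventually_mono[OF large])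
        fix n assume "k + 2 \<le> n"
        from conjunct2[OF mp[OF spec[OF W] this]] show "\<forall>c\<in>even_codes k. \<forall>d\<in>even_codes k.
          (\<Sum>e\<in>even_codes k. W n c e * of_nat (card (joint_words n k e d))) = of_bool (c = d)" .
      qed
    qed
    moreover have "\<forall>\<^sub>F n in sequentially. (\<Sum>c\<in>even_codes k. \<Sum>e\<in>even_codes k.
        W n c e * of_nat (card (joint_words (s n) k c e))) = h n (a n [^]\<^bsub>A n\<^esub> k)"
    proof (rule eventually_mono[OF large])
      fix n assume "k + 2 \<le> n"
      from conjunct1[OF mp[OF spec[OF W] this]] show "(\<Sum>c\<in>even_codes k. \<Sum>e\<in>even_codes k.
        W n c e * of_nat (card (joint_words (s n) k c e))) = h n (a n [^]\<^bsub>A n\<^esub> k)" by (rule sym)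
    qed
    ultimately show ?thesis by (rule Lim_transform_eventually)
  qed
  have Re_lim: "(\<lambda>n. Re (h n (a n [^]\<^bsub>A n\<^esub> k))) \<longlonglongrightarrow> m k" for k :: nat
    using tendsto_Re[OF moment_lim[of k]] by simp
  \<comment> \<open>Positivity passes from the Haar functionals to the limit of their moments; this
    produces the limit measure without an explicit description.\<close>
  have hankel: "0 \<le> (\<Sum>i\<le>N. \<Sum>j\<le>N. c i * c j * m (i + j))" for N and c :: "nat \<Rightarrow> real"
  proof (rule LIMSEQ_le_const)
    show "(\<lambda>n. \<Sum>i\<le>N. \<Sum>j\<le>N. c i * c j * Re (h n (a n [^]\<^bsub>A n\<^esub> (i + j)))) \<longlonglongrightarrow>
        (\<Sum>i\<le>N. \<Sum>j\<le>N. c i * c j * m (i + j))"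
      by (intro tendsto_sum tendsto_mult tendsto_const Re_lim)
    show "\<exists>n0. \<forall>n\<ge>n0. 0 \<le> (\<Sum>i\<le>N. \<Sum>j\<le>N. c i * c j * Re (h n (a n [^]\<^bsub>A n\<^esub> (i + j))))"
    proof (intro exI[of _ 1] allI impI)
      fix n :: nat assume n: "1 \<le> n"
      show "0 \<le> (\<Sum>i\<le>N. \<Sum>j\<le>N. c i * c j * Re (h n (a n [^]\<^bsub>A n\<^esub> (i + j))))"
        unfolding a_def
        by (rule haar_cubic.haar_hankel[OF haar[OF n]
              haar_cubic.partial_trace_closed[OF haar[OF n] s_le] haar_cubic.partial_trace_adj[OF haar[OF n] s_le]])
    qed
  qed
  have m0: "m 0 = 1" unfolding m_def even_codes_0 by simp
  have bound: "\<bar>m k\<bar> \<le> 1 * 4 ^ k" for k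
    unfolding m_def by (rule sum_even_codes_bound[OF less_imp_le[OF assms(1)] assms(2)])
  have "\<exists>\<mu>. real_distribution \<mu> \<and> (\<forall>k. integrable \<mu> (\<lambda>x. x ^ k) \<and> (\<integral>x. x ^ k \<partial>\<mu>) = m k)"
    by (rule moment_sequence_measure[OF m0 hankel bound])
  then obtain \<mu> where \<mu>: "real_distribution \<mu>" "\<And>k. integrable \<mu> (\<lambda>x. x ^ k)"
    "\<And>k. (\<integral>x. x ^ k \<partial>\<mu>) = m k" by blast
  \<comment> \<open>The algebras are given from \<open>n = 1\<close> on, so the moments of the laws
    agree with those of the Haar functionals eventually.\<close>
  have \<nu>_lim: "(\<lambda>n. \<integral>x. x ^ k \<partial>\<nu> n) \<longlonglongrightarrow> m k" for k :: nat
  proof (rule Lim_transform_eventually[OF Re_lim])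
    show "\<forall>\<^sub>F n in sequentially. Re (h n (a n [^]\<^bsub>A n\<^esub> k)) = (\<integral>x. x ^ k \<partial>\<nu> n)"
      using eventually_ge_at_top[of 1]
    proof eventually_elim
      case (elim n)
      then show ?case using law[OF elim] unfolding is_law_def by simp
    qed
  qed
  have "converges_in_moments \<nu> \<mu>"
    unfolding converges_in_moments_def \<mu>(3) by (intro conjI allI \<mu>(1,2) \<nu>_lim)
  moreover have "\<mu>' = \<mu>" if conv: "converges_in_moments \<nu> \<mu>'" for \<mu>'
  proof -
    note conv' = conv[unfolded converges_in_moments_def]
    have \<mu>': "real_distribution \<mu>'" by (rule conjunct1[OF conv'])
    have integrable': "integrable \<mu>' (\<lambda>x. x ^ k)" for k :: nat
      by (rule conjunct1[OF spec[OF conjunct2[OF conv']]])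
    have moments': "(\<integral>x. x ^ k \<partial>\<mu>') = m k" for k :: nat
      by (rule LIMSEQ_unique[OF conjunct2[OF spec[OF conjunct2[OF conv']]] \<nu>_lim])
    show ?thesis
    proof (rule moments_determine_measure[OF \<mu>' \<mu>(1) integrable' \<mu>(2)])
      show "(\<integral>x. x ^ k \<partial>\<mu>') = (\<integral>x. x ^ k \<partial>\<mu>)" for k by (simp only: moments' \<mu>(3))
      show "\<bar>\<integral>x. x ^ k \<partial>\<mu>'\<bar> \<le> 1 * 4 ^ k" for k unfolding moments' by (rule bound)
    qed
  qed
  moreover have "(\<integral>x. x ^ (2 * k) \<partial>\<mu>) = (\<Sum>b = 1..k. 1 / real b * real ((k - 1) choose (b - 1)) *
      real ((2 * k) choose (b - 1)) * t ^ b)" if "1 \<le> k" for k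
    unfolding \<mu>(3) m_def by (rule sum_even_codes[OF that])
  moreover have "(\<integral>x. x ^ k \<partial>\<mu>) = 0" if "odd k" for k
    unfolding \<mu>(3) m_def by (simp add: even_codes_odd_empty[OF that])
  ultimately show ?thesis by blast
qed

end
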